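(* Let $R$ be an $h$-local domain with field of fractions $Q$, and let $\Lambda$ be a locally semiperfect torsion-free $R$-algebra such that $\Lambda_Q=\Lambda\otimes_RQ$ is simple artinian. Then every two-sided ideal of $\Lambda$ that is the trace of a projective right (or left) $\Lambda$-module is also the trace of a finitely generated projective right $\Lambda$-module. In particular, $\mathcal{T}_r(\Lambda)=\mathcal{T}_\ell(\Lambda)$.
   Context: Rings are associative with $1$. A commutative domain $R$ is $h$-local if every non-zero element of $R$ is contained in only finitely many maximal ideals and every non-zero prime ideal of $R$ is contained in a unique maximal ideal. An $R$-algebra $\Lambda$ is torsion-free if it is torsion-free as an $R$-module; it is locally semiperfect if $\Lambda_{\mathfrak m}=\Lambda\otimes_R R_{\mathfrak m}$ is a semiperfect ring for every maximal ideal $\mathfrak m$ of $R$. The trace of a right (or left) $\Lambda$-module $M$ is the two-sided ideal $\mathrm{Tr}_\Lambda(M)=\sum_{f\in\mathrm{Hom}_\Lambda(M,\Lambda)}f(M)$. $\mathcal{T}_r(\Lambda)$ (resp. $\mathcal{T}_\ell(\Lambda)$) is the set of ideals of $\Lambda$ that are traces of countably generated projective right (resp. left) $\Lambda$-modules. *)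

theory Defs
  imports "HOL-Algebra.Module" "HOL-Algebra.QuotRing" "HOL-Algebra.Generated_Groups"
    "HOL-Library.Countable_Set" "HOL-Library.Poly_Mapping"
begin

section \<open>Modules over non-commutative rings\<close>

text \<open>The locale \<^locale>\<open>module\<close> of the library requires commutative scalars.  As there, a module is
  a record of type \<^typ>\<open>('a, 'm) module\<close> of which the fields \<open>mult\<close> and \<open>one\<close> are irrelevant.  The
  library's \<^locale>\<open>submodule\<close> does not need commutativity and is reused.\<close>

locale left_module = R?: ring R + M?: abelian_group M
  for R :: "('a, 'b) ring_scheme" (structure) and M :: "('a, 'm, 'c) module_scheme" (structure) +
  assumes smult_closed [simp, intro]:
      "\<lbrakk>a \<in> carrier R; x \<in> carrier M\<rbrakk> \<Longrightarrow> a \<odot>\<^bsub>M\<^esub> x \<in> carrier M"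
    and smult_l_distr:
      "\<lbrakk>a \<in> carrier R; b \<in> carrier R; x \<in> carrier M\<rbrakk> \<Longrightarrow>
        (a \<oplus> b) \<odot>\<^bsub>M\<^esub> x = a \<odot>\<^bsub>M\<^esub> x \<oplus>\<^bsub>M\<^esub> b \<odot>\<^bsub>M\<^esub> x"
    and smult_r_distr:
      "\<lbrakk>a \<in> carrier R; x \<in> carrier M; y \<in> carrier M\<rbrakk> \<Longrightarrow>
        a \<odot>\<^bsub>M\<^esub> (x \<oplus>\<^bsub>M\<^esub> y) = a \<odot>\<^bsub>M\<^esub> x \<oplus>\<^bsub>M\<^esub> a \<odot>\<^bsub>M\<^esub> y"
    and smult_assoc:
      "\<lbrakk>a \<in> carrier R; b \<in> carrier R; x \<in> carrier M\<rbrakk> \<Longrightarrow>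
        (a \<otimes> b) \<odot>\<^bsub>M\<^esub> x = a \<odot>\<^bsub>M\<^esub> (b \<odot>\<^bsub>M\<^esub> x)"
    and smult_one [simp]: "x \<in> carrier M \<Longrightarrow> \<one> \<odot>\<^bsub>M\<^esub> x = x"

definition opposite :: "('a, 'b) ring_scheme \<Rightarrow> 'a ring" where
  "opposite R = \<lparr>carrier = carrier R, mult = (\<lambda>x y. y \<otimes>\<^bsub>R\<^esub> x), one = \<one>\<^bsub>R\<^esub>,
                 zero = \<zero>\<^bsub>R\<^esub>, add = (\<oplus>\<^bsub>R\<^esub>)\<rparr>"

text \<open>A right module over \<open>R\<close> is a left module over the opposite ring; in the record of a right
  module, \<open>a \<odot> x\<close> stands for the product \<open>x a\<close>.  All notions below are defined for left modules
  and are applied to right modules through \<^const>\<open>opposite\<close>.\<close>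

definition regular_module :: "('a, 'b) ring_scheme \<Rightarrow> ('a, 'a) module" where
  "regular_module R = \<lparr>carrier = carrier R, mult = (\<otimes>\<^bsub>R\<^esub>), one = \<one>\<^bsub>R\<^esub>,
                       zero = \<zero>\<^bsub>R\<^esub>, add = (\<oplus>\<^bsub>R\<^esub>), smult = (\<otimes>\<^bsub>R\<^esub>)\<rparr>"

definition mod_hom ::
    "('a, 'b) ring_scheme \<Rightarrow> ('a, 'm, 'c) module_scheme \<Rightarrow> ('a, 'n, 'd) module_scheme \<Rightarrow> ('m \<Rightarrow> 'n) set"
  where
  "mod_hom R M N = {f \<in> carrier M \<rightarrow> carrier N.
     (\<forall>x \<in> carrier M. \<forall>y \<in> carrier M. f (x \<oplus>\<^bsub>M\<^esub> y) = f x \<oplus>\<^bsub>N\<^esub> f y) \<and>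
     (\<forall>a \<in> carrier R. \<forall>x \<in> carrier M. f (a \<odot>\<^bsub>M\<^esub> x) = a \<odot>\<^bsub>N\<^esub> f x)}"

definition mod_span :: "('a, 'b) ring_scheme \<Rightarrow> ('a, 'm, 'c) module_scheme \<Rightarrow> 'm set \<Rightarrow> 'm set" where
  "mod_span R M X = carrier M \<inter> \<Inter>{H. submodule H R M \<and> X \<subseteq> H}"

definition finitely_generated where
  "finitely_generated R M \<longleftrightarrow> (\<exists>X. X \<subseteq> carrier M \<and> finite X \<and> mod_span R M X = carrier M)"

definition countably_generated where
  "countably_generated R M \<longleftrightarrow> (\<exists>X. X \<subseteq> carrier M \<and> countable X \<and> mod_span R M X = carrier M)"

definition free_module :: "('a, 'b) ring_scheme \<Rightarrow> 'k set \<Rightarrow> ('a, 'k \<Rightarrow> 'a) module" where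
  "free_module R K =
    \<lparr>carrier = {f. (\<forall>k. f k \<in> carrier R) \<and> (\<forall>k. k \<notin> K \<longrightarrow> f k = \<zero>\<^bsub>R\<^esub>) \<and> finite {k. f k \<noteq> \<zero>\<^bsub>R\<^esub>}},
     mult = (\<lambda>f g k. f k \<otimes>\<^bsub>R\<^esub> g k), one = (\<lambda>k. \<one>\<^bsub>R\<^esub>), zero = (\<lambda>k. \<zero>\<^bsub>R\<^esub>),
     add = (\<lambda>f g k. f k \<oplus>\<^bsub>R\<^esub> g k), smult = (\<lambda>a f k. a \<otimes>\<^bsub>R\<^esub> f k)\<rparr>"

definition summand_of where
  "summand_of R M F \<longleftrightarrow>
    (\<exists>i \<in> mod_hom R M F. \<exists>p \<in> mod_hom R F M. \<forall>x \<in> carrier M. p (i x) = x)"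

text \<open>Projective means isomorphic to a direct summand of a free module.  The index set of the free
  module may be taken inside the module itself: lemma \<open>projectiveI\<close> below shows that any summand of
  a free module, with an index set of any type, is projective in this sense, and lemma
  \<open>projective_iff_lifting\<close> gives the equivalence with the lifting property.\<close>

definition projective :: "('a, 'b) ring_scheme \<Rightarrow> ('a, 'm) module \<Rightarrow> bool" where
  "projective R M \<longleftrightarrow> left_module R M \<and> (\<exists>K :: 'm set. summand_of R M (free_module R K))"

definition trace_ideal :: "('a, 'b) ring_scheme \<Rightarrow> ('a, 'm) module \<Rightarrow> 'a set" where
  "trace_ideal R M =
    generate (add_monoid R) (\<Union>f \<in> mod_hom R M (regular_module R). f ` carrier M)"

text \<open>Every countably generated projective module is isomorphic to a submodule of the free module
  with basis indexed by the natural numbers, so that restricting to modules with carrier of type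
  \<^typ>\<open>nat \<Rightarrow> 'a\<close> is no loss (lemma \<open>countably_generated_projective_model\<close>).\<close>

definition traces_left :: "('a, 'b) ring_scheme \<Rightarrow> 'a set set" where
  "traces_left R = {I. ideal I R \<and>
     (\<exists>M :: ('a, nat \<Rightarrow> 'a) module. projective R M \<and> countably_generated R M \<and> trace_ideal R M = I)}"

definition traces_right :: "('a, 'b) ring_scheme \<Rightarrow> 'a set set" where
  "traces_right R = {I. ideal I R \<and>
     (\<exists>M :: ('a, nat \<Rightarrow> 'a) module. projective (opposite R) M \<and> countably_generated (opposite R) M \<and>
        trace_ideal (opposite R) M = I)}"


section \<open>Ring-theoretic notions\<close>

text \<open>Semisimplicity and semiperfectness are left-right symmetric, as is the Jacobson radical; left
  modules and left ideals are used here.\<close>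

definition simple_submodule where
  "simple_submodule R M N \<longleftrightarrow> submodule N R M \<and> N \<noteq> {\<zero>\<^bsub>M\<^esub>} \<and>
     (\<forall>H. submodule H R M \<and> H \<subseteq> N \<longrightarrow> H = {\<zero>\<^bsub>M\<^esub>} \<or> H = N)"

definition semisimple_module where
  "semisimple_module R M \<longleftrightarrow> mod_span R M (\<Union>{N. simple_submodule R M N}) = carrier M"

definition semisimple_ring where
  "semisimple_ring R \<longleftrightarrow> ring R \<and> semisimple_module R (regular_module R)"

definition left_ideal where
  "left_ideal I R \<longleftrightarrow> submodule I R (regular_module R)"

definition maximal_left_ideal where
  "maximal_left_ideal I R \<longleftrightarrow> left_ideal I R \<and> I \<noteq> carrier R \<and>
     (\<forall>J. left_ideal J R \<and> I \<subseteq> J \<longrightarrow> J = I \<or> J = carrier R)"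

definition jacobson_radical :: "('a, 'b) ring_scheme \<Rightarrow> 'a set" where
  "jacobson_radical R = carrier R \<inter> \<Inter>{I. maximal_left_ideal I R}"

definition idempotents_lift :: "('a, 'b) ring_scheme \<Rightarrow> 'a set \<Rightarrow> bool" where
  "idempotents_lift R I \<longleftrightarrow> (\<forall>x \<in> carrier R. x \<otimes>\<^bsub>R\<^esub> x \<ominus>\<^bsub>R\<^esub> x \<in> I \<longrightarrow>
     (\<exists>e \<in> carrier R. e \<otimes>\<^bsub>R\<^esub> e = e \<and> e \<ominus>\<^bsub>R\<^esub> x \<in> I))"

definition semiperfect where
  "semiperfect R \<longleftrightarrow> ring R \<and> semisimple_ring (R Quot jacobson_radical R) \<and>
     idempotents_lift R (jacobson_radical R)"

definition left_artinian :: "('a, 'b) ring_scheme \<Rightarrow> bool" where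
  "left_artinian R \<longleftrightarrow> (\<forall>I :: nat \<Rightarrow> 'a set.
     (\<forall>n. left_ideal (I n) R \<and> I (Suc n) \<subseteq> I n) \<longrightarrow> (\<exists>n. \<forall>m \<ge> n. I m = I n))"

definition simple_artinian where
  "simple_artinian R \<longleftrightarrow> ring R \<and> \<one>\<^bsub>R\<^esub> \<noteq> \<zero>\<^bsub>R\<^esub> \<and>
     (\<forall>I. ideal I R \<longrightarrow> I = {\<zero>\<^bsub>R\<^esub>} \<or> I = carrier R) \<and>
     left_artinian R \<and> left_artinian (opposite R)"

definition h_local_domain where
  "h_local_domain R \<longleftrightarrow> domain R \<and>
     (\<forall>x \<in> carrier R. x \<noteq> \<zero>\<^bsub>R\<^esub> \<longrightarrow> finite {m. maximalideal m R \<and> x \<in> m}) \<and>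
     (\<forall>P. primeideal P R \<and> P \<noteq> {\<zero>\<^bsub>R\<^esub>} \<longrightarrow> (\<exists>!m. maximalideal m R \<and> P \<subseteq> m))"


section \<open>Algebras, localization and base change\<close>

text \<open>The locale \<^locale>\<open>algebra\<close> of the library is restricted to commutative algebras.\<close>

locale ring_algebra = module + ring M +
  assumes smult_mult_left:
      "\<lbrakk>a \<in> carrier R; x \<in> carrier M; y \<in> carrier M\<rbrakk> \<Longrightarrow>
        (a \<odot>\<^bsub>M\<^esub> x) \<otimes>\<^bsub>M\<^esub> y = a \<odot>\<^bsub>M\<^esub> (x \<otimes>\<^bsub>M\<^esub> y)"
    and smult_mult_right:
      "\<lbrakk>a \<in> carrier R; x \<in> carrier M; y \<in> carrier M\<rbrakk> \<Longrightarrow>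
        x \<otimes>\<^bsub>M\<^esub> (a \<odot>\<^bsub>M\<^esub> y) = a \<odot>\<^bsub>M\<^esub> (x \<otimes>\<^bsub>M\<^esub> y)"

definition torsion_free where
  "torsion_free R M \<longleftrightarrow> (\<forall>a \<in> carrier R. \<forall>x \<in> carrier M.
     a \<odot>\<^bsub>M\<^esub> x = \<zero>\<^bsub>M\<^esub> \<longrightarrow> a = \<zero>\<^bsub>R\<^esub> \<or> x = \<zero>\<^bsub>M\<^esub>)"

text \<open>The fraction \<open>a/s\<close> is the equivalence class of \<open>(a, s)\<close>; the localization of \<open>R\<close> at a
  multiplicative set \<open>S\<close> is regarded as an \<open>R\<close>-algebra.\<close>

definition fraction :: "('r, 'b) ring_scheme \<Rightarrow> 'r set \<Rightarrow> 'r \<Rightarrow> 'r \<Rightarrow> ('r \<times> 'r) set" where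
  "fraction R S a s = {(b, t). b \<in> carrier R \<and> t \<in> S \<and>
     (\<exists>u \<in> S. u \<otimes>\<^bsub>R\<^esub> (t \<otimes>\<^bsub>R\<^esub> a) = u \<otimes>\<^bsub>R\<^esub> (s \<otimes>\<^bsub>R\<^esub> b))}"

definition localization :: "('r, 'b) ring_scheme \<Rightarrow> 'r set \<Rightarrow> ('r, ('r \<times> 'r) set) module" where
  "localization R S =
    \<lparr>carrier = {fraction R S a s | a s. a \<in> carrier R \<and> s \<in> S},
     mult = (\<lambda>X Y. \<Union>(a, s) \<in> X. \<Union>(b, t) \<in> Y. fraction R S (a \<otimes>\<^bsub>R\<^esub> b) (s \<otimes>\<^bsub>R\<^esub> t)),
     one = fraction R S \<one>\<^bsub>R\<^esub> \<one>\<^bsub>R\<^esub>,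
     zero = fraction R S \<zero>\<^bsub>R\<^esub> \<one>\<^bsub>R\<^esub>,
     add = (\<lambda>X Y. \<Union>(a, s) \<in> X. \<Union>(b, t) \<in> Y.
       fraction R S (t \<otimes>\<^bsub>R\<^esub> a \<oplus>\<^bsub>R\<^esub> s \<otimes>\<^bsub>R\<^esub> b) (s \<otimes>\<^bsub>R\<^esub> t)),
     smult = (\<lambda>r X. \<Union>(a, s) \<in> X. fraction R S (r \<otimes>\<^bsub>R\<^esub> a) s)\<rparr>"

definition local_ring_at :: "('r, 'b) ring_scheme \<Rightarrow> 'r set \<Rightarrow> ('r, ('r \<times> 'r) set) module" where
  "local_ring_at R P = localization R (carrier R - P)"

definition fraction_field :: "('r, 'b) ring_scheme \<Rightarrow> ('r, ('r \<times> 'r) set) module" where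
  "fraction_field R = localization R (carrier R - {\<zero>\<^bsub>R\<^esub>})"

text \<open>The tensor product of two \<open>R\<close>-algebras \<open>A\<close> and \<open>B\<close> is the free abelian group on pairs
  \<open>(a, b)\<close> modulo the bilinearity and balancing relations.  With the product
  \<open>(a, b)(a', b') = (a a', b b')\<close> that free abelian group is a ring, in which the relations generate
  the same ideal as additive subgroup.\<close>

definition pair_ring ::
    "('a, 'c) ring_scheme \<Rightarrow> ('b, 'd) ring_scheme \<Rightarrow> ('a \<times> 'b \<Rightarrow>\<^sub>0 int) ring" where
  "pair_ring A B =
    \<lparr>carrier = {c. Poly_Mapping.keys c \<subseteq> carrier A \<times> carrier B},
     mult = (\<lambda>x y. frag_extend (\<lambda>(a, b). frag_extend (\<lambda>(a', b').
       frag_of (a \<otimes>\<^bsub>A\<^esub> a', b \<otimes>\<^bsub>B\<^esub> b')) y) x),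
     one = frag_of (\<one>\<^bsub>A\<^esub>, \<one>\<^bsub>B\<^esub>), zero = 0, add = (+)\<rparr>"

definition tensor_relations ::
    "('r, 'e) ring_scheme \<Rightarrow> ('r, 'a, 'c) module_scheme \<Rightarrow> ('r, 'b, 'd) module_scheme
      \<Rightarrow> ('a \<times> 'b \<Rightarrow>\<^sub>0 int) set" where
  "tensor_relations R A B =
     {frag_of (a \<oplus>\<^bsub>A\<^esub> a', b) - frag_of (a, b) - frag_of (a', b) | a a' b.
        a \<in> carrier A \<and> a' \<in> carrier A \<and> b \<in> carrier B} \<union>
     {frag_of (a, b \<oplus>\<^bsub>B\<^esub> b') - frag_of (a, b) - frag_of (a, b') | a b b'.
        a \<in> carrier A \<and> b \<in> carrier B \<and> b' \<in> carrier B} \<union>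
     {frag_of (r \<odot>\<^bsub>A\<^esub> a, b) - frag_of (a, r \<odot>\<^bsub>B\<^esub> b) | r a b.
        r \<in> carrier R \<and> a \<in> carrier A \<and> b \<in> carrier B}"

definition tensor_algebra ::
    "('r, 'e) ring_scheme \<Rightarrow> ('r, 'a, 'c) module_scheme \<Rightarrow> ('r, 'b, 'd) module_scheme
      \<Rightarrow> ('a \<times> 'b \<Rightarrow>\<^sub>0 int) set ring" where
  "tensor_algebra R A B = pair_ring A B Quot genideal (pair_ring A B) (tensor_relations R A B)"

definition locally_semiperfect where
  "locally_semiperfect R A \<longleftrightarrow>
     (\<forall>m. maximalideal m R \<longrightarrow> semiperfect (tensor_algebra R A (local_ring_at R m)))"


section \<open>Consistency of the definitions\<close>

lemma opposite_simps [simp]: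
  "carrier (opposite R) = carrier R" "\<one>\<^bsub>opposite R\<^esub> = \<one>\<^bsub>R\<^esub>" "\<zero>\<^bsub>opposite R\<^esub> = \<zero>\<^bsub>R\<^esub>"
  "x \<otimes>\<^bsub>opposite R\<^esub> y = y \<otimes>\<^bsub>R\<^esub> x" "x \<oplus>\<^bsub>opposite R\<^esub> y = x \<oplus>\<^bsub>R\<^esub> y"
  by (simp_all add: opposite_def)

lemma regular_module_simps [simp]:
  "carrier (regular_module R) = carrier R" "\<zero>\<^bsub>regular_module R\<^esub> = \<zero>\<^bsub>R\<^esub>"
  "x \<oplus>\<^bsub>regular_module R\<^esub> y = x \<oplus>\<^bsub>R\<^esub> y" "a \<odot>\<^bsub>regular_module R\<^esub> y = a \<otimes>\<^bsub>R\<^esub> y"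
  by (simp_all add: regular_module_def)

lemma (in ring) ring_opposite: "ring (opposite R)"
  by (rule ringI) (auto intro!: abelian_groupI monoidI
    simp: l_distr r_distr m_assoc a_ac)

lemma (in ring) regular_left_module: "left_module R (regular_module R)"
proof -
  have "abelian_group (regular_module R)"
    by (rule abelian_groupI) (auto simp: a_ac)
  then show ?thesis
    by (simp add: left_module_def left_module_axioms_def ring_axioms l_distr r_distr m_assoc)
qed

lemma free_module_simps:
  "zero (free_module R K) = (\<lambda>k. \<zero>\<^bsub>R\<^esub>)"
  "f \<oplus>\<^bsub>free_module R K\<^esub> g = (\<lambda>k. f k \<oplus>\<^bsub>R\<^esub> g k)"
  "a \<odot>\<^bsub>free_module R K\<^esub> f = (\<lambda>k. a \<otimes>\<^bsub>R\<^esub> f k)"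
  by (simp_all add: free_module_def)

lemma free_module_carrier:
  "f \<in> carrier (free_module R K) \<longleftrightarrow>
     (\<forall>k. f k \<in> carrier R) \<and> (\<forall>k. k \<notin> K \<longrightarrow> f k = \<zero>\<^bsub>R\<^esub>) \<and> finite {k. f k \<noteq> \<zero>\<^bsub>R\<^esub>}"
  by (simp add: free_module_def)

lemma (in ring) free_left_module: "left_module R (free_module R K)"
proof -
  have add: "(\<lambda>k. f k \<oplus> g k) \<in> carrier (free_module R K)"
    if "f \<in> carrier (free_module R K)" "g \<in> carrier (free_module R K)" for f g
  proof -
    have "{k. f k \<oplus> g k \<noteq> \<zero>} \<subseteq> {k. f k \<noteq> \<zero>} \<union> {k. g k \<noteq> \<zero>}" by auto
    then show ?thesis
      using that by (auto simp: free_module_carrier intro: finite_subset)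
  qed
  have smult: "(\<lambda>k. a \<otimes> f k) \<in> carrier (free_module R K)"
    if "a \<in> carrier R" "f \<in> carrier (free_module R K)" for a f
  proof -
    have "{k. a \<otimes> f k \<noteq> \<zero>} \<subseteq> {k. f k \<noteq> \<zero>}" using that by auto
    then show ?thesis
      using that by (auto simp: free_module_carrier intro: finite_subset)
  qed
  have minus: "(\<lambda>k. \<ominus> f k) \<in> carrier (free_module R K)"
    if "f \<in> carrier (free_module R K)" for f
  proof -
    have "{k. \<ominus> f k \<noteq> \<zero>} \<subseteq> {k. f k \<noteq> \<zero>}" using that by auto
    then show ?thesis
      using that by (auto simp: free_module_carrier intro: finite_subset)
  qed
  have "abelian_group (free_module R K)"
  proof (rule abelian_groupI)
    fix f assume f: "f \<in> carrier (free_module R K)"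
    show "\<exists>g\<in>carrier (free_module R K). g \<oplus>\<^bsub>free_module R K\<^esub> f = \<zero>\<^bsub>free_module R K\<^esub>"
      using f minus[OF f]
      by (intro bexI[of _ "\<lambda>k. \<ominus> f k"]) (auto simp: free_module_simps free_module_carrier l_neg)
  qed (auto simp: free_module_simps add, auto simp: free_module_carrier a_ac)
  then show ?thesis
    by (simp add: left_module_def left_module_axioms_def ring_axioms free_module_simps smult)
      (auto simp: free_module_carrier l_distr r_distr m_assoc)
qed

definition basis_vec :: "('a, 'b) ring_scheme \<Rightarrow> 'k \<Rightarrow> 'k \<Rightarrow> 'a" where
  "basis_vec R k = (\<lambda>j. if j = k then \<one>\<^bsub>R\<^esub> else \<zero>\<^bsub>R\<^esub>)"

definition lincomb :: "('a, 'b) ring_scheme \<Rightarrow> ('a, 'm, 'c) module_scheme \<Rightarrow> ('k \<Rightarrow> 'm) \<Rightarrow> ('k \<Rightarrow> 'a) \<Rightarrow> 'm" where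
  "lincomb R M v f = finsum M (\<lambda>k. f k \<odot>\<^bsub>M\<^esub> v k) {k. f k \<noteq> \<zero>\<^bsub>R\<^esub>}"

lemma (in ring) basis_vec_carrier:
  assumes "k \<in> K" shows "basis_vec R k \<in> carrier (free_module R K)"
proof -
  have "{j. basis_vec R k j \<noteq> \<zero>} \<subseteq> {k}" by (auto simp: basis_vec_def)
  then have "finite {j. basis_vec R k j \<noteq> \<zero>}" using finite_subset by blast
  then show ?thesis using assms by (auto simp: free_module_carrier basis_vec_def)
qed

lemma mod_homD:
  assumes "f \<in> mod_hom R M N"
  shows "x \<in> carrier M \<Longrightarrow> f x \<in> carrier N"
    and "\<lbrakk>x \<in> carrier M; y \<in> carrier M\<rbrakk> \<Longrightarrow> f (x \<oplus>\<^bsub>M\<^esub> y) = f x \<oplus>\<^bsub>N\<^esub> f y"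
    and "\<lbrakk>a \<in> carrier R; x \<in> carrier M\<rbrakk> \<Longrightarrow> f (a \<odot>\<^bsub>M\<^esub> x) = a \<odot>\<^bsub>N\<^esub> f x"
  using assms by (auto simp: mod_hom_def)

lemma mod_hom_comp:
  assumes "f \<in> mod_hom R L M" "g \<in> mod_hom R M N"
  shows "(\<lambda>x. g (f x)) \<in> mod_hom R L N"
  using assms by (auto simp: mod_hom_def Pi_iff)

context left_module
begin

lemma smult_l_null: assumes "x \<in> carrier M" shows "\<zero> \<odot>\<^bsub>M\<^esub> x = \<zero>\<^bsub>M\<^esub>"
proof -
  have c: "\<zero> \<odot>\<^bsub>M\<^esub> x \<in> carrier M" using assms by simp
  have "\<zero> \<odot>\<^bsub>M\<^esub> x \<oplus>\<^bsub>M\<^esub> \<zero> \<odot>\<^bsub>M\<^esub> x = (\<zero> \<oplus> \<zero>) \<odot>\<^bsub>M\<^esub> x"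
    using assms by (subst smult_l_distr) auto
  also have "\<dots> = \<zero> \<odot>\<^bsub>M\<^esub> x" by simp
  finally show ?thesis using c by (metis M.add.r_cancel_one)
qed

lemma smult_r_null: assumes "a \<in> carrier R" shows "a \<odot>\<^bsub>M\<^esub> \<zero>\<^bsub>M\<^esub> = \<zero>\<^bsub>M\<^esub>"
proof -
  have c: "a \<odot>\<^bsub>M\<^esub> \<zero>\<^bsub>M\<^esub> \<in> carrier M" using assms by simp
  have "a \<odot>\<^bsub>M\<^esub> \<zero>\<^bsub>M\<^esub> \<oplus>\<^bsub>M\<^esub> a \<odot>\<^bsub>M\<^esub> \<zero>\<^bsub>M\<^esub> = a \<odot>\<^bsub>M\<^esub> (\<zero>\<^bsub>M\<^esub> \<oplus>\<^bsub>M\<^esub> \<zero>\<^bsub>M\<^esub>)"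
    using assms by (subst smult_r_distr) auto
  also have "\<dots> = a \<odot>\<^bsub>M\<^esub> \<zero>\<^bsub>M\<^esub>" by simp
  finally show ?thesis using c by (metis M.add.r_cancel_one)
qed

lemma finsum_smult_r:
  assumes "finite S" "a \<in> carrier R" "g \<in> S \<rightarrow> carrier M"
  shows "a \<odot>\<^bsub>M\<^esub> finsum M g S = finsum M (\<lambda>k. a \<odot>\<^bsub>M\<^esub> g k) S"
  using assms
proof (induction S rule: finite_induct)
  case empty then show ?case by (simp add: smult_r_null)
next
  case (insert k S)
  then show ?case by (simp add: Pi_iff smult_r_distr M.finsum_insert M.finsum_closed)
qed

lemma lincomb_superset:
  assumes "f \<in> carrier (free_module R K)" "v \<in> K \<rightarrow> carrier M"
    "finite S" "{k. f k \<noteq> \<zero>} \<subseteq> S" "S \<subseteq> K"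
  shows "lincomb R M v f = finsum M (\<lambda>k. f k \<odot>\<^bsub>M\<^esub> v k) S"
  unfolding lincomb_def
proof (rule M.add.finprod_mono_neutral_cong_left[OF assms(3,4)])
  have vS: "v i \<in> carrier M" if "i \<in> S" for i using assms(2,5) that by blast
  show "f i \<odot>\<^bsub>M\<^esub> v i = \<zero>\<^bsub>M\<^esub>" if "i \<in> S - {k. f k \<noteq> \<zero>}" for i
    using that smult_l_null[OF vS] by simp
  show "(\<lambda>k. f k \<odot>\<^bsub>M\<^esub> v k) \<in> S \<rightarrow> carrier M"
    using vS assms(1) by (simp add: free_module_carrier)
qed simp

lemma lincomb_hom:
  assumes v: "v \<in> K \<rightarrow> carrier M"
  shows "lincomb R M v \<in> mod_hom R (free_module R K) M"
  unfolding mod_hom_def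
proof (safe)
  interpret F: left_module R "free_module R K" by (rule free_left_module)
  fix f assume f: "f \<in> carrier (free_module R K)"
  have sub: "{k. f k \<noteq> \<zero>} \<subseteq> K" using f by (auto simp: free_module_carrier)
  show "lincomb R M v f \<in> carrier M"
    unfolding lincomb_def using f v sub
    by (auto intro!: M.finsum_closed simp: free_module_carrier Pi_iff)
  {
    fix a assume a: "a \<in> carrier R"
    have af: "(\<lambda>k. a \<otimes> f k) \<in> carrier (free_module R K)"
      using left_module.smult_closed[OF free_left_module a f] by (simp add: free_module_simps)
    have "lincomb R M v (\<lambda>k. a \<otimes> f k) = finsum M (\<lambda>k. (a \<otimes> f k) \<odot>\<^bsub>M\<^esub> v k) {k. f k \<noteq> \<zero>}"
      by (rule lincomb_superset[OF af v _ _ sub]) (use f a in \<open>auto simp: free_module_carrier\<close>)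
    also have "\<dots> = finsum M (\<lambda>k. a \<odot>\<^bsub>M\<^esub> (f k \<odot>\<^bsub>M\<^esub> v k)) {k. f k \<noteq> \<zero>}"
      by (rule M.finsum_cong') (use f a v sub in \<open>auto simp: free_module_carrier smult_assoc Pi_iff\<close>)
    also have "\<dots> = a \<odot>\<^bsub>M\<^esub> lincomb R M v f"
      unfolding lincomb_def
      by (rule finsum_smult_r[symmetric])
        (use f a v sub in \<open>auto simp: free_module_carrier Pi_iff\<close>)
    finally show "lincomb R M v (a \<odot>\<^bsub>free_module R K\<^esub> f) = a \<odot>\<^bsub>M\<^esub> lincomb R M v f"
      by (simp add: free_module_simps)
  }
  fix g assume g: "g \<in> carrier (free_module R K)"
  let ?S = "{k. f k \<noteq> \<zero>} \<union> {k. g k \<noteq> \<zero>}"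
  have fg: "(\<lambda>k. f k \<oplus> g k) \<in> carrier (free_module R K)"
    using F.a_closed[OF f g] by (simp add: free_module_simps)
  have S: "finite ?S" "?S \<subseteq> K" using f g by (auto simp: free_module_carrier)
  have car: "(\<lambda>k. f k \<odot>\<^bsub>M\<^esub> v k) \<in> ?S \<rightarrow> carrier M" "(\<lambda>k. g k \<odot>\<^bsub>M\<^esub> v k) \<in> ?S \<rightarrow> carrier M"
    using f g v S by (auto simp: free_module_carrier Pi_iff)
  have "lincomb R M v (\<lambda>k. f k \<oplus> g k) = finsum M (\<lambda>k. (f k \<oplus> g k) \<odot>\<^bsub>M\<^esub> v k) ?S"
    by (rule lincomb_superset[OF fg v S(1) _ S(2)]) auto
  also have "\<dots> = finsum M (\<lambda>k. f k \<odot>\<^bsub>M\<^esub> v k \<oplus>\<^bsub>M\<^esub> g k \<odot>\<^bsub>M\<^esub> v k) ?S"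
    by (rule M.finsum_cong') (use f g v S in \<open>auto simp: free_module_carrier Pi_iff intro!: smult_l_distr\<close>)
  also have "\<dots> = finsum M (\<lambda>k. f k \<odot>\<^bsub>M\<^esub> v k) ?S \<oplus>\<^bsub>M\<^esub> finsum M (\<lambda>k. g k \<odot>\<^bsub>M\<^esub> v k) ?S"
    by (rule M.finsum_addf[OF car])
  also have "\<dots> = lincomb R M v f \<oplus>\<^bsub>M\<^esub> lincomb R M v g"
    using lincomb_superset[OF f v S(1) _ S(2)] lincomb_superset[OF g v S(1) _ S(2)] by auto
  finally show "lincomb R M v (f \<oplus>\<^bsub>free_module R K\<^esub> g) = lincomb R M v f \<oplus>\<^bsub>M\<^esub> lincomb R M v g"
    by (simp add: free_module_simps)
qed

lemma lincomb_basis_vec: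
  assumes v: "v \<in> K \<rightarrow> carrier M" and k: "k \<in> K"
  shows "lincomb R M v (basis_vec R k) = v k"
proof -
  have "lincomb R M v (basis_vec R k) = finsum M (\<lambda>j. basis_vec R k j \<odot>\<^bsub>M\<^esub> v j) {k}"
    by (rule lincomb_superset[OF basis_vec_carrier[OF k] v]) (use k in \<open>auto simp: basis_vec_def\<close>)
  also have "\<dots> = v k" using v k by (auto simp: basis_vec_def Pi_iff M.finsum_insert)
  finally show ?thesis .
qed

lemma free_module_hom_eq:
  assumes g: "g \<in> mod_hom R (free_module R K) M" and h: "h \<in> mod_hom R (free_module R K) M"
    and eq: "\<And>k. k \<in> K \<Longrightarrow> g (basis_vec R k) = h (basis_vec R k)"
    and f: "f \<in> carrier (free_module R K)"
  shows "g f = h f"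
proof -
  interpret F: left_module R "free_module R K" by (rule free_left_module)
  have "finite S \<Longrightarrow> \<forall>f \<in> carrier (free_module R K). {k. f k \<noteq> \<zero>} \<subseteq> S \<longrightarrow> g f = h f" for S
  proof (induction S rule: finite_induct)
    case empty
    show ?case
    proof (intro ballI impI)
      fix f assume f: "f \<in> carrier (free_module R K)" "{k. f k \<noteq> \<zero>} \<subseteq> {}"
      have f0: "\<zero> \<odot>\<^bsub>free_module R K\<^esub> f = f"
        using f by (auto simp: free_module_simps fun_eq_iff free_module_carrier)
      have "g f = g (\<zero> \<odot>\<^bsub>free_module R K\<^esub> f)" "h f = h (\<zero> \<odot>\<^bsub>free_module R K\<^esub> f)"
        by (simp_all only: f0)
      moreover have "g f \<in> carrier M" "h f \<in> carrier M" using mod_homD(1)[OF g f(1)] mod_homD(1)[OF h f(1)] by auto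
      ultimately show "g f = h f"
        using mod_homD(3)[OF g _ f(1), of \<zero>] mod_homD(3)[OF h _ f(1), of \<zero>]
        by (simp only: smult_l_null R.zero_closed)
    qed
  next
    case (insert k S)
    show ?case
    proof (intro ballI impI)
      fix f assume f: "f \<in> carrier (free_module R K)" "{k. f k \<noteq> \<zero>} \<subseteq> insert k S"
      let ?f = "f(k := \<zero>)"
      have sub: "{j. ?f j \<noteq> \<zero>} \<subseteq> {j. f j \<noteq> \<zero>}" by auto
      have f': "?f \<in> carrier (free_module R K)"
        using f finite_subset[OF sub] by (auto simp: free_module_carrier)
      have "{j. ?f j \<noteq> \<zero>} \<subseteq> S" using f(2) by auto
      then have IH: "g ?f = h ?f" using insert.IH f' by blast
      show "g f = h f"
      proof (cases "k \<in> K")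
        case True
        let ?b = "f k \<odot>\<^bsub>free_module R K\<^esub> basis_vec R k"
        have fk: "f k \<in> carrier R" using f by (simp add: free_module_carrier)
        have b: "?b \<in> carrier (free_module R K)"
          using fk basis_vec_carrier[OF True] by (rule F.smult_closed)
        have split: "f = ?f \<oplus>\<^bsub>free_module R K\<^esub> ?b"
          using f by (auto simp: free_module_simps basis_vec_def fun_eq_iff free_module_carrier)
        have "g f = g ?f \<oplus>\<^bsub>M\<^esub> f k \<odot>\<^bsub>M\<^esub> g (basis_vec R k)"
          by (subst split) (simp only: mod_homD(2)[OF g f' b] mod_homD(3)[OF g fk basis_vec_carrier[OF True]])
        moreover have "h f = h ?f \<oplus>\<^bsub>M\<^esub> f k \<odot>\<^bsub>M\<^esub> h (basis_vec R k)"
          by (subst split) (simp only: mod_homD(2)[OF h f' b] mod_homD(3)[OF h fk basis_vec_carrier[OF True]])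
        ultimately show ?thesis using IH eq[OF True] by simp
      next
        case False
        then have "?f = f" using f by (auto simp: free_module_carrier fun_eq_iff)
        then show ?thesis using IH by simp
      qed
    qed
  qed
  then show ?thesis using f by (auto simp: free_module_carrier)
qed

lemma hom_image_submodule:
  assumes L: "left_module R L" and g: "g \<in> mod_hom R L M"
  shows "submodule (g ` carrier L) R M"
proof -
  interpret L: left_module R L by (rule L)
  have zero: "\<zero>\<^bsub>M\<^esub> = g \<zero>\<^bsub>L\<^esub>"
    using mod_homD(3)[OF g, of \<zero> "\<zero>\<^bsub>L\<^esub>"] mod_homD(1)[OF g, of "\<zero>\<^bsub>L\<^esub>"]
    by (simp add: smult_l_null L.smult_r_null)
  have inv: "inv\<^bsub>add_monoid M\<^esub> g x = g (\<ominus>\<^bsub>L\<^esub> x)" if "x \<in> carrier L" for x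
  proof -
    have "g (\<ominus>\<^bsub>L\<^esub> x) \<oplus>\<^bsub>M\<^esub> g x = \<zero>\<^bsub>M\<^esub>"
      using mod_homD(2)[OF g, of "\<ominus>\<^bsub>L\<^esub> x" x] that by (simp add: L.l_neg zero)
    then have "\<ominus>\<^bsub>M\<^esub> g x = g (\<ominus>\<^bsub>L\<^esub> x)"
      using that mod_homD(1)[OF g] by (intro M.minus_equality) auto
    then show ?thesis by (simp add: a_inv_def)
  qed
  show ?thesis
  proof (intro submodule.intro subgroup.intro submodule_axioms.intro)
    show "g ` carrier L \<subseteq> carrier (add_monoid M)" using mod_homD(1)[OF g] by auto
    show "\<one>\<^bsub>add_monoid M\<^esub> \<in> g ` carrier L" by (simp add: zero)
    show "inv\<^bsub>add_monoid M\<^esub> x \<in> g ` carrier L" if "x \<in> g ` carrier L" for x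
      using that inv by auto
    show "x \<otimes>\<^bsub>add_monoid M\<^esub> y \<in> g ` carrier L" if "x \<in> g ` carrier L" "y \<in> g ` carrier L" for x y
      using that by (auto simp flip: mod_homD(2)[OF g])
    show "a \<odot>\<^bsub>M\<^esub> x \<in> g ` carrier L" if "a \<in> carrier R" "x \<in> g ` carrier L" for a x
      using that by (auto simp flip: mod_homD(3)[OF g])
  qed
qed

text \<open>Any surjection from a free module onto a summand of a free module splits.\<close>

lemma summand_of_free_transfer:
  assumes sum: "summand_of R M (free_module R K)"
    and v: "v \<in> J \<rightarrow> carrier M" and span: "mod_span R M (v ` J) = carrier M"
  shows "summand_of R M (free_module R J)"
proof -
  interpret F: left_module R "free_module R J" by (rule free_left_module)
  obtain i p where i: "i \<in> mod_hom R M (free_module R K)" and p: "p \<in> mod_hom R (free_module R K) M"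
    and pi: "\<And>x. x \<in> carrier M \<Longrightarrow> p (i x) = x"
    using sum unfolding summand_of_def by blast
  let ?q = "lincomb R M v"
  have q: "?q \<in> mod_hom R (free_module R J) M" by (rule lincomb_hom[OF v])
  have "submodule (?q ` carrier (free_module R J)) R M"
    by (rule hom_image_submodule[OF free_left_module q])
  moreover have "v ` J \<subseteq> ?q ` carrier (free_module R J)"
  proof
    fix x assume "x \<in> v ` J"
    then obtain j where j: "j \<in> J" "x = v j" by blast
    then show "x \<in> ?q ` carrier (free_module R J)"
      using lincomb_basis_vec[OF v j(1)] basis_vec_carrier[OF j(1)] by (intro image_eqI) auto
  qed
  ultimately have surj: "carrier M \<subseteq> ?q ` carrier (free_module R J)"
    using span unfolding mod_span_def by blast
  have "\<exists>c \<in> carrier (free_module R J). ?q c = p (basis_vec R k)" if "k \<in> K" for k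
  proof -
    have "p (basis_vec R k) \<in> ?q ` carrier (free_module R J)"
      using surj mod_homD(1)[OF p basis_vec_carrier[OF that]] by blast
    then show ?thesis by force
  qed
  then obtain c where c: "\<And>k. k \<in> K \<Longrightarrow> c k \<in> carrier (free_module R J)"
      "\<And>k. k \<in> K \<Longrightarrow> ?q (c k) = p (basis_vec R k)" by metis
  let ?h = "lincomb R (free_module R J) c"
  have cK: "c \<in> K \<rightarrow> carrier (free_module R J)" using c by auto
  have h: "?h \<in> mod_hom R (free_module R K) (free_module R J)" by (rule F.lincomb_hom[OF cK])
  have qh: "?q (?h f) = p f" if "f \<in> carrier (free_module R K)" for f
    using free_module_hom_eq[OF mod_hom_comp[OF h q] p _ that] c(2) F.lincomb_basis_vec[OF cK]
    by simp
  show ?thesis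
    unfolding summand_of_def
    by (rule bexI[OF _ mod_hom_comp[OF i h]], rule bexI[OF _ q])
      (simp add: qh[OF mod_homD(1)[OF i]] pi)
qed

lemma mod_span_carrier: "mod_span R M (carrier M) = carrier M"
  by (auto simp: mod_span_def)

end

lemma projectiveI:
  assumes "left_module R M" "summand_of R M (free_module R K)"
  shows "projective R M"
proof -
  interpret left_module R M by fact
  have "summand_of R M (free_module R (carrier M))"
    by (rule summand_of_free_transfer[OF assms(2), of "\<lambda>x. x"]) (auto simp: mod_span_carrier)
  then show ?thesis using assms(1) by (auto simp: projective_def)
qed

lemma projective_iff_lifting:
  fixes M :: "('a, 'm) module"
  assumes M: "left_module R M"
  shows "projective R M \<Longrightarrow> left_module R A \<Longrightarrow> left_module R B \<Longrightarrow>
           g \<in> mod_hom R A B \<Longrightarrow> g ` carrier A = carrier B \<Longrightarrow> f \<in> mod_hom R M B \<Longrightarrow>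
           \<exists>h \<in> mod_hom R M A. \<forall>x \<in> carrier M. g (h x) = f x"
    and "(\<And>(A :: ('a, 'm \<Rightarrow> 'a) module) (B :: ('a, 'm) module) g f.
           \<lbrakk>left_module R A; left_module R B; g \<in> mod_hom R A B; g ` carrier A = carrier B;
            f \<in> mod_hom R M B\<rbrakk> \<Longrightarrow> \<exists>h \<in> mod_hom R M A. \<forall>x \<in> carrier M. g (h x) = f x) \<Longrightarrow>
         projective R M"
proof -
  interpret M: left_module R M by (rule M)
  {
    assume proj: "projective R M" and A: "left_module R A" and B: "left_module R B"
      and g: "g \<in> mod_hom R A B" "g ` carrier A = carrier B" and f: "f \<in> mod_hom R M B"
    from proj obtain K :: "'m set" and i p where i: "i \<in> mod_hom R M (free_module R K)"
      and p: "p \<in> mod_hom R (free_module R K) M"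
      and pi: "\<And>x. x \<in> carrier M \<Longrightarrow> p (i x) = x"
      unfolding projective_def summand_of_def by blast
    interpret A: left_module R A by (rule A)
    interpret B: left_module R B by (rule B)
    have "\<exists>c \<in> carrier A. g c = f (p (basis_vec R k))" if "k \<in> K" for k
    proof -
      have "f (p (basis_vec R k)) \<in> g ` carrier A"
        using g(2) mod_homD(1)[OF f mod_homD(1)[OF p M.basis_vec_carrier[OF that]]] by blast
      then show ?thesis by force
    qed
    then obtain c where c: "\<And>k. k \<in> K \<Longrightarrow> c k \<in> carrier A"
      "\<And>k. k \<in> K \<Longrightarrow> g (c k) = f (p (basis_vec R k))" by metis
    have cK: "c \<in> K \<rightarrow> carrier A" using c by auto
    let ?h = "lincomb R A c"
    have h: "?h \<in> mod_hom R (free_module R K) A" by (rule A.lincomb_hom[OF cK])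
    have gh: "g (?h u) = f (p u)" if "u \<in> carrier (free_module R K)" for u
      using B.free_module_hom_eq[OF mod_hom_comp[OF h g(1)] mod_hom_comp[OF p f] _ that]
        c(2) A.lincomb_basis_vec[OF cK] by simp
    show "\<exists>h \<in> mod_hom R M A. \<forall>x \<in> carrier M. g (h x) = f x"
      by (rule bexI[OF _ mod_hom_comp[OF i h]]) (simp add: gh[OF mod_homD(1)[OF i]] pi)
  next
    assume lift: "\<And>(A :: ('a, 'm \<Rightarrow> 'a) module) (B :: ('a, 'm) module) g f.
           \<lbrakk>left_module R A; left_module R B; g \<in> mod_hom R A B; g ` carrier A = carrier B;
            f \<in> mod_hom R M B\<rbrakk> \<Longrightarrow> \<exists>h \<in> mod_hom R M A. \<forall>x \<in> carrier M. g (h x) = f x"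
    let ?F = "free_module R (carrier M)" and ?q = "lincomb R M (\<lambda>x. x)"
    have q: "?q \<in> mod_hom R ?F M" by (rule M.lincomb_hom) auto
    have "x \<in> ?q ` carrier ?F" if "x \<in> carrier M" for x
      using M.lincomb_basis_vec[of "\<lambda>x. x" "carrier M" x] M.basis_vec_carrier[OF that] that
      by (intro image_eqI[of _ _ "basis_vec R x"]) auto
    then have surj: "?q ` carrier ?F = carrier M" using mod_homD(1)[OF q] by auto
    have "(\<lambda>x. x) \<in> mod_hom R M M" by (auto simp: mod_hom_def)
    from lift[OF M.free_left_module M q surj this]
    obtain s where s: "s \<in> mod_hom R M ?F" "\<And>x. x \<in> carrier M \<Longrightarrow> ?q (s x) = x" by blast
    have "summand_of R M ?F"
      unfolding summand_of_def by (rule bexI[OF _ s(1)], rule bexI[OF _ q]) (simp add: s(2))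
    then show "projective R M" using M by (auto simp: projective_def)
  }
qed

lemma projective_model:
  fixes M :: "('a, 'm) module" and idx :: "'m \<Rightarrow> 'k"
  assumes proj: "projective R M" and V: "V \<subseteq> carrier M" "mod_span R M V = carrier M"
    and idx: "inj_on idx V"
  obtains N :: "('a, 'k \<Rightarrow> 'a) module" and i W
  where "projective R N" "i \<in> mod_hom R M N" "bij_betw i (carrier M) (carrier N)"
    "mod_span R N (i ` V) = carrier N" "i ` V \<subseteq> carrier N" "trace_ideal R N = trace_ideal R M"
proof -
  interpret left_module R M using proj by (simp add: projective_def)
  let ?F = "free_module R (idx ` V)"
  interpret F: left_module R ?F by (rule free_left_module)
  have v: "inv_into V idx \<in> idx ` V \<rightarrow> carrier M" "inv_into V idx ` idx ` V = V"
    using V(1) idx by (auto simp: inv_into_image_cancel)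
  have sumF: "summand_of R M ?F"
    using proj summand_of_free_transfer[OF _ v(1)] v(2) V(2) unfolding projective_def by metis
  then obtain i p where i: "i \<in> mod_hom R M ?F" and p: "p \<in> mod_hom R ?F M"
    and pi: "\<And>x. x \<in> carrier M \<Longrightarrow> p (i x) = x"
    unfolding summand_of_def by blast
  define N :: "('a, 'k \<Rightarrow> 'a) module" where "N = ?F\<lparr>carrier := i ` carrier M\<rparr>"
  have Ns: "carrier N = i ` carrier M" "f \<oplus>\<^bsub>N\<^esub> g = f \<oplus>\<^bsub>?F\<^esub> g" "a \<odot>\<^bsub>N\<^esub> f = a \<odot>\<^bsub>?F\<^esub> f" "\<zero>\<^bsub>N\<^esub> = \<zero>\<^bsub>?F\<^esub>" for a f g
    by (simp_all add: N_def)
  have sub: "submodule (i ` carrier M) R ?F"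
    by (rule F.hom_image_submodule[OF left_module_axioms i])
  have subF: "carrier N \<subseteq> carrier ?F" using mod_homD(1)[OF i] Ns(1) by auto
  have ag: "abelian_group N"
  proof (rule abelian_groupI)
    fix f assume f: "f \<in> carrier N"
    show "\<exists>g\<in>carrier N. g \<oplus>\<^bsub>N\<^esub> f = \<zero>\<^bsub>N\<^esub>"
    proof
      show "\<ominus>\<^bsub>?F\<^esub> f \<in> carrier N"
        using subgroup.m_inv_closed[OF submodule.axioms(1)[OF sub]] f by (simp add: Ns a_inv_def)
      show "\<ominus>\<^bsub>?F\<^esub> f \<oplus>\<^bsub>N\<^esub> f = \<zero>\<^bsub>N\<^esub>" using f subF by (auto simp: Ns F.l_neg)
    qed
  next
    show "\<zero>\<^bsub>N\<^esub> \<in> carrier N"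
      using subgroup.one_closed[OF submodule.axioms(1)[OF sub]] by (simp add: Ns)
  next
    fix f g assume "f \<in> carrier N" "g \<in> carrier N"
    then show "f \<oplus>\<^bsub>N\<^esub> g \<in> carrier N"
      using subgroup.m_closed[OF submodule.axioms(1)[OF sub]] by (simp add: Ns)
  qed (use subF in \<open>auto simp only: Ns(2-4) F.a_ac F.l_zero subset_iff\<close>)
  have N: "left_module R N"
    using ag submodule.smult_closed[OF sub] subF
    by (auto simp: left_module_def left_module_axioms_def ring_axioms Ns(2,3,4)
        F.smult_l_distr F.smult_r_distr F.smult_assoc subset_iff) (simp_all add: Ns)
  interpret N: left_module R N by (rule N)
  have iN: "i \<in> mod_hom R M N" using i by (auto simp: mod_hom_def Ns)
  have pN: "p \<in> mod_hom R N M" using p subF by (auto simp: mod_hom_def Ns subset_iff Pi_iff)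
  have bij: "bij_betw i (carrier M) (carrier N)"
    by (rule bij_betw_byWitness[of _ p]) (use pi mod_homD(1)[OF pN] in \<open>auto simp: Ns\<close>)
  have ip: "i (p y) = y" if "y \<in> carrier N" for y using that pi by (auto simp: Ns)
  have sumN: "summand_of R N ?F"
    unfolding summand_of_def
  proof (intro bexI ballI)
    show "(\<lambda>f. f) \<in> mod_hom R N ?F" using subF by (auto simp: mod_hom_def Ns)
    show "(\<lambda>f. i (p f)) \<in> mod_hom R ?F N" by (rule mod_hom_comp[OF p iN])
  qed (use ip in auto)
  have projN: "projective R N" by (rule projectiveI[OF N sumN])
  have spanN: "mod_span R N (i ` V) = carrier N"
  proof -
    have "carrier N \<subseteq> H" if H: "submodule H R N" "i ` V \<subseteq> H" for H
    proof -
      have Hsub: "H \<subseteq> carrier N" using subgroup.subset[OF submodule.axioms(1)[OF H(1)]] by simp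
      let ?L = "N\<lparr>carrier := H\<rparr>"
      have agL: "abelian_group ?L"
      proof (rule abelian_groupI)
        fix f assume f: "f \<in> carrier ?L"
        show "\<exists>g\<in>carrier ?L. g \<oplus>\<^bsub>?L\<^esub> f = \<zero>\<^bsub>?L\<^esub>"
        proof
          show "\<ominus>\<^bsub>N\<^esub> f \<in> carrier ?L"
            using subgroup.m_inv_closed[OF submodule.axioms(1)[OF H(1)]] f by (simp add: a_inv_def)
          show "\<ominus>\<^bsub>N\<^esub> f \<oplus>\<^bsub>?L\<^esub> f = \<zero>\<^bsub>?L\<^esub>" using f Hsub by (auto simp: N.l_neg)
        qed
      next
        show "\<zero>\<^bsub>?L\<^esub> \<in> carrier ?L"
          using subgroup.one_closed[OF submodule.axioms(1)[OF H(1)]] by simp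
      next
        fix f g assume "f \<in> carrier ?L" "g \<in> carrier ?L"
        then show "f \<oplus>\<^bsub>?L\<^esub> g \<in> carrier ?L"
          using subgroup.m_closed[OF submodule.axioms(1)[OF H(1)]] by simp
      qed (use Hsub in \<open>auto simp: N.a_ac subset_iff\<close>)
      have L: "left_module R ?L"
        using agL submodule.smult_closed[OF H(1)] Hsub
        by (auto simp: left_module_def left_module_axioms_def ring_axioms
            N.smult_l_distr N.smult_r_distr N.smult_assoc subset_iff)
      have pL: "p \<in> mod_hom R ?L M" using pN Hsub by (auto simp: mod_hom_def subset_iff Pi_iff)
      have "submodule (p ` H) R M" using hom_image_submodule[OF L pL] by simp
      moreover have "V \<subseteq> p ` H"
      proof
        fix x assume "x \<in> V"
        then show "x \<in> p ` H" using H(2) V(1) pi by (metis image_eqI image_subset_iff subsetD)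
      qed
      ultimately have "carrier M \<subseteq> p ` H" using V(2) unfolding mod_span_def by blast
      then have pH: "p f \<in> p ` H" if "f \<in> carrier N" for f
        using mod_homD(1)[OF pN that] by blast
      show ?thesis
      proof
        fix f assume f: "f \<in> carrier N"
        obtain g where g: "g \<in> H" "p f = p g" using pH[OF f] by blast
        then have "f = g" using ip[OF f] ip[of g] Hsub by auto
        then show "f \<in> H" using g by simp
      qed
    qed
    then show ?thesis by (auto simp: mod_span_def)
  qed
  have "(\<Union>f \<in> mod_hom R N (regular_module R). f ` carrier N) =
        (\<Union>f \<in> mod_hom R M (regular_module R). f ` carrier M)" (is "?A = ?B")
  proof
    show "?A \<subseteq> ?B"
    proof
      fix y assume "y \<in> ?A"
      then obtain f x where f: "f \<in> mod_hom R N (regular_module R)" "x \<in> carrier M" "y = f (i x)"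
        by (auto simp: Ns)
      then show "y \<in> ?B" using mod_hom_comp[OF iN f(1)] by blast
    qed
    show "?B \<subseteq> ?A"
    proof
      fix y assume "y \<in> ?B"
      then obtain f x where f: "f \<in> mod_hom R M (regular_module R)" "x \<in> carrier M" "y = f x"
        by auto
      then have "y = f (p (i x))" "i x \<in> carrier N" using pi by (auto simp: Ns)
      then show "y \<in> ?A" using mod_hom_comp[OF pN f(1)] by blast
    qed
  qed
  then have "trace_ideal R N = trace_ideal R M" by (simp add: trace_ideal_def)
  moreover have "i ` V \<subseteq> carrier N" using V by (auto simp: Ns)
  ultimately show thesis using that projN iN bij spanN by blast
qed

lemma countably_generated_projective_model:
  fixes M :: "('a, 'm) module"
  assumes "projective R M" "countably_generated R M"
  obtains N :: "('a, nat \<Rightarrow> 'a) module" and i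
  where "projective R N" "countably_generated R N" "trace_ideal R N = trace_ideal R M"
    "i \<in> mod_hom R M N" "bij_betw i (carrier M) (carrier N)"
proof -
  obtain V where V: "V \<subseteq> carrier M" "countable V" "mod_span R M V = carrier M"
    using assms(2) by (auto simp: countably_generated_def)
  obtain idx :: "'m \<Rightarrow> nat" where idx: "inj_on idx V" using V(2) by (auto simp: countable_def)
  show thesis
  proof (rule projective_model[OF assms(1) V(1,3) idx])
    fix N :: "('a, nat \<Rightarrow> 'a) module" and i
    assume N: "projective R N" "i \<in> mod_hom R M N" "bij_betw i (carrier M) (carrier N)"
      "mod_span R N (i ` V) = carrier N" "i ` V \<subseteq> carrier N" "trace_ideal R N = trace_ideal R M"
    have "countably_generated R N"
      unfolding countably_generated_def using N(4,5) countable_image[OF V(2), of i] by blast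
    then show thesis using that N by blast
  qed
qed

lemma finitely_generated_projective_model:
  fixes M :: "('a, 'm) module"
  assumes "projective R M" "finitely_generated R M"
  obtains N :: "('a, nat \<Rightarrow> 'a) module" and i
  where "projective R N" "finitely_generated R N" "trace_ideal R N = trace_ideal R M"
    "i \<in> mod_hom R M N" "bij_betw i (carrier M) (carrier N)"
proof -
  obtain V where V: "V \<subseteq> carrier M" "finite V" "mod_span R M V = carrier M"
    using assms(2) by (auto simp: finitely_generated_def)
  obtain idx :: "'m \<Rightarrow> nat" where idx: "inj_on idx V"
    using countable_finite[OF V(2)] by (auto simp: countable_def)
  show thesis
  proof (rule projective_model[OF assms(1) V(1,3) idx])
    fix N :: "('a, nat \<Rightarrow> 'a) module" and i
    assume N: "projective R N" "i \<in> mod_hom R M N" "bij_betw i (carrier M) (carrier N)"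
      "mod_span R N (i ` V) = carrier N" "i ` V \<subseteq> carrier N" "trace_ideal R N = trace_ideal R M"
    have "finitely_generated R N"
      unfolding finitely_generated_def using N(4,5) finite_imageI[OF V(2), of i] by blast
    then show thesis using that N by blast
  qed
qed

lemma pair_ring_ring:
  assumes A: "ring A" and B: "ring B"
  shows "ring (pair_ring A B)"
proof -
  interpret A: ring A by (rule A)
  interpret B: ring B by (rule B)
  let ?C = "{c. Poly_Mapping.keys c \<subseteq> carrier A \<times> carrier B}"
  let ?m = "\<lambda>x y. frag_extend (\<lambda>(a, b). frag_extend (\<lambda>(a', b').
       frag_of (a \<otimes>\<^bsub>A\<^esub> a', b \<otimes>\<^bsub>B\<^esub> b')) y) x"
  have m0: "?m 0 y = 0" "?m x 0 = 0" for x y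
    by (auto simp: frag_extend_eq_0 split: prod.splits)
  have ml: "?m (x - y) z = ?m x z - ?m y z" for x y z by (simp add: frag_extend_diff)
  have mr: "?m x (y - z) = ?m x y - ?m x z" for x y z
    using subset_UNIV[of "Poly_Mapping.keys x"]
    by (induction x rule: frag_induction) (auto simp: frag_extend_diff)
  have ml': "?m (x + y) z = ?m x z + ?m y z" for x y z by (simp add: frag_extend_add)
  have mr': "?m x (y + z) = ?m x y + ?m x z" for x y z
    using subset_UNIV[of "Poly_Mapping.keys x"]
    by (induction x rule: frag_induction) (auto simp: frag_extend_diff frag_extend_add)
  have closed: "?m x y \<in> ?C" if "x \<in> ?C" "y \<in> ?C" for x y
  proof -
    have "Poly_Mapping.keys x \<subseteq> carrier A \<times> carrier B" using that by simp
    then show ?thesis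
    proof (induction x rule: frag_induction)
      case zero then show ?case by simp
    next
      case (one p)
      have "Poly_Mapping.keys y \<subseteq> carrier A \<times> carrier B" using that by simp
      then show ?case using one
      proof (induction y rule: frag_induction)
        case (diff a b)
        then show ?case using keys_diff by (fastforce simp only: mr mem_Collect_eq)
      qed (auto simp: m0 split: prod.splits)
    next
      case (diff a b)
      then show ?case using keys_diff by (fastforce simp only: ml mem_Collect_eq)
    qed
  qed
  have assoc: "?m (?m x y) z = ?m x (?m y z)" if "x \<in> ?C" "y \<in> ?C" "z \<in> ?C" for x y z
  proof -
    have "Poly_Mapping.keys x \<subseteq> carrier A \<times> carrier B" using that by simp
    then show ?thesis
    proof (induction x rule: frag_induction)
      case zero then show ?case by simp
    next
      case (diff a b) then show ?case by (simp only: ml)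
    next
      case (one p)
      have "Poly_Mapping.keys y \<subseteq> carrier A \<times> carrier B" using that by simp
      then show ?case
      proof (induction y rule: frag_induction)
        case zero then show ?case by (simp only: m0)
      next
        case (diff a b) then show ?case by (simp only: ml mr)
      next
        case (one q)
        have "Poly_Mapping.keys z \<subseteq> carrier A \<times> carrier B" using that by simp
        then show ?case
        proof (induction z rule: frag_induction)
          case zero then show ?case by (simp only: m0)
        next
          case (diff a b) then show ?case by (simp only: mr)
        next
          case (one r)
          then show ?case using \<open>p \<in> _\<close> \<open>q \<in> _\<close>
            by (auto simp: A.m_assoc B.m_assoc)
        qed
      qed
    qed
  qed
  have one_l: "?m (frag_of (\<one>\<^bsub>A\<^esub>, \<one>\<^bsub>B\<^esub>)) x = x" if "x \<in> ?C" for x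
  proof -
    have "Poly_Mapping.keys x \<subseteq> carrier A \<times> carrier B" using that by simp
    then show ?thesis
      by (induction x rule: frag_induction) (auto simp: frag_extend_diff)
  qed
  have one_r: "?m x (frag_of (\<one>\<^bsub>A\<^esub>, \<one>\<^bsub>B\<^esub>)) = x" if "x \<in> ?C" for x
  proof -
    have "Poly_Mapping.keys x \<subseteq> carrier A \<times> carrier B" using that by simp
    then show ?thesis
      by (induction x rule: frag_induction) (auto simp: frag_extend_diff)
  qed
  have plus: "x + y \<in> ?C" if "x \<in> ?C" "y \<in> ?C" for x y :: "'a \<times> 'c \<Rightarrow>\<^sub>0 int"
    using that keys_add[of x y] by blast
  show ?thesis
  proof (rule ringI)
    show "abelian_group (pair_ring A B)"
    proof (rule abelian_groupI)
      fix x assume "x \<in> carrier (pair_ring A B)"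
      then show "\<exists>y\<in>carrier (pair_ring A B). y \<oplus>\<^bsub>pair_ring A B\<^esub> x = \<zero>\<^bsub>pair_ring A B\<^esub>"
        by (intro bexI[of _ "- x"]) (auto simp: pair_ring_def)
    qed (use plus in \<open>auto simp: pair_ring_def\<close>)
    show "monoid (pair_ring A B)"
      by (rule monoidI) (use closed assoc one_l one_r in \<open>auto simp: pair_ring_def\<close>)
  qed (use ml' mr' in \<open>auto simp: pair_ring_def\<close>)
qed

lemma (in ring_algebra) tensor_relations_carrier:
  assumes "ring_algebra R B"
  shows "tensor_relations R M B \<subseteq> carrier (pair_ring M B)"
proof -
  interpret B: ring_algebra R B by fact
  have d: "Poly_Mapping.keys (x - y) \<subseteq> U"
    if "Poly_Mapping.keys x \<subseteq> U" "Poly_Mapping.keys y \<subseteq> U" for x y :: "'x \<Rightarrow>\<^sub>0 int" and U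
    using that keys_diff[of x y] by auto
  show ?thesis
    unfolding tensor_relations_def pair_ring_def
    by (intro Un_least; safe; simp only: partial_object.simps mem_Collect_eq; intro d)
      (simp_all add: keys_frag_of)
qed

lemma tensor_algebra_ring:
  assumes "ring_algebra R A" "ring_algebra R B"
  shows "ring (tensor_algebra R A B)"
proof -
  interpret A: ring_algebra R A by fact
  interpret B: ring_algebra R B by fact
  interpret P: ring "pair_ring A B" by (rule pair_ring_ring) unfold_locales
  have "ideal (genideal (pair_ring A B) (tensor_relations R A B)) (pair_ring A B)"
    by (rule P.genideal_ideal[OF A.tensor_relations_carrier[OF assms(2)]])
  then show ?thesis unfolding tensor_algebra_def by (rule ideal.quotient_is_ring)
qed

context cring
begin

context
  fixes S
  assumes S: "submonoid S R"
begin

lemma S_closed: "s \<in> S \<Longrightarrow> s \<in> carrier R" "\<one> \<in> S" "\<lbrakk>s \<in> S; t \<in> S\<rbrakk> \<Longrightarrow> s \<otimes> t \<in> S"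
  using submonoid.subset[OF S] submonoid.one_closed[OF S] submonoid.m_closed[OF S] by auto

lemma fraction_eqI:
  assumes "a \<in> carrier R" "b \<in> carrier R" "s \<in> S" "t \<in> S" "u \<in> S"
    and eq: "u \<otimes> (t \<otimes> a) = u \<otimes> (s \<otimes> b)"
  shows "fraction R S a s = fraction R S b t"
proof -
  have sub: "fraction R S a s \<subseteq> fraction R S b t"
    if ab: "a \<in> carrier R" "b \<in> carrier R" "s \<in> S" "t \<in> S" "u \<in> S"
      and eq: "u \<otimes> (t \<otimes> a) = u \<otimes> (s \<otimes> b)" for a b s t u
  proof
    fix x assume "x \<in> fraction R S a s"
    then obtain c w v where x: "x = (c, w)" "c \<in> carrier R" "w \<in> S" "v \<in> S"
      and vw: "v \<otimes> (w \<otimes> a) = v \<otimes> (s \<otimes> c)" by (auto simp: fraction_def)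
    note car = S_closed(1)[OF ab(3)] S_closed(1)[OF ab(4)] S_closed(1)[OF ab(5)]
      S_closed(1)[OF x(3)] S_closed(1)[OF x(4)] ab(1,2) x(2)
    have "((u \<otimes> v) \<otimes> s) \<otimes> (w \<otimes> b) = (v \<otimes> w) \<otimes> (u \<otimes> (s \<otimes> b))" using car by algebra
    also have "\<dots> = (u \<otimes> t) \<otimes> (v \<otimes> (w \<otimes> a))" using car by (subst eq[symmetric]) algebra
    also have "\<dots> = ((u \<otimes> v) \<otimes> s) \<otimes> (t \<otimes> c)" using car by (subst vw) algebra
    finally show "x \<in> fraction R S b t"
      using x ab S_closed(3) by (auto simp: fraction_def)
  qed
  show ?thesis using sub[OF assms] sub[OF assms(2,1,4,3,5) eq[symmetric]] by (rule equalityI)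
qed

lemma fraction_self: "\<lbrakk>a \<in> carrier R; s \<in> S\<rbrakk> \<Longrightarrow> (a, s) \<in> fraction R S a s"
  using S_closed(2) by (auto simp: fraction_def)

lemma fraction_UN:
  assumes "a \<in> carrier R" "s \<in> S"
    and "\<And>a' s'. (a', s') \<in> fraction R S a s \<Longrightarrow> F a' s' = F a s"
  shows "(\<Union>(a', s') \<in> fraction R S a s. F a' s') = F a s"
proof -
  have "(\<Union>(a', s') \<in> fraction R S a s. F a' s') = (\<Union>x \<in> fraction R S a s. F a s)"
    by (rule SUP_cong) (auto simp: assms(3))
  then show ?thesis using fraction_self[OF assms(1,2)] by auto
qed

lemma localization_simps:
  shows "\<lbrakk>a \<in> carrier R; b \<in> carrier R; s \<in> S; t \<in> S\<rbrakk> \<Longrightarrow>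
      fraction R S a s \<otimes>\<^bsub>localization R S\<^esub> fraction R S b t = fraction R S (a \<otimes> b) (s \<otimes> t)"
    and "\<lbrakk>a \<in> carrier R; b \<in> carrier R; s \<in> S; t \<in> S\<rbrakk> \<Longrightarrow>
      fraction R S a s \<oplus>\<^bsub>localization R S\<^esub> fraction R S b t
        = fraction R S (t \<otimes> a \<oplus> s \<otimes> b) (s \<otimes> t)"
    and "\<lbrakk>r \<in> carrier R; a \<in> carrier R; s \<in> S\<rbrakk> \<Longrightarrow>
      r \<odot>\<^bsub>localization R S\<^esub> fraction R S a s = fraction R S (r \<otimes> a) s"
proof -
  assume ab: "a \<in> carrier R" "b \<in> carrier R" "s \<in> S" "t \<in> S"
  {
    fix a' s' b' t' assume "(a', s') \<in> fraction R S a s" "(b', t') \<in> fraction R S b t"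
    then obtain u v where *: "a' \<in> carrier R" "b' \<in> carrier R" "s' \<in> S" "t' \<in> S" "u \<in> S" "v \<in> S"
      and u: "u \<otimes> (s' \<otimes> a) = u \<otimes> (s \<otimes> a')" and v: "v \<otimes> (t' \<otimes> b) = v \<otimes> (t \<otimes> b')"
      by (auto simp: fraction_def)
    note car = ab(1,2) *(1,2) S_closed(1)[OF ab(3)] S_closed(1)[OF ab(4)] S_closed(1)[OF *(3)]
      S_closed(1)[OF *(4)] S_closed(1)[OF *(5)] S_closed(1)[OF *(6)]
    have "(u \<otimes> v) \<otimes> ((s' \<otimes> t') \<otimes> (a \<otimes> b)) = (u \<otimes> (s' \<otimes> a)) \<otimes> (v \<otimes> (t' \<otimes> b))"
      using car by algebra
    also have "\<dots> = (u \<otimes> v) \<otimes> ((s \<otimes> t) \<otimes> (a' \<otimes> b'))" unfolding u v using car by algebra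
    finally have 1: "fraction R S (a' \<otimes> b') (s' \<otimes> t') = fraction R S (a \<otimes> b) (s \<otimes> t)"
      using ab * S_closed by (intro fraction_eqI[symmetric, of _ _ _ _ "u \<otimes> v"]) auto
    have "(u \<otimes> v) \<otimes> ((s' \<otimes> t') \<otimes> (t \<otimes> a \<oplus> s \<otimes> b))
        = (v \<otimes> t \<otimes> t') \<otimes> (u \<otimes> (s' \<otimes> a)) \<oplus> (u \<otimes> s \<otimes> s') \<otimes> (v \<otimes> (t' \<otimes> b))"
      using car by algebra
    also have "\<dots> = (u \<otimes> v) \<otimes> ((s \<otimes> t) \<otimes> (t' \<otimes> a' \<oplus> s' \<otimes> b'))" unfolding u v using car by algebra
    finally have 2: "fraction R S (t' \<otimes> a' \<oplus> s' \<otimes> b') (s' \<otimes> t') = fraction R S (t \<otimes> a \<oplus> s \<otimes> b) (s \<otimes> t)"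
      using ab * S_closed by (intro fraction_eqI[symmetric, of _ _ _ _ "u \<otimes> v"]) auto
    note 1 2
  }
  note * = this
  show "fraction R S a s \<otimes>\<^bsub>localization R S\<^esub> fraction R S b t = fraction R S (a \<otimes> b) (s \<otimes> t)"
  proof -
    have "(\<Union>(b', t') \<in> fraction R S b t. fraction R S (a' \<otimes> b') (s' \<otimes> t')) = fraction R S (a \<otimes> b) (s \<otimes> t)"
      if "(a', s') \<in> fraction R S a s" for a' s'
      using fraction_UN[OF ab(2,4), of "\<lambda>b' t'. fraction R S (a' \<otimes> b') (s' \<otimes> t')"]
        *(1)[OF that] *(1)[OF that fraction_self[OF ab(2,4)]] by simp
    then show ?thesis
      using fraction_UN[OF ab(1,3), of "\<lambda>a' s'. \<Union>(b', t') \<in> fraction R S b t. fraction R S (a' \<otimes> b') (s' \<otimes> t')"]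
        fraction_self[OF ab(1,3)] by (simp add: localization_def)
  qed
  show "fraction R S a s \<oplus>\<^bsub>localization R S\<^esub> fraction R S b t
        = fraction R S (t \<otimes> a \<oplus> s \<otimes> b) (s \<otimes> t)"
  proof -
    have "(\<Union>(b', t') \<in> fraction R S b t. fraction R S (t' \<otimes> a' \<oplus> s' \<otimes> b') (s' \<otimes> t'))
        = fraction R S (t \<otimes> a \<oplus> s \<otimes> b) (s \<otimes> t)"
      if "(a', s') \<in> fraction R S a s" for a' s'
      using fraction_UN[OF ab(2,4), of "\<lambda>b' t'. fraction R S (t' \<otimes> a' \<oplus> s' \<otimes> b') (s' \<otimes> t')"]
        *(2)[OF that] *(2)[OF that fraction_self[OF ab(2,4)]] by simp
    then show ?thesis
      using fraction_UN[OF ab(1,3), of "\<lambda>a' s'. \<Union>(b', t') \<in> fraction R S b t.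
          fraction R S (t' \<otimes> a' \<oplus> s' \<otimes> b') (s' \<otimes> t')"]
        fraction_self[OF ab(1,3)] by (simp add: localization_def)
  qed
next
  assume as: "r \<in> carrier R" "a \<in> carrier R" "s \<in> S"
  have "fraction R S (r \<otimes> a') s' = fraction R S (r \<otimes> a) s" if mem: "(a', s') \<in> fraction R S a s" for a' s'
  proof -
    obtain u where *: "a' \<in> carrier R" "s' \<in> S" "u \<in> S" and u: "u \<otimes> (s' \<otimes> a) = u \<otimes> (s \<otimes> a')"
      using mem by (auto simp: fraction_def)
    note car = as(1,2) *(1) S_closed(1)[OF as(3)] S_closed(1)[OF *(2)] S_closed(1)[OF *(3)]
    have "u \<otimes> (s' \<otimes> (r \<otimes> a)) = r \<otimes> (u \<otimes> (s' \<otimes> a))" using car by algebra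
    also have "\<dots> = u \<otimes> (s \<otimes> (r \<otimes> a'))" unfolding u using car by algebra
    finally show ?thesis
      using as * S_closed by (intro fraction_eqI[symmetric, of _ _ _ _ u]) auto
  qed
  then show "r \<odot>\<^bsub>localization R S\<^esub> fraction R S a s = fraction R S (r \<otimes> a) s"
    using fraction_UN[OF as(2,3), of "\<lambda>a' s'. fraction R S (r \<otimes> a') s'"]
    by (simp add: localization_def)
qed

lemma localizationE:
  assumes "x \<in> carrier (localization R S)"
  obtains a s where "x = fraction R S a s" "a \<in> carrier R" "s \<in> S"
  using assms by (auto simp: localization_def)

lemma localization_carrier:
  "\<lbrakk>a \<in> carrier R; s \<in> S\<rbrakk> \<Longrightarrow> fraction R S a s \<in> carrier (localization R S)"
  "x \<in> carrier (localization R S) \<Longrightarrow> \<exists>a \<in> carrier R. \<exists>s \<in> S. x = fraction R S a s"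
  "\<one>\<^bsub>localization R S\<^esub> = fraction R S \<one> \<one>" "\<zero>\<^bsub>localization R S\<^esub> = fraction R S \<zero> \<one>"
  by (auto simp: localization_def)

lemma localization_ring_algebra: "ring_algebra R (localization R S)"
  and localization_cring: "cring (localization R S)"
proof -
  let ?L = "localization R S"
  note sim = localization_simps localization_carrier(1,3,4) S_closed
  have eq: "fraction R S a s = fraction R S b t"
    if "a \<in> carrier R" "b \<in> carrier R" "s \<in> S" "t \<in> S" "t \<otimes> a = s \<otimes> b" for a b s t
    by (rule fraction_eqI[OF that(1-4) S_closed(2)]) (simp add: that(5))
  have ag: "abelian_group ?L"
  proof (rule abelian_groupI)
    fix x y assume L: "x \<in> carrier ?L" "y \<in> carrier ?L"
    obtain a s where x: "x = fraction R S a s" "a \<in> carrier R" "s \<in> S" by (rule localizationE[OF L(1)])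
    obtain b t where y: "y = fraction R S b t" "b \<in> carrier R" "t \<in> S" by (rule localizationE[OF L(2)])
    note car = x(2) y(2) S_closed(1)[OF x(3)] S_closed(1)[OF y(3)]
    show "x \<oplus>\<^bsub>?L\<^esub> y \<in> carrier ?L" using x y car by (simp add: sim)
    show "x \<oplus>\<^bsub>?L\<^esub> y = y \<oplus>\<^bsub>?L\<^esub> x"
      using x y car by (simp add: sim) (intro eq, simp_all add: sim, use car in algebra)
    fix z assume L': "z \<in> carrier ?L"
    obtain c w where z: "z = fraction R S c w" "c \<in> carrier R" "w \<in> S" by (rule localizationE[OF L'])
    note car = car z(2) S_closed(1)[OF z(3)]
    show "(x \<oplus>\<^bsub>?L\<^esub> y) \<oplus>\<^bsub>?L\<^esub> z = x \<oplus>\<^bsub>?L\<^esub> (y \<oplus>\<^bsub>?L\<^esub> z)"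
      using x y z car by (simp add: sim) (intro eq, simp_all add: sim, use car in algebra)
  next
    fix x assume L': "x \<in> carrier ?L"
    obtain a s where x: "x = fraction R S a s" "a \<in> carrier R" "s \<in> S" by (rule localizationE[OF L'])
    note car = x(2) S_closed(1)[OF x(3)]
    show "\<zero>\<^bsub>?L\<^esub> \<oplus>\<^bsub>?L\<^esub> x = x" using x car by (simp add: sim)
    show "\<exists>y\<in>carrier ?L. y \<oplus>\<^bsub>?L\<^esub> x = \<zero>\<^bsub>?L\<^esub>"
      using x car by (intro bexI[of _ "fraction R S (\<ominus> a) s"])
        (simp_all add: sim, intro eq, simp_all add: sim, use car in algebra)
  qed (simp add: sim)
  have ring: "ring ?L"
  proof (rule ringI[OF ag])
    show "monoid ?L"
    proof (rule monoidI)
      fix x y z assume L: "x \<in> carrier ?L" "y \<in> carrier ?L" "z \<in> carrier ?L"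
    obtain a s where x: "x = fraction R S a s" "a \<in> carrier R" "s \<in> S" by (rule localizationE[OF L(1)])
    obtain b t where y: "y = fraction R S b t" "b \<in> carrier R" "t \<in> S" by (rule localizationE[OF L(2)])
    obtain c w where z: "z = fraction R S c w" "c \<in> carrier R" "w \<in> S" by (rule localizationE[OF L(3)])
      show "x \<otimes>\<^bsub>?L\<^esub> y \<otimes>\<^bsub>?L\<^esub> z = x \<otimes>\<^bsub>?L\<^esub> (y \<otimes>\<^bsub>?L\<^esub> z)"
        using x y z by (simp add: sim m_assoc)
    qed (auto dest!: localization_carrier(2) simp: sim)
  next
    fix x y z assume L: "x \<in> carrier ?L" "y \<in> carrier ?L" "z \<in> carrier ?L"
    obtain a s where x: "x = fraction R S a s" "a \<in> carrier R" "s \<in> S" by (rule localizationE[OF L(1)])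
    obtain b t where y: "y = fraction R S b t" "b \<in> carrier R" "t \<in> S" by (rule localizationE[OF L(2)])
    obtain c w where z: "z = fraction R S c w" "c \<in> carrier R" "w \<in> S" by (rule localizationE[OF L(3)])
    note car = x(2) y(2) z(2) S_closed(1)[OF x(3)] S_closed(1)[OF y(3)] S_closed(1)[OF z(3)]
    show "(x \<oplus>\<^bsub>?L\<^esub> y) \<otimes>\<^bsub>?L\<^esub> z = x \<otimes>\<^bsub>?L\<^esub> z \<oplus>\<^bsub>?L\<^esub> y \<otimes>\<^bsub>?L\<^esub> z"
      using x y z car by (simp add: sim) (intro eq, simp_all add: sim, use car in algebra)
    show "z \<otimes>\<^bsub>?L\<^esub> (x \<oplus>\<^bsub>?L\<^esub> y) = z \<otimes>\<^bsub>?L\<^esub> x \<oplus>\<^bsub>?L\<^esub> z \<otimes>\<^bsub>?L\<^esub> y"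
      using x y z car by (simp add: sim) (intro eq, simp_all add: sim, use car in algebra)
  qed
  have comm: "x \<otimes>\<^bsub>?L\<^esub> y = y \<otimes>\<^bsub>?L\<^esub> x" if "x \<in> carrier ?L" "y \<in> carrier ?L" for x y
    using that by (auto dest!: localization_carrier(2) simp: sim m_comm)
  show "cring ?L"
    using ring comm by (auto simp: cring_def comm_monoid_def comm_monoid_axioms_def ring.is_monoid)
  have "module R ?L"
  proof (rule moduleI[OF is_cring ag])
    fix r r' x assume r: "r \<in> carrier R" "r' \<in> carrier R" and L': "x \<in> carrier ?L"
    obtain a s where x: "x = fraction R S a s" "a \<in> carrier R" "s \<in> S" by (rule localizationE[OF L'])
    note car = r x(2) S_closed(1)[OF x(3)]
    show "(r \<oplus> r') \<odot>\<^bsub>?L\<^esub> x = r \<odot>\<^bsub>?L\<^esub> x \<oplus>\<^bsub>?L\<^esub> r' \<odot>\<^bsub>?L\<^esub> x"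
      using x car by (simp add: sim) (intro eq, simp_all add: sim, use car in algebra)
    show "(r \<otimes> r') \<odot>\<^bsub>?L\<^esub> x = r \<odot>\<^bsub>?L\<^esub> (r' \<odot>\<^bsub>?L\<^esub> x)"
      using x car by (simp add: sim m_assoc)
  next
    fix r x y assume r: "r \<in> carrier R" and L: "x \<in> carrier ?L" "y \<in> carrier ?L"
    obtain a s where x: "x = fraction R S a s" "a \<in> carrier R" "s \<in> S" by (rule localizationE[OF L(1)])
    obtain b t where y: "y = fraction R S b t" "b \<in> carrier R" "t \<in> S" by (rule localizationE[OF L(2)])
    note car = r x(2) y(2) S_closed(1)[OF x(3)] S_closed(1)[OF y(3)]
    show "r \<odot>\<^bsub>?L\<^esub> (x \<oplus>\<^bsub>?L\<^esub> y) = r \<odot>\<^bsub>?L\<^esub> x \<oplus>\<^bsub>?L\<^esub> r \<odot>\<^bsub>?L\<^esub> y"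
      using x y car by (simp add: sim) (intro eq, simp_all add: sim, use car in algebra)
  qed (auto dest!: localization_carrier(2) simp: sim)
  moreover have "(r \<odot>\<^bsub>?L\<^esub> x) \<otimes>\<^bsub>?L\<^esub> y = r \<odot>\<^bsub>?L\<^esub> (x \<otimes>\<^bsub>?L\<^esub> y)"
    "x \<otimes>\<^bsub>?L\<^esub> (r \<odot>\<^bsub>?L\<^esub> y) = r \<odot>\<^bsub>?L\<^esub> (x \<otimes>\<^bsub>?L\<^esub> y)"
    if "r \<in> carrier R" "x \<in> carrier ?L" "y \<in> carrier ?L" for r x y
    using that by (auto dest!: localization_carrier(2) simp: sim m_ac)
  ultimately show "ring_algebra R ?L"
    using ring by (simp add: ring_algebra_def ring_algebra_axioms_def)
qed

end

lemma local_ring_at_ring_algebra: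
  assumes "primeideal P R"
  shows "ring_algebra R (local_ring_at R P)"
proof -
  interpret P: primeideal P R by fact
  have "\<one> \<notin> P" using P.I_notcarr P.one_imp_carrier by blast
  then have "submonoid (carrier R - P) R"
    by unfold_locales (use P.I_prime in auto)
  then show ?thesis unfolding local_ring_at_def by (rule localization_ring_algebra)
qed

end

lemma (in domain) fraction_field_ring_algebra: "ring_algebra R (fraction_field R)"
proof -
  have "submonoid (carrier R - {\<zero>}) R"
    by unfold_locales (use integral in auto)
  then show ?thesis unfolding fraction_field_def by (rule localization_ring_algebra)
qed

end

theory Submission
  imports Defs "HOL-Algebra.Free_Abelian_Groups"
begin

text \<open>
  Let \<open>I\<close> be the trace of a projective module, \<open>Q\<close> the field of fractions of \<open>R\<close> and
  \<open>A = \<Lambda> \<otimes> Q\<close>.  The theorem follows once \<open>I\<close> is known to be generated, as a two-sided ideal, by the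
  entries of an idempotent matrix over \<open>\<Lambda>\<close>: the rows of the matrix span a finitely generated
  projective left module with trace \<open>I\<close>, and the transposed matrix over the opposite ring does the
  same for right modules (\<open>idempotent_matrix_module\<close>, \<open>idempotent_matrix_opposite\<close>).

  Locally, a single idempotent suffices.  An ideal of a semiperfect ring contains an idempotent \<open>e\<close>
  that generates it modulo the Jacobson radical.  If the ideal is the extension of a trace ideal,
  then \<open>e\<close> generates it outright, because a trace ideal inside \<open>J + K\<close>, with \<open>J\<close> in the radical, lies
  in \<open>K\<close>; this is Nakayama's lemma applied to the coordinates of an element with respect to a dual
  basis (\<open>projective_trace_image_subset\<close>).  Hence, for every maximal ideal \<open>m\<close> of \<open>R\<close>, the
  localization of \<open>I\<close> is \<open>\<Lambda>\<^sub>m e\<^sub>m \<Lambda>\<^sub>m\<close> for an idempotent \<open>e\<^sub>m\<close>.  If \<open>I \<noteq> 0\<close>, then \<open>I\<close> contains a non-zero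
  element \<open>r\<close> of \<open>R\<close>, as \<open>A\<close> is simple; only finitely many \<open>m\<close> contain \<open>r\<close>, and \<open>e\<^sub>m = \<one>\<close> can be taken at
  all others.  So only finitely many different idempotents occur.

  To glue them, the local data are placed in one \<open>A\<close>-module.  If \<open>f\<close> is a primitive idempotent of the
  simple artinian ring \<open>A\<close>, every \<open>e\<^sub>m A\<close> is a power of \<open>f A\<close>, and so suitable powers of all the \<open>e\<^sub>m A\<close>
  are isomorphic to \<open>V = (f A)\<^sup>n\<close> for one \<open>n\<close>.  Let \<open>L\<close> be the set of all vectors of \<open>V\<close> that have, for
  each \<open>m\<close>, coordinates in \<open>e\<^sub>m \<Lambda>\<^sub>m\<close>.  Since \<open>R\<close> is h-local, for every \<open>b \<noteq> 0\<close> and \<open>m\<close> there is \<open>c\<close> outside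
  \<open>m\<close> that is divisible by \<open>b\<close> in every other localization (\<open>h_local_separation\<close>).  If \<open>b\<close> is a common
  denominator of the finitely many changes of coordinates, such a \<open>c\<close> carries the basis vectors for
  \<open>m\<close> into \<open>L\<close>, and turns the coordinate functions for \<open>m\<close> into functionals \<open>L \<rightarrow> I\<close>.  Therefore
  multiplication by \<open>c\<^sup>2\<close> on \<open>L\<close> is a sum of maps \<open>v \<mapsto> x g(v)\<close> with \<open>x \<in> L\<close> and \<open>g : L \<rightarrow> I\<close>.  The elements
  of \<open>R\<close> that act on \<open>L\<close> as such a sum form an ideal; it lies in no maximal ideal, so \<open>\<one>\<close> belongs to it.
  This gives \<open>x\<^sub>j\<close> and \<open>g\<^sub>j\<close> such that every \<open>v\<close> in \<open>L\<close> is the sum of the \<open>x\<^sub>j g\<^sub>j(v)\<close>, and \<open>(g\<^sub>i(x\<^sub>j))\<close> is the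
  matrix sought (\<open>glued_idempotent_matrix\<close>).
\<close>

section \<open>Left ideals and maximal ideals\<close>

lemma (in ring) left_ideal_iff:
  "left_ideal I R \<longleftrightarrow> I \<subseteq> carrier R \<and> \<zero> \<in> I \<and> (\<forall>x \<in> I. \<forall>y \<in> I. x \<oplus> y \<in> I) \<and>
     (\<forall>a \<in> carrier R. \<forall>x \<in> I. a \<otimes> x \<in> I)" (is "_ \<longleftrightarrow> ?rhs")
proof
  assume "left_ideal I R"
  then have s: "submodule I R (regular_module R)" by (simp add: left_ideal_def)
  note g = submodule.axioms(1)[OF s]
  show ?rhs
    using subgroup.subset[OF g] subgroup.one_closed[OF g] subgroup.m_closed[OF g]
      submodule.smult_closed[OF s] by auto
next
  assume r: ?rhs
  interpret M: left_module R "regular_module R" by (rule regular_left_module)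
  have inv: "\<ominus>\<^bsub>regular_module R\<^esub> x \<in> I" if "x \<in> I" for x
  proof -
    have x: "x \<in> carrier R" using r that by auto
    have "(\<ominus> \<one>) \<otimes> x \<in> I" using r that by auto
    moreover have "\<ominus>\<^bsub>regular_module R\<^esub> x = \<ominus> x"
      using x by (intro M.minus_equality) (auto simp: l_neg)
    moreover have "(\<ominus> \<one>) \<otimes> x = \<ominus> x" using x by (simp add: l_minus)
    ultimately show ?thesis by simp
  qed
  show "left_ideal I R"
    unfolding left_ideal_def
    by (intro submodule.intro subgroup.intro submodule_axioms.intro)
      (use r inv in \<open>auto simp: a_inv_def\<close>)
qed

lemma (in ring) left_idealD:
  assumes "left_ideal I R"
  shows "I \<subseteq> carrier R" "\<zero> \<in> I" "\<lbrakk>x \<in> I; y \<in> I\<rbrakk> \<Longrightarrow> x \<oplus> y \<in> I"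
    "\<lbrakk>a \<in> carrier R; x \<in> I\<rbrakk> \<Longrightarrow> a \<otimes> x \<in> I" "\<lbrakk>x \<in> I; y \<in> I\<rbrakk> \<Longrightarrow> x \<ominus> y \<in> I"
proof -
  note I = assms[unfolded left_ideal_iff]
  show "I \<subseteq> carrier R" "\<zero> \<in> I" "\<lbrakk>x \<in> I; y \<in> I\<rbrakk> \<Longrightarrow> x \<oplus> y \<in> I"
    "\<lbrakk>a \<in> carrier R; x \<in> I\<rbrakk> \<Longrightarrow> a \<otimes> x \<in> I" using I by auto
  show "x \<ominus> y \<in> I" if xy: "x \<in> I" "y \<in> I"
  proof -
    have c: "x \<in> carrier R" "y \<in> carrier R" using I xy by auto
    have "x \<oplus> (\<ominus> \<one>) \<otimes> y \<in> I" using I xy by auto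
    then show ?thesis using c by (simp add: l_minus a_minus_def)
  qed
qed

lemma (in ring) ideal_imp_left_ideal:
  assumes "ideal I R" shows "left_ideal I R"
proof -
  interpret ideal I R by fact
  show ?thesis unfolding left_ideal_iff using I_l_closed Icarr by auto
qed

lemma (in cring) left_ideal_imp_ideal:
  assumes "left_ideal I R" shows "ideal I R"
proof (rule idealI[OF ring_axioms])
  show "subgroup I (add_monoid R)"
    by (rule add.subgroupI)
      (use left_idealD[OF assms] left_idealD(5)[OF assms left_idealD(2)[OF assms]]
        in \<open>auto simp: a_minus_def a_inv_def subset_iff\<close>)
  show "x \<otimes> a \<in> I" "a \<otimes> x \<in> I" if "a \<in> I" "x \<in> carrier R" for a x
    using left_idealD(4)[OF assms that(2,1)] left_idealD(1)[OF assms] that m_comm[of x a] by auto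
qed

lemma (in ring) left_ideal_principal:
  assumes "x \<in> carrier R"
  shows "left_ideal ((\<lambda>a. a \<otimes> x) ` carrier R) R"
  unfolding left_ideal_iff
proof (intro conjI ballI)
  show "\<zero> \<in> (\<lambda>a. a \<otimes> x) ` carrier R" using assms by (intro image_eqI[of _ _ \<zero>]) auto
qed (use assms in \<open>auto simp: l_distr[symmetric] m_assoc[symmetric]\<close>)

lemma (in ring) left_ideal_sum:
  assumes "left_ideal H R" "left_ideal K R"
  shows "left_ideal {h \<oplus> k | h k. h \<in> H \<and> k \<in> K} R"
proof -
  note H = left_idealD[OF assms(1)] and K = left_idealD[OF assms(2)]
  show ?thesis
    unfolding left_ideal_iff
  proof (intro conjI ballI subsetI)
    show "\<zero> \<in> {h \<oplus> k | h k. h \<in> H \<and> k \<in> K}" using H(2) K(2) by force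
  next
    fix x assume "x \<in> {h \<oplus> k | h k. h \<in> H \<and> k \<in> K}"
    then show "x \<in> carrier R" using H(1) K(1) by auto
  next
    fix x y assume "x \<in> {h \<oplus> k | h k. h \<in> H \<and> k \<in> K}" "y \<in> {h \<oplus> k | h k. h \<in> H \<and> k \<in> K}"
    then obtain h k h' k' where *: "x = h \<oplus> k" "y = h' \<oplus> k'" "h \<in> H" "k \<in> K" "h' \<in> H" "k' \<in> K" by blast
    have "x \<oplus> y = (h \<oplus> h') \<oplus> (k \<oplus> k')" using * H(1) K(1) by (simp add: subset_iff a_ac)
    then show "x \<oplus> y \<in> {h \<oplus> k | h k. h \<in> H \<and> k \<in> K}" using H(3) K(3) * by blast
  next
    fix a x assume a: "a \<in> carrier R" and "x \<in> {h \<oplus> k | h k. h \<in> H \<and> k \<in> K}"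
    then obtain h k where *: "x = h \<oplus> k" "h \<in> H" "k \<in> K" by blast
    have "a \<otimes> x = a \<otimes> h \<oplus> a \<otimes> k" using * H(1) K(1) a by (auto simp: r_distr subset_iff)
    then show "a \<otimes> x \<in> {h \<oplus> k | h k. h \<in> H \<and> k \<in> K}" using H(4) K(4) * a by blast
  qed
qed

lemma (in ring) left_ideal_sum_upper:
  assumes "left_ideal H R" "left_ideal K R"
  shows "H \<subseteq> {h \<oplus> k | h k. h \<in> H \<and> k \<in> K}" "K \<subseteq> {h \<oplus> k | h k. h \<in> H \<and> k \<in> K}"
proof -
  note H = left_idealD[OF assms(1)] and K = left_idealD[OF assms(2)]
  have "x = x \<oplus> \<zero>" if "x \<in> H" for x using H(1) that by auto
  then show "H \<subseteq> {h \<oplus> k | h k. h \<in> H \<and> k \<in> K}" using K(2) by blast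
  have "x = \<zero> \<oplus> x" if "x \<in> K" for x using K(1) that by auto
  then show "K \<subseteq> {h \<oplus> k | h k. h \<in> H \<and> k \<in> K}" using H(2) by blast
qed

text \<open>By Zorn's lemma.  The set \<open>X\<close> to be avoided is \<open>{\<one>}\<close> for maximal (left) ideals, a
  multiplicative set for prime ideals, and the non-zero part of a left ideal for complements.\<close>

lemma (in ring) left_ideal_maximal_disjoint:
  assumes "left_ideal H R" "H \<inter> X = {}"
  obtains M where "left_ideal M R" "H \<subseteq> M" "M \<inter> X = {}"
    "\<And>M'. \<lbrakk>left_ideal M' R; M \<subseteq> M'; M' \<inter> X = {}\<rbrakk> \<Longrightarrow> M' = M"
proof -
  let ?A = "{M. left_ideal M R \<and> H \<subseteq> M \<and> M \<inter> X = {}}"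
  have "\<exists>M\<in>?A. \<forall>X\<in>?A. M \<subseteq> X \<longrightarrow> X = M"
  proof (rule subset_Zorn_nonempty)
    show "?A \<noteq> {}" using assms by blast
    fix C assume C: "C \<noteq> {}" "subset.chain ?A C"
    have CA: "C \<subseteq> ?A" and tot: "\<And>Y Z. Y \<in> C \<Longrightarrow> Z \<in> C \<Longrightarrow> Y \<subseteq> Z \<or> Z \<subseteq> Y"
      using C(2) unfolding subset.chain_def by blast+
    have li: "left_ideal Y R" if "Y \<in> C" for Y using CA that by auto
    have "left_ideal (\<Union>C) R"
      unfolding left_ideal_iff
    proof (intro conjI ballI)
      show "\<Union>C \<subseteq> carrier R" using left_idealD(1)[OF li] by auto
      show "\<zero> \<in> \<Union>C" using C(1) left_idealD(2)[OF li] by auto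
      show "a \<otimes> x \<in> \<Union>C" if "a \<in> carrier R" "x \<in> \<Union>C" for a x
        using left_idealD(4)[OF li] that by auto
      show "x \<oplus> y \<in> \<Union>C" if xy: "x \<in> \<Union>C" "y \<in> \<Union>C" for x y
      proof -
        obtain Y Z where "x \<in> Y" "y \<in> Z" "Y \<in> C" "Z \<in> C" using xy by auto
        then show ?thesis using tot[of Y Z] left_idealD(3)[OF li, of Y x y] left_idealD(3)[OF li, of Z x y]
          by blast
      qed
    qed
    then show "\<Union>C \<in> ?A" using C(1) CA by auto
  qed
  then obtain M where M: "left_ideal M R" "H \<subseteq> M" "M \<inter> X = {}"
    "\<And>M'. \<lbrakk>left_ideal M' R; H \<subseteq> M'; M' \<inter> X = {}; M \<subseteq> M'\<rbrakk> \<Longrightarrow> M' = M" by auto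
  show thesis by (rule that[OF M(1-3)]) (use M in blast)
qed

lemma (in cring) maximal_ideal_exists:
  assumes "ideal I R" "I \<noteq> carrier R"
  obtains m where "maximalideal m R" "I \<subseteq> m"
proof -
  have "I \<inter> {\<one>} = {}" using ideal.one_imp_carrier[OF assms(1)] assms(2) by blast
  then obtain M where M: "left_ideal M R" "I \<subseteq> M" "M \<inter> {\<one>} = {}"
    "\<And>M'. \<lbrakk>left_ideal M' R; M \<subseteq> M'; M' \<inter> {\<one>} = {}\<rbrakk> \<Longrightarrow> M' = M"
    using left_ideal_maximal_disjoint[OF ideal_imp_left_ideal[OF assms(1)]] by metis
  have "maximalideal M R"
  proof (rule maximalidealI[OF left_ideal_imp_ideal[OF M(1)]])
    show "carrier R \<noteq> M" using M(3) by auto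
    show "J = M \<or> J = carrier R" if J: "ideal J R" "M \<subseteq> J" "J \<subseteq> carrier R" for J
      using M(4)[OF ideal_imp_left_ideal[OF J(1)] J(2)] ideal.one_imp_carrier[OF J(1)] by blast
  qed
  then show thesis using that M(2) by blast
qed

lemma (in cring) ideal_eq_carrier_local:
  assumes "ideal I R" "\<And>m. maximalideal m R \<Longrightarrow> \<exists>s \<in> I. s \<notin> m"
  shows "\<one> \<in> I"
proof (rule ccontr)
  assume "\<one> \<notin> I"
  then have "I \<noteq> carrier R" by auto
  then obtain m where "maximalideal m R" "I \<subseteq> m" using maximal_ideal_exists[OF assms(1)] by metis
  then show False using assms(2)[of m] by blast
qed

section \<open>The Jacobson radical and semiperfect rings\<close>

text \<open>The Jacobson radical is an intersection of left ideals; this identity is the reason why it is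
  closed under multiplication from the right as well.\<close>

lemma (in ring) one_minus_commute_left_inverse:
  assumes ab: "a \<in> carrier R" "b \<in> carrier R" and c: "c \<in> carrier R" "c \<otimes> (\<one> \<ominus> a \<otimes> b) = \<one>"
  shows "(\<one> \<oplus> b \<otimes> c \<otimes> a) \<otimes> (\<one> \<ominus> b \<otimes> a) = \<one>"
proof -
  have "(b \<otimes> c \<otimes> a) \<otimes> (\<one> \<ominus> b \<otimes> a) = b \<otimes> (c \<otimes> (\<one> \<ominus> a \<otimes> b)) \<otimes> a"
    using ab c(1) by (simp add: a_minus_def r_distr l_distr m_assoc r_minus l_minus)
  also have "\<dots> = b \<otimes> a" using ab c by simp
  finally have "(\<one> \<oplus> b \<otimes> c \<otimes> a) \<otimes> (\<one> \<ominus> b \<otimes> a) = (\<one> \<ominus> b \<otimes> a) \<oplus> b \<otimes> a"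
    using ab c(1) by (simp add: l_distr)
  then show ?thesis using ab by (simp add: a_minus_def a_assoc l_neg)
qed

lemma (in ring) jacobson_radical_iff:
  "x \<in> jacobson_radical R \<longleftrightarrow>
     x \<in> carrier R \<and> (\<forall>a \<in> carrier R. \<exists>c \<in> carrier R. c \<otimes> (\<one> \<ominus> a \<otimes> x) = \<one>)"
proof
  assume x: "x \<in> jacobson_radical R"
  then have xR: "x \<in> carrier R" by (simp add: jacobson_radical_def)
  have "\<exists>c \<in> carrier R. c \<otimes> (\<one> \<ominus> a \<otimes> x) = \<one>" if a: "a \<in> carrier R" for a
  proof (rule ccontr)
    assume neg: "\<not> ?thesis"
    let ?y = "\<one> \<ominus> a \<otimes> x" and ?L = "(\<lambda>c. c \<otimes> (\<one> \<ominus> a \<otimes> x)) ` carrier R"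
    have y: "?y \<in> carrier R" using a xR by simp
    have "?L \<inter> {\<one>} = {}" using neg by auto
    then obtain M where M: "left_ideal M R" "?L \<subseteq> M" "M \<inter> {\<one>} = {}"
      "\<And>M'. \<lbrakk>left_ideal M' R; M \<subseteq> M'; M' \<inter> {\<one>} = {}\<rbrakk> \<Longrightarrow> M' = M"
      using left_ideal_maximal_disjoint[OF left_ideal_principal[OF y]] by metis
    have full: "J = carrier R" if "left_ideal J R" "\<one> \<in> J" for J
    proof -
      have "r \<in> J" if "r \<in> carrier R" for r using left_idealD(4)[OF \<open>left_ideal J R\<close> that \<open>\<one> \<in> J\<close>] that by simp
      then show ?thesis using left_idealD(1)[OF that(1)] by auto
    qed
    have "maximal_left_ideal M R"
      unfolding maximal_left_ideal_def using M full by blast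
    then have xM: "x \<in> M" using x by (auto simp: jacobson_radical_def)
    have "?y \<in> M" using M(2) y by (intro subsetD[OF M(2)] image_eqI[of _ _ \<one>]) auto
    then have "?y \<oplus> a \<otimes> x \<in> M" using left_idealD(3,4)[OF M(1)] xM a by blast
    moreover have "?y \<oplus> a \<otimes> x = \<one>" using a xR by (simp add: a_minus_def a_assoc l_neg)
    ultimately show False using M(3) by auto
  qed
  then show "x \<in> carrier R \<and> (\<forall>a \<in> carrier R. \<exists>c \<in> carrier R. c \<otimes> (\<one> \<ominus> a \<otimes> x) = \<one>)" using xR by blast
next
  assume x: "x \<in> carrier R \<and> (\<forall>a \<in> carrier R. \<exists>c \<in> carrier R. c \<otimes> (\<one> \<ominus> a \<otimes> x) = \<one>)"
  have "x \<in> M" if M: "maximal_left_ideal M R" for M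
  proof (rule ccontr)
    assume xM: "x \<notin> M"
    have Ml: "left_ideal M R" and Mn: "M \<noteq> carrier R"
      and mx: "\<And>J. left_ideal J R \<Longrightarrow> M \<subseteq> J \<Longrightarrow> J = M \<or> J = carrier R"
      using M by (auto simp: maximal_left_ideal_def)
    note Md = left_idealD[OF Ml]
    let ?L = "(\<lambda>a. a \<otimes> x) ` carrier R" and ?K = "{h \<oplus> k | h k. h \<in> M \<and> k \<in> (\<lambda>a. a \<otimes> x) ` carrier R}"
    have L: "left_ideal ?L R" using left_ideal_principal x by blast
    have K: "left_ideal ?K R" by (rule left_ideal_sum[OF Ml L])
    have "M \<subseteq> ?K" by (rule left_ideal_sum_upper(1)[OF Ml L])
    moreover have "x \<in> ?L" using x by (intro image_eqI[of _ _ \<one>]) auto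
    then have "x \<in> ?K" using left_ideal_sum_upper(2)[OF Ml L] by blast
    ultimately have "?K = carrier R" using mx[OF K] xM by blast
    then obtain h a where h: "h \<in> M" "a \<in> carrier R" "\<one> = h \<oplus> a \<otimes> x"
      using one_closed by blast
    have hR: "h \<in> carrier R" using h(1) Md(1) by auto
    have "\<one> \<ominus> a \<otimes> x = h" using h(2,3) hR x by (simp add: a_minus_def a_assoc r_neg)
    then have "\<one> \<in> M" using x h Md(4) by metis
    then have "carrier R \<subseteq> M" using Md(4) r_one by (metis subsetI)
    then show False using Mn Md(1) by blast
  qed
  then show "x \<in> jacobson_radical R" using x by (auto simp: jacobson_radical_def)
qed

lemma (in ring) jacobson_radical_ideal: "ideal (jacobson_radical R) R"
proof (rule idealI[OF ring_axioms])
  let ?J = "jacobson_radical R"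
  have li: "left_ideal ?J R"
    unfolding left_ideal_iff jacobson_radical_def
    using left_idealD(2-4) by (auto simp: maximal_left_ideal_def)
  show "subgroup ?J (add_monoid R)"
    by (rule add.subgroupI)
      (use left_idealD[OF li] left_idealD(5)[OF li left_idealD(2)[OF li]]
        in \<open>auto simp: a_minus_def a_inv_def subset_iff\<close>)
  fix x y assume x: "x \<in> ?J" and y: "y \<in> carrier R"
  show "y \<otimes> x \<in> ?J" using left_idealD(4)[OF li y x] .
  have xR: "x \<in> carrier R" using x by (simp add: jacobson_radical_def)
  have "\<exists>c \<in> carrier R. c \<otimes> (\<one> \<ominus> a \<otimes> (x \<otimes> y)) = \<one>" if a: "a \<in> carrier R" for a
  proof -
    obtain c where c: "c \<in> carrier R" "c \<otimes> (\<one> \<ominus> (y \<otimes> a) \<otimes> x) = \<one>"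
      using x y a unfolding jacobson_radical_iff by blast
    then have "c \<otimes> (\<one> \<ominus> y \<otimes> (a \<otimes> x)) = \<one>" using y a xR by (simp add: m_assoc)
    from one_minus_commute_left_inverse[OF y _ c(1) this]
    have "(\<one> \<oplus> (a \<otimes> x) \<otimes> c \<otimes> y) \<otimes> (\<one> \<ominus> a \<otimes> (x \<otimes> y)) = \<one>" using a xR y by (simp add: m_assoc)
    then show ?thesis using a xR y c(1) by blast
  qed
  then show "x \<otimes> y \<in> ?J" unfolding jacobson_radical_iff using xR y by blast
qed

lemma (in ring) jacobson_radical_unit:
  assumes "j \<in> jacobson_radical R"
  shows "\<one> \<ominus> j \<in> Units R"
proof -
  have jR: "j \<in> carrier R" and inv: "\<And>a. a \<in> carrier R \<Longrightarrow> \<exists>c \<in> carrier R. c \<otimes> (\<one> \<ominus> a \<otimes> j) = \<one>"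
    using assms unfolding jacobson_radical_iff by auto
  obtain c where c: "c \<in> carrier R" "c \<otimes> (\<one> \<ominus> j) = \<one>" using inv[of \<one>] jR by auto
  \<comment> \<open>\<open>c = \<one> + c j\<close> has the same form as \<open>\<one> - j\<close>, so the left inverse \<open>c\<close> has a left inverse itself.\<close>
  have cd: "\<one> \<ominus> (\<ominus> c) \<otimes> j = c"
  proof -
    have "c = \<one> \<oplus> c \<otimes> j"
      using c jR by (metis (no_types, lifting) a_minus_def r_distr r_minus r_one a_inv_closed m_closed
          one_closed a_assoc l_neg r_zero)
    then show ?thesis using c jR by (simp add: a_minus_def l_minus)
  qed
  obtain d where d: "d \<in> carrier R" "d \<otimes> c = \<one>" using inv[of "\<ominus> c"] c(1) cd by auto
  have "d = d \<otimes> (c \<otimes> (\<one> \<ominus> j))" using c(2) d(1) by simp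
  also have "\<dots> = \<one> \<ominus> j" using d c(1) jR by (simp add: m_assoc[symmetric])
  finally have "(\<one> \<ominus> j) \<otimes> c = \<one>" using d by simp
  then show ?thesis using c jR unfolding Units_def by auto
qed

text \<open>A complement \<open>C\<close> of the ideal \<open>I\<close> among left ideals gives \<open>\<one> = x + y\<close>, and \<open>I C \<subseteq> I \<inter> C = 0\<close>.\<close>

lemma semisimple_ring_ideal_right_unit:
  fixes R (structure)
  assumes ss: "semisimple_ring R" and I: "ideal I R"
  obtains x where "x \<in> I" "\<And>z. z \<in> I \<Longrightarrow> z \<otimes>\<^bsub>R\<^esub> x = z"
proof -
  interpret ring R using ss by (simp add: semisimple_ring_def)
  interpret I: ideal I R by (rule I)
  have IL: "left_ideal I R" by (rule ideal_imp_left_ideal[OF I])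
  have Z: "left_ideal {\<zero>} R" by (rule ideal_imp_left_ideal[OF zeroideal])
  obtain C where C: "left_ideal C R" "C \<inter> (I - {\<zero>}) = {}"
    "\<And>M'. \<lbrakk>left_ideal M' R; C \<subseteq> M'; M' \<inter> (I - {\<zero>}) = {}\<rbrakk> \<Longrightarrow> M' = C"
    using left_ideal_maximal_disjoint[OF Z, of "I - {\<zero>}"] by (metis Diff_disjoint inf_commute)
  note Cd = left_idealD[OF C(1)]
  let ?K = "{h \<oplus> k | h k. h \<in> I \<and> k \<in> C}"
  have K: "left_ideal ?K R" by (rule left_ideal_sum[OF IL C(1)])
  have CK: "C \<subseteq> ?K" by (rule left_ideal_sum_upper(2)[OF IL C(1)])
  \<comment> \<open>A simple left ideal outside \<open>I + C\<close> could be added to \<open>C\<close>, which is maximal.\<close>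
  have simp: "N \<subseteq> ?K" if N: "simple_submodule R (regular_module R) N" for N
  proof (rule ccontr)
    assume nsub: "\<not> N \<subseteq> ?K"
    have NL: "left_ideal N R" and min: "\<And>H. left_ideal H R \<Longrightarrow> H \<subseteq> N \<Longrightarrow> H = {\<zero>} \<or> H = N"
      using N by (auto simp: simple_submodule_def left_ideal_def)
    note Nd = left_idealD[OF NL]
    have "left_ideal (N \<inter> ?K) R"
      using NL K unfolding left_ideal_iff[of N] left_ideal_iff[of ?K] left_ideal_iff[of "N \<inter> ?K"] by blast
    then have NK: "N \<inter> ?K = {\<zero>}" using min[of "N \<inter> ?K"] nsub by blast
    let ?C' = "{h \<oplus> k | h k. h \<in> N \<and> k \<in> C}"
    have C': "left_ideal ?C' R" by (rule left_ideal_sum[OF NL C(1)])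
    have CC': "C \<subseteq> ?C'" by (rule left_ideal_sum_upper(2)[OF NL C(1)])
    have NC': "N \<subseteq> ?C'" by (rule left_ideal_sum_upper(1)[OF NL C(1)])
    have "?C' \<inter> (I - {\<zero>}) = {}"
    proof (rule equals0I)
      fix z assume "z \<in> ?C' \<inter> (I - {\<zero>})"
      then obtain h k where z: "z = h \<oplus> k" "h \<in> N" "k \<in> C" "z \<in> I" "z \<noteq> \<zero>" by blast
      have c: "h \<in> carrier R" "k \<in> carrier R" using z Nd(1) Cd(1) by auto
      have "\<ominus> k \<in> C" using Cd(5)[OF Cd(2) z(3)] c by (simp add: a_minus_def)
      moreover have "h = z \<oplus> \<ominus> k" using z(1) c by (simp add: a_assoc r_neg)
      ultimately have "h \<in> ?K" using z(4) by blast
      then have "h = \<zero>" using NK z(2) by blast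
      then show False using z c C(2) by auto
    qed
    then have "?C' = C" by (rule C(3)[OF C' CC'])
    then have "N \<subseteq> C" using NC' by simp
    then show False using CK nsub by (meson order_trans)
  qed
  have "submodule ?K R (regular_module R)" using K by (simp add: left_ideal_def)
  then have "carrier R \<subseteq> ?K"
    using ss simp unfolding semisimple_ring_def semisimple_module_def mod_span_def regular_module_simps(1)
    by blast
  then obtain x y where xy: "\<one> = x \<oplus> y" "x \<in> I" "y \<in> C" using one_closed by blast
  have c: "x \<in> carrier R" "y \<in> carrier R" using xy Cd(1) I.Icarr by auto
  have "z \<otimes> x = z" if z: "z \<in> I" for z
  proof -
    have zR: "z \<in> carrier R" using z I.Icarr by simp
    have "z \<otimes> y \<in> I \<inter> C" using I.I_r_closed[OF z c(2)] Cd(4)[OF zR xy(3)] by blast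
    then have "z \<otimes> y = \<zero>" using C(2) by blast
    then have "z \<otimes> (x \<oplus> y) = z \<otimes> x" using zR c by (simp add: r_distr)
    then show ?thesis using xy(1)[symmetric] zR by simp
  qed
  then show thesis using that xy(2) by blast
qed

text \<open>Modulo the radical the ideal has a right unit, which is an idempotent and lifts to an idempotent
  of \<open>T\<close>.  That the lift can be found inside \<open>I\<close> is what the proof adds.\<close>

lemma semiperfect_ideal_idempotent:
  assumes sp: "semiperfect T" and I: "ideal I T"
  obtains e where "e \<in> I" "e \<otimes>\<^bsub>T\<^esub> e = e" "\<And>z. z \<in> I \<Longrightarrow> z \<ominus>\<^bsub>T\<^esub> z \<otimes>\<^bsub>T\<^esub> e \<in> jacobson_radical T"
proof -
  interpret ring T using sp by (simp add: semiperfect_def)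
  interpret I: ideal I T by (rule I)
  let ?J = "jacobson_radical T"
  interpret J: ideal ?J T by (rule jacobson_radical_ideal)
  have hom: "(+>\<^bsub>T\<^esub>) ?J \<in> ring_hom T (T Quot ?J)" by (rule J.rcos_ring_hom)
  have Ibar: "ideal ((+>\<^bsub>T\<^esub>) ?J ` I) (T Quot ?J)"
    by (rule ring_ideal_imp_quot_ideal[OF J.is_ideal I])
  have ss: "semisimple_ring (T Quot ?J)" using sp by (simp add: semiperfect_def)
  obtain x where x: "x \<in> I" "\<And>z. z \<in> I \<Longrightarrow> (?J +>\<^bsub>T\<^esub> z) \<otimes>\<^bsub>T Quot ?J\<^esub> (?J +>\<^bsub>T\<^esub> x) = ?J +>\<^bsub>T\<^esub> z"
    using semisimple_ring_ideal_right_unit[OF ss Ibar] by (metis (no_types, lifting) image_iff)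
  have xT: "x \<in> carrier T" using x I.Icarr by simp
  have zx: "z \<otimes>\<^bsub>T\<^esub> x \<ominus>\<^bsub>T\<^esub> z \<in> ?J" if z: "z \<in> I" for z
  proof -
    have zT: "z \<in> carrier T" using z I.Icarr by simp
    have "?J +>\<^bsub>T\<^esub> (z \<otimes>\<^bsub>T\<^esub> x) = ?J +>\<^bsub>T\<^esub> z"
      using x(2)[OF z] ring_hom_mult[OF hom zT xT] by simp
    then show ?thesis using quotient_eq_iff_same_a_r_cos[OF J.is_ideal] zT xT by simp
  qed
  obtain e where e: "e \<in> carrier T" "e \<otimes>\<^bsub>T\<^esub> e = e" "e \<ominus>\<^bsub>T\<^esub> x \<in> ?J"
    using sp zx[OF x(1)] xT unfolding semiperfect_def idempotents_lift_def by blast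
  \<comment> \<open>\<open>e (\<one> - (e - x)) = e x\<close> lies in \<open>I\<close>, and \<open>\<one> - (e - x)\<close> is a unit.\<close>
  let ?u = "\<one>\<^bsub>T\<^esub> \<ominus>\<^bsub>T\<^esub> (e \<ominus>\<^bsub>T\<^esub> x)"
  have u: "?u \<in> Units T" by (rule jacobson_radical_unit[OF e(3)])
  have "e \<otimes>\<^bsub>T\<^esub> ?u = e \<ominus>\<^bsub>T\<^esub> (e \<ominus>\<^bsub>T\<^esub> e \<otimes>\<^bsub>T\<^esub> x)"
    using e(1,2) xT by (simp add: a_minus_def r_distr r_minus)
  also have "\<dots> = e \<otimes>\<^bsub>T\<^esub> x"
    using e(1) xT by (simp add: a_minus_def minus_add a_assoc[symmetric] r_neg)
  finally have eu: "e \<otimes>\<^bsub>T\<^esub> ?u = e \<otimes>\<^bsub>T\<^esub> x" .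
  have "e = (e \<otimes>\<^bsub>T\<^esub> ?u) \<otimes>\<^bsub>T\<^esub> inv\<^bsub>T\<^esub> ?u"
    using e(1) u by (simp add: m_assoc Units_closed del: minus_closed)
  then have eI: "e \<in> I"
    using eu I.I_r_closed[OF I.I_l_closed[OF x(1) e(1)] Units_inv_closed[OF u]] by simp
  have "z \<ominus>\<^bsub>T\<^esub> z \<otimes>\<^bsub>T\<^esub> e \<in> ?J" if z: "z \<in> I" for z
  proof -
    have zT: "z \<in> carrier T" using z I.Icarr by simp
    have "\<ominus>\<^bsub>T\<^esub> ((z \<otimes>\<^bsub>T\<^esub> x \<ominus>\<^bsub>T\<^esub> z) \<oplus>\<^bsub>T\<^esub> z \<otimes>\<^bsub>T\<^esub> (e \<ominus>\<^bsub>T\<^esub> x)) \<in> ?J"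
      by (intro J.a_inv_closed J.a_closed zx[OF z] J.I_l_closed[OF e(3) zT])
    moreover have "\<ominus>\<^bsub>T\<^esub> ((z \<otimes>\<^bsub>T\<^esub> x \<ominus>\<^bsub>T\<^esub> z) \<oplus>\<^bsub>T\<^esub> z \<otimes>\<^bsub>T\<^esub> (e \<ominus>\<^bsub>T\<^esub> x)) = z \<ominus>\<^bsub>T\<^esub> z \<otimes>\<^bsub>T\<^esub> e"
    proof -
      have "(z \<otimes>\<^bsub>T\<^esub> x \<ominus>\<^bsub>T\<^esub> z) \<oplus>\<^bsub>T\<^esub> z \<otimes>\<^bsub>T\<^esub> (e \<ominus>\<^bsub>T\<^esub> x) = z \<otimes>\<^bsub>T\<^esub> e \<ominus>\<^bsub>T\<^esub> z"
        using zT xT e(1) by (simp add: a_minus_def r_distr r_minus a_ac r_neg1 r_neg2 r_neg)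
      then show ?thesis using zT e(1) by (simp add: a_minus_def minus_add a_comm)
    qed
    ultimately show ?thesis by simp
  qed
  then show thesis using that eI e(2) by blast
qed

section \<open>Traces of projective modules\<close>

lemma additive_finsum:
  assumes M: "abelian_group M" and N: "abelian_group N" and f: "f \<in> carrier M \<rightarrow> carrier N"
    and add: "\<And>x y. \<lbrakk>x \<in> carrier M; y \<in> carrier M\<rbrakk> \<Longrightarrow> f (x \<oplus>\<^bsub>M\<^esub> y) = f x \<oplus>\<^bsub>N\<^esub> f y"
    and g: "g \<in> S \<rightarrow> carrier M"
  shows "f (finsum M g S) = (\<Oplus>\<^bsub>N\<^esub>k\<in>S. f (g k))"
proof -
  interpret M: abelian_group M by (rule M)
  interpret N: abelian_group N by (rule N)
  have fz: "f \<zero>\<^bsub>M\<^esub> = \<zero>\<^bsub>N\<^esub>"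
  proof -
    have "f \<zero>\<^bsub>M\<^esub> \<in> carrier N" using f by auto
    then show ?thesis using add[of "\<zero>\<^bsub>M\<^esub>" "\<zero>\<^bsub>M\<^esub>"] by (simp add: N.add.l_cancel_one')
  qed
  have fc: "f x \<in> carrier N" if "x \<in> carrier M" for x using f that by auto
  show ?thesis using g
    by (induction S rule: infinite_finite_induct) (simp_all add: Pi_iff fz fc add)
qed

lemma (in ring) finsum_regular_module:
  assumes "f \<in> S \<rightarrow> carrier R"
  shows "finsum (regular_module R) f S = finsum R f S"
proof -
  interpret M: left_module R "regular_module R" by (rule regular_left_module)
  show ?thesis
  proof (cases "finite S")
    case True
    then show ?thesis using assms
      by (induction S rule: finite_induct) (auto simp: Pi_iff)
  next
    case False
    then show ?thesis by (simp add: finsum_infinite M.M.finsum_infinite)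
  qed
qed

lemma coordinate_hom:
  "(\<lambda>v. v j) \<in> mod_hom R (free_module R K) (regular_module R)"
  unfolding mod_hom_def by (auto simp: free_module_simps free_module_carrier)

lemma (in left_module) hom_from_free:
  assumes g: "g \<in> mod_hom R (free_module R K) M" and v: "v \<in> carrier (free_module R K)"
    and S: "finite S" "{k. v k \<noteq> \<zero>} \<subseteq> S" "S \<subseteq> K"
  shows "g v = finsum M (\<lambda>k. v k \<odot>\<^bsub>M\<^esub> g (basis_vec R k)) S"
proof -
  have b: "(\<lambda>k. g (basis_vec R k)) \<in> K \<rightarrow> carrier M"
    using mod_homD(1)[OF g basis_vec_carrier] by simp
  have "g v = lincomb R M (\<lambda>k. g (basis_vec R k)) v"
    by (rule free_module_hom_eq[OF g lincomb_hom[OF b] _ v], subst lincomb_basis_vec[OF b]) simp_all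
  then show ?thesis using lincomb_superset[OF v b S] by simp
qed

lemma (in ring) functional_on_free:
  assumes g: "g \<in> mod_hom R (free_module R K) (regular_module R)" and v: "v \<in> carrier (free_module R K)"
    and S: "finite S" "{k. v k \<noteq> \<zero>} \<subseteq> S" "S \<subseteq> K"
  shows "g v = (\<Oplus>k\<in>S. v k \<otimes> g (basis_vec R k))"
proof -
  interpret M: left_module R "regular_module R" by (rule regular_left_module)
  have "(\<lambda>k. v k \<otimes> g (basis_vec R k)) \<in> S \<rightarrow> carrier R"
    using v S(3) mod_homD(1)[OF g basis_vec_carrier] by (auto simp: free_module_carrier)
  then show ?thesis using M.hom_from_free[OF g v S] by (simp add: finsum_regular_module)
qed

text \<open>Nakayama's lemma for a row vector \<open>r = r A\<close>.  Determinants are of no use over a non-commutative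
  ring; instead, one unknown \<open>r k\<close> after the other is eliminated, the coefficient \<open>\<one> - A k k\<close> being a
  unit.  The matrix that remains has its entries in \<open>J\<close> again.\<close>

lemma (in ring) nakayama:
  assumes J: "ideal J R" and U: "\<And>j. j \<in> J \<Longrightarrow> \<one> \<ominus> j \<in> Units R"
    and "finite S" "r \<in> S \<rightarrow> carrier R" "\<And>i j. \<lbrakk>i \<in> S; j \<in> S\<rbrakk> \<Longrightarrow> A i j \<in> J"
    and "\<And>j. j \<in> S \<Longrightarrow> r j = (\<Oplus>i\<in>S. r i \<otimes> A i j)"
    and "j \<in> S"
  shows "r j = \<zero>"
  using assms(3-7)
proof (induction S arbitrary: A j rule: finite_induct)
  case (insert k S)
  interpret J: ideal J R by (rule J)
  have rc: "r i \<in> carrier R" if "i \<in> insert k S" for i using insert.prems(1) that by auto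
  have Ac: "A i j \<in> carrier R" if "i \<in> insert k S" "j \<in> insert k S" for i j
    using insert.prems(2) that J.Icarr by blast
  define s where "s = (\<Oplus>i\<in>S. r i \<otimes> A i k)"
  define u where "u = \<one> \<ominus> A k k"
  have sc: "s \<in> carrier R" unfolding s_def using rc Ac by (intro finsum_closed) auto
  have u: "u \<in> Units R" "u \<in> carrier R" "inv u \<in> carrier R"
    using U insert.prems(2) unfolding u_def by (auto intro: Units_closed)
  have split: "r j = r k \<otimes> A k j \<oplus> (\<Oplus>i\<in>S. r i \<otimes> A i j)" if "j \<in> insert k S" for j
  proof -
    have "r j = (\<Oplus>i\<in>insert k S. r i \<otimes> A i j)" by (rule insert.prems(3)[OF that])
    also have "\<dots> = r k \<otimes> A k j \<oplus> (\<Oplus>i\<in>S. r i \<otimes> A i j)"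
      using insert.hyps rc Ac that by (intro finsum_insert) auto
    finally show ?thesis .
  qed
  have k: "k \<in> insert k S" by simp
  have rk: "r k = s \<otimes> inv u"
  proof -
    have "r k \<otimes> u = r k \<ominus> r k \<otimes> A k k"
      using rc[OF k] Ac[OF k k] by (simp add: u_def a_minus_def r_distr r_minus)
    also have "\<dots> = s"
    proof -
      have y: "r k \<otimes> A k k \<in> carrier R" using rc[OF k] Ac[OF k k] by simp
      have "r k = s \<oplus> r k \<otimes> A k k"
        using split[OF k] a_comm[OF y sc] unfolding s_def[symmetric] by (rule trans)
      moreover have "(s \<oplus> r k \<otimes> A k k) \<ominus> r k \<otimes> A k k = s"
        using y sc by (simp add: a_minus_def a_assoc r_neg)
      ultimately show ?thesis by (rule ssubst[where P = "\<lambda>z. z \<ominus> r k \<otimes> A k k = s"])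
    qed
    finally have "r k \<otimes> u = s" .
    then show ?thesis using u rc[OF k] by (simp add: m_assoc flip: \<open>r k \<otimes> u = s\<close>)
  qed
  \<comment> \<open>the Schur complement left by the elimination of \<open>r k\<close>\<close>
  let ?A = "\<lambda>i j. (A i k \<otimes> inv u) \<otimes> A k j \<oplus> A i j"
  have "r j = \<zero>" if j: "j \<in> S" for j
  proof (rule insert.IH[of ?A])
    show "r \<in> S \<rightarrow> carrier R" using rc by auto
    show "?A i j \<in> J" if "i \<in> S" "j \<in> S" for i j
      using that insert.prems(2) u Ac by (intro J.a_closed J.I_r_closed) auto
    show "j \<in> S" by (rule j)
    show "r j = (\<Oplus>i\<in>S. r i \<otimes> ?A i j)" if j: "j \<in> S" for j
    proof -
      have cl: "(\<lambda>i. r i \<otimes> A i k) \<in> S \<rightarrow> carrier R" "(\<lambda>i. r i \<otimes> A i j) \<in> S \<rightarrow> carrier R"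
        "(\<lambda>i. r i \<otimes> A i k \<otimes> (inv u \<otimes> A k j)) \<in> S \<rightarrow> carrier R"
        using rc Ac u j by auto
      have "r k \<otimes> A k j = s \<otimes> (inv u \<otimes> A k j)"
        unfolding rk using sc u Ac j by (simp add: m_assoc)
      also have "\<dots> = (\<Oplus>i\<in>S. r i \<otimes> A i k \<otimes> (inv u \<otimes> A k j))"
        unfolding s_def using finsum_ldistr[OF insert.hyps(1) _ cl(1)] u Ac j by simp
      finally have "r j = (\<Oplus>i\<in>S. r i \<otimes> A i k \<otimes> (inv u \<otimes> A k j) \<oplus> r i \<otimes> A i j)"
        using split[of j] j by (simp add: finsum_addf[OF cl(3,2)])
      also have "\<dots> = (\<Oplus>i\<in>S. r i \<otimes> ?A i j)"
        using rc Ac u j by (intro finsum_cong') (auto simp: r_distr m_assoc)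
      finally show ?thesis .
    qed
  qed
  moreover from this have "s = \<zero>"
    unfolding s_def using Ac by (subst finsum_cong'[of S S "\<lambda>_. \<zero>"]) auto
  then have "r k = \<zero>" using rk u by simp
  ultimately show ?case using insert.prems(4) by auto
qed simp

lemma (in ring) trace_ideal_closed:
  assumes M: "left_module R M"
  shows "f \<in> mod_hom R M (regular_module R) \<Longrightarrow> x \<in> carrier M \<Longrightarrow> f x \<in> trace_ideal R M"
    and "ideal (trace_ideal R M) R"
proof -
  interpret M: left_module R M by (rule M)
  let ?H = "\<Union>f \<in> mod_hom R M (regular_module R). f ` carrier M"
  have H: "?H \<subseteq> carrier R" by (auto dest: mod_homD(1))
  show "f x \<in> trace_ideal R M" if "f \<in> mod_hom R M (regular_module R)" "x \<in> carrier M" for f x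
    unfolding trace_ideal_def using that by (intro generate.incl) auto
  show "ideal (trace_ideal R M) R"
  proof (rule idealI[OF ring_axioms])
    show sub: "subgroup (trace_ideal R M) (add_monoid R)"
      unfolding trace_ideal_def by (rule add.generate_is_subgroup[OF H])
    fix z a assume z: "z \<in> trace_ideal R M" and a: "a \<in> carrier R"
    have "z \<in> carrier R \<and> a \<otimes> z \<in> trace_ideal R M \<and> z \<otimes> a \<in> trace_ideal R M"
      using z unfolding trace_ideal_def
    proof (induction z rule: generate.induct)
      case one
      show ?case using a generate.one[of "add_monoid R" ?H] by simp
    next
      case (incl h)
      then obtain f x where f: "f \<in> mod_hom R M (regular_module R)" "x \<in> carrier M" "h = f x" by blast
      have "a \<otimes> h = f (a \<odot>\<^bsub>M\<^esub> x)" using mod_homD(3)[OF f(1) a f(2)] f(3) by simp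
      moreover have "(\<lambda>x. f x \<otimes> a) \<in> mod_hom R M (regular_module R)"
        using mod_homD[OF f(1)] a by (auto simp: mod_hom_def l_distr m_assoc)
      ultimately show ?case using f a mod_homD(1)[OF f(1,2)] M.smult_closed[OF a f(2)]
        by (auto intro!: generate.incl)
    next
      case (inv h)
      then obtain f x where f: "f \<in> mod_hom R M (regular_module R)" "x \<in> carrier M" "h = f x" by blast
      have hc: "h \<in> carrier R" using mod_homD(1)[OF f(1,2)] f(3) by simp
      have "a \<otimes> h = f (a \<odot>\<^bsub>M\<^esub> x)" using mod_homD(3)[OF f(1) a f(2)] f(3) by simp
      then have "a \<otimes> h \<in> ?H" using f(1) M.smult_closed[OF a f(2)] by blast
      moreover have "(\<lambda>x. f x \<otimes> a) \<in> mod_hom R M (regular_module R)"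
        using mod_homD[OF f(1)] a by (auto simp: mod_hom_def l_distr m_assoc)
      then have "h \<otimes> a \<in> ?H" using f by blast
      ultimately have "inv\<^bsub>add_monoid R\<^esub> (a \<otimes> h) \<in> generate (add_monoid R) ?H"
        "inv\<^bsub>add_monoid R\<^esub> (h \<otimes> a) \<in> generate (add_monoid R) ?H"
        by (auto intro!: generate.inv simp del: UN_iff)
      then show ?case using hc a by (simp add: a_inv_def[symmetric] r_minus l_minus)
    next
      case (eng h1 h2)
      then have "a \<otimes> h1 \<oplus> a \<otimes> h2 \<in> generate (add_monoid R) ?H" "h1 \<otimes> a \<oplus> h2 \<otimes> a \<in> generate (add_monoid R) ?H"
        using generate.eng[of "a \<otimes> h1" "add_monoid R" ?H "a \<otimes> h2"]
          generate.eng[of "h1 \<otimes> a" "add_monoid R" ?H "h2 \<otimes> a"] by simp_all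
      then show ?case using eng.IH a by (simp add: l_distr r_distr)
    qed
    then show "a \<otimes> z \<in> trace_ideal R M" "z \<otimes> a \<in> trace_ideal R M" by auto
  qed
qed

lemma (in ring) trace_ideal_subset:
  assumes "left_module R M" "ideal I R"
    and "\<And>f x. \<lbrakk>f \<in> mod_hom R M (regular_module R); x \<in> carrier M\<rbrakk> \<Longrightarrow> f x \<in> I"
  shows "trace_ideal R M \<subseteq> I"
  unfolding trace_ideal_def
proof (rule add.generate_subgroup_incl)
  show "subgroup I (add_monoid R)"
    using assms(2) by (simp add: ideal_def additive_subgroup_def)
qed (use assms(3) in blast)

lemma ring_hom_Units:
  assumes h: "h \<in> ring_hom R S" and R: "ring R" and S: "ring S" and u: "u \<in> Units R"
  shows "h u \<in> Units S"
proof -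
  interpret R: ring R by (rule R)
  interpret h: ring_hom_ring R S h by (rule ring_hom_ringI2[OF R S h])
  have c: "u \<in> carrier R" "inv\<^bsub>R\<^esub> u \<in> carrier R" using u by (auto intro: R.Units_closed)
  have "h (inv\<^bsub>R\<^esub> u) \<otimes>\<^bsub>S\<^esub> h u = h (inv\<^bsub>R\<^esub> u \<otimes>\<^bsub>R\<^esub> u)" "h u \<otimes>\<^bsub>S\<^esub> h (inv\<^bsub>R\<^esub> u) = h (u \<otimes>\<^bsub>R\<^esub> inv\<^bsub>R\<^esub> u)"
    using c by simp_all
  then show ?thesis using u c h.hom_closed unfolding Units_def[of S]
    by (auto simp: R.Units_l_inv R.Units_r_inv intro!: bexI[of _ "h (inv\<^bsub>R\<^esub> u)"])
qed

text \<open>Let \<open>x\<close> have the coordinates \<open>x\<^sub>k\<close> in the free module of which \<open>M\<close> is a summand.  Projecting back to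
  \<open>M\<close> gives \<open>x\<^sub>j = \<Sum> x\<^sub>k a\<^sub>k\<^sub>j\<close>, where \<open>a\<^sub>k\<^sub>j\<close> is the \<open>j\<close>-th coordinate of the projection of the \<open>k\<close>-th basis
  vector and so belongs to the trace.  Modulo \<open>K\<close> these coefficients come from \<open>J\<close>, and Nakayama's
  lemma makes all coordinates vanish, hence also the value of every functional.  The homomorphism
  \<open>\<phi>\<close> is there because the module lives over \<open>\<Lambda>\<close> but the radical belongs to a localization of \<open>\<Lambda>\<close>;
  so no base change of modules is required.\<close>

lemma projective_trace_image_subset:
  assumes proj: "projective R M" and T: "ring T" and \<phi>: "\<phi> \<in> ring_hom R T"
    and J: "ideal J T" "\<And>j. j \<in> J \<Longrightarrow> \<one>\<^bsub>T\<^esub> \<ominus>\<^bsub>T\<^esub> j \<in> Units T" and K: "ideal K T"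
    and tr: "\<And>z. z \<in> trace_ideal R M \<Longrightarrow> \<exists>b \<in> J. \<phi> z \<ominus>\<^bsub>T\<^esub> b \<in> K"
    and z: "z \<in> trace_ideal R M"
  shows "\<phi> z \<in> K"
proof -
  interpret M: left_module R M using proj by (simp add: projective_def)
  interpret T: ring T by (rule T)
  interpret K: ideal K T by (rule K)
  interpret J: ideal J T by (rule J(1))
  let ?Q = "T Quot K"
  interpret Q: ring ?Q by (rule K.quotient_is_ring)
  define \<psi> where "\<psi> = (\<lambda>x. K +>\<^bsub>T\<^esub> \<phi> x)"
  have pr: "(+>\<^bsub>T\<^esub>) K \<in> ring_hom T ?Q" by (rule K.rcos_ring_hom)
  have "\<psi> \<in> ring_hom R ?Q" using ring_hom_trans[OF \<phi> pr] by (simp add: \<psi>_def comp_def)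
  then interpret \<psi>: ring_hom_ring R ?Q \<psi>
    by (intro ring_hom_ringI2 M.R.ring_axioms Q.ring_axioms)
  have \<phi>c: "\<phi> x \<in> carrier T" if "x \<in> carrier R" for x using ring_hom_closed[OF \<phi> that] .
  have ker: "\<psi> x = \<zero>\<^bsub>?Q\<^esub> \<longleftrightarrow> \<phi> x \<in> K" if "x \<in> carrier R" for x
    using K.rcos_const_imp_mem[OF \<phi>c[OF that]] T.a_rcos_zero[OF K.is_ideal, of "\<phi> x"]
    by (auto simp: \<psi>_def FactRing_def)
  let ?J = "(+>\<^bsub>T\<^esub>) K ` J"
  have Jq: "ideal ?J ?Q" by (rule T.ring_ideal_imp_quot_ideal[OF K.is_ideal J(1)])
  have Ju: "\<one>\<^bsub>?Q\<^esub> \<ominus>\<^bsub>?Q\<^esub> j \<in> Units ?Q" if j: "j \<in> ?J" for j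
  proof -
    obtain b where b: "b \<in> J" "j = K +>\<^bsub>T\<^esub> b" using j by (elim imageE)
    interpret pr: ring_hom_ring T ?Q "(+>\<^bsub>T\<^esub>) K" by (rule K.rcos_ring_hom_ring)
    have "\<one>\<^bsub>?Q\<^esub> \<ominus>\<^bsub>?Q\<^esub> j = K +>\<^bsub>T\<^esub> (\<one>\<^bsub>T\<^esub> \<ominus>\<^bsub>T\<^esub> b)"
      using b J.Icarr by (simp add: a_minus_def)
    then show ?thesis using ring_hom_Units[OF pr T.ring_axioms Q.ring_axioms J(2)[OF b(1)]] by simp
  qed
  have \<psi>J: "\<psi> x \<in> ?J" if x: "x \<in> trace_ideal R M" for x
  proof -
    obtain b where b: "b \<in> J" "\<phi> x \<ominus>\<^bsub>T\<^esub> b \<in> K" using tr[OF x] by blast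
    have "x \<in> carrier R" using ideal.Icarr[OF M.trace_ideal_closed(2)[OF M.left_module_axioms] x] .
    then have "K +>\<^bsub>T\<^esub> \<phi> x = K +>\<^bsub>T\<^esub> b"
      using T.quotient_eq_iff_same_a_r_cos[OF K.is_ideal \<phi>c J.Icarr[OF b(1)]] b(2) by blast
    then show ?thesis using b(1) by (auto simp: \<psi>_def)
  qed
  obtain B :: "'c set" and i p where i: "i \<in> mod_hom R M (free_module R B)"
    and p: "p \<in> mod_hom R (free_module R B) M"
    and pi: "\<And>x. x \<in> carrier M \<Longrightarrow> p (i x) = x"
    using proj unfolding projective_def summand_of_def by blast
  have gen: "\<phi> (f x) \<in> K" if f: "f \<in> mod_hom R M (regular_module R)" and x: "x \<in> carrier M" for f x
  proof -
    let ?S = "{k. i x k \<noteq> \<zero>\<^bsub>R\<^esub>}" and ?e = "basis_vec R :: 'c \<Rightarrow> 'c \<Rightarrow> 'a"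
    have ix: "i x \<in> carrier (free_module R B)" by (rule mod_homD(1)[OF i x])
    have S: "finite ?S" "?S \<subseteq> B" and ic: "\<And>k. i x k \<in> carrier R" using ix by (auto simp: free_module_carrier)
    have pe: "p (?e k) \<in> carrier M" if "k \<in> ?S" for k
      using mod_homD(1)[OF p M.basis_vec_carrier] S that by blast
    have coord: "(\<lambda>y. i y j) \<in> mod_hom R M (regular_module R)" for j
      by (rule mod_hom_comp[OF i coordinate_hom])
    have A: "i (p (?e k)) j \<in> trace_ideal R M" if "k \<in> ?S" for k j
      by (rule M.trace_ideal_closed(1)[OF M.left_module_axioms coord pe[OF that]])
    have Ac: "i (p (?e k)) j \<in> carrier R" if "k \<in> ?S" for k j
      using mod_homD(1)[OF coord pe[OF that]] by simp
    have expand: "g x = (\<Oplus>\<^bsub>R\<^esub>k\<in>?S. i x k \<otimes>\<^bsub>R\<^esub> g (p (?e k)))"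
      if "g \<in> mod_hom R M (regular_module R)" for g
      using M.functional_on_free[OF mod_hom_comp[OF p that] ix S(1) _ S(2)] pi[OF x] by simp
    have z0: "\<psi> (i x j) = \<zero>\<^bsub>?Q\<^esub>" if "j \<in> ?S" for j
    proof (rule Q.nakayama[OF Jq Ju S(1)])
      show "(\<lambda>k. \<psi> (i x k)) \<in> ?S \<rightarrow> carrier ?Q" using ic by auto
      show "\<psi> (i (p (?e k)) j) \<in> ?J" if "k \<in> ?S" for k j by (rule \<psi>J[OF A[OF that]])
      show "j \<in> ?S" by (rule that)
      fix j
      have "\<psi> (i x j) = \<psi> (\<Oplus>\<^bsub>R\<^esub>k\<in>?S. i x k \<otimes>\<^bsub>R\<^esub> i (p (?e k)) j)" by (rule arg_cong[OF expand[OF coord]])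
      also have "\<dots> = (\<Oplus>\<^bsub>?Q\<^esub>k\<in>?S. \<psi> (i x k \<otimes>\<^bsub>R\<^esub> i (p (?e k)) j))"
        using ic Ac by (intro additive_finsum[OF M.R.abelian_group_axioms Q.abelian_group_axioms]) auto
      also have "\<dots> = (\<Oplus>\<^bsub>?Q\<^esub>k\<in>?S. \<psi> (i x k) \<otimes>\<^bsub>?Q\<^esub> \<psi> (i (p (?e k)) j))"
        using ic Ac by (intro Q.finsum_cong') auto
      finally show "\<psi> (i x j) = (\<Oplus>\<^bsub>?Q\<^esub>k\<in>?S. \<psi> (i x k) \<otimes>\<^bsub>?Q\<^esub> \<psi> (i (p (?e k)) j))" .
    qed
    have fc: "f (p (?e k)) \<in> carrier R" if "k \<in> ?S" for k
      using mod_homD(1)[OF f pe[OF that]] by simp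
    have "\<phi> (f x) = \<phi> (\<Oplus>\<^bsub>R\<^esub>k\<in>?S. i x k \<otimes>\<^bsub>R\<^esub> f (p (?e k)))" by (rule arg_cong[OF expand[OF f]])
    moreover have "\<psi> (\<Oplus>\<^bsub>R\<^esub>k\<in>?S. i x k \<otimes>\<^bsub>R\<^esub> f (p (?e k)))
        = (\<Oplus>\<^bsub>?Q\<^esub>k\<in>?S. \<psi> (i x k \<otimes>\<^bsub>R\<^esub> f (p (?e k))))"
      using ic fc by (intro additive_finsum[OF M.R.abelian_group_axioms Q.abelian_group_axioms]) auto
    moreover have "\<dots> = (\<Oplus>\<^bsub>?Q\<^esub>k\<in>?S. \<zero>\<^bsub>?Q\<^esub>)"
      using ic fc z0 by (intro Q.finsum_cong') (simp_all add: Pi_iff)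
    moreover have "(\<Oplus>\<^bsub>R\<^esub>k\<in>?S. i x k \<otimes>\<^bsub>R\<^esub> f (p (?e k))) \<in> carrier R"
      using ic fc by (intro M.R.finsum_closed) auto
    ultimately show ?thesis using ker by simp
  qed
  interpret \<phi>: ring_hom_ring R T \<phi> by (rule ring_hom_ringI2[OF M.R.ring_axioms T \<phi>])
  have "trace_ideal R M \<subseteq> {x \<in> carrier R. \<phi> x \<in> K}"
    using mod_homD(1)[where N = "regular_module R"] gen
    by (intro M.trace_ideal_subset[OF M.left_module_axioms \<phi>.ideal_vimage[OF K]]) auto
  then show ?thesis using z by auto
qed

section \<open>Rings of fractions\<close>

lemma pair_ring_simps:
  "carrier (pair_ring A B) = {c. Poly_Mapping.keys c \<subseteq> carrier A \<times> carrier B}"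
  "\<zero>\<^bsub>pair_ring A B\<^esub> = 0" "x \<oplus>\<^bsub>pair_ring A B\<^esub> y = x + y"
  "\<one>\<^bsub>pair_ring A B\<^esub> = frag_of (\<one>\<^bsub>A\<^esub>, \<one>\<^bsub>B\<^esub>)"
  "frag_of (a, b) \<otimes>\<^bsub>pair_ring A B\<^esub> frag_of (a', b') = frag_of (a \<otimes>\<^bsub>A\<^esub> a', b \<otimes>\<^bsub>B\<^esub> b')"
  by (simp_all add: pair_ring_def)

lemma pair_ring_minus:
  assumes "ring A" "ring B" "x \<in> carrier (pair_ring A B)" "y \<in> carrier (pair_ring A B)"
  shows "x \<ominus>\<^bsub>pair_ring A B\<^esub> y = x - y"
proof -
  interpret P: ring "pair_ring A B" by (rule pair_ring_ring[OF assms(1,2)])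
  have "\<ominus>\<^bsub>pair_ring A B\<^esub> y = - y"
    using assms(3,4) by (intro P.minus_equality) (auto simp: pair_ring_simps)
  then show ?thesis by (simp add: a_minus_def pair_ring_simps)
qed

lemma (in domain) fraction_eq_iff:
  assumes S: "submonoid S R" "\<zero> \<notin> S" and "a \<in> carrier R" "b \<in> carrier R" "s \<in> S" "t \<in> S"
  shows "fraction R S a s = fraction R S b t \<longleftrightarrow> t \<otimes> a = s \<otimes> b"
proof
  note Sc = S_closed[OF S(1)]
  assume "fraction R S a s = fraction R S b t"
  then have "(a, s) \<in> fraction R S b t" using fraction_self[OF S(1) assms(3,5)] by simp
  then obtain u where u: "u \<in> S" "u \<otimes> (s \<otimes> b) = u \<otimes> (t \<otimes> a)" by (auto simp: fraction_def)
  then have "u \<noteq> \<zero>" "u \<in> carrier R" using S(2) Sc by auto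
  then show "t \<otimes> a = s \<otimes> b" using u(2) assms Sc by (simp add: m_lcancel)
next
  assume "t \<otimes> a = s \<otimes> b"
  then show "fraction R S a s = fraction R S b t"
    using assms S_closed[OF S(1)] by (intro fraction_eqI[OF S(1), of _ _ _ _ \<one>]) auto
qed

context
  fixes R :: "('r, 'b) ring_scheme" and \<Lambda> :: "('r, 'a) module" and S :: "'r set"
  assumes alg: "ring_algebra R \<Lambda>" and dom: "domain R" and tf: "torsion_free R \<Lambda>"
    and S: "submonoid S R" "\<zero>\<^bsub>R\<^esub> \<notin> S"
begin

interpretation R: domain R by (rule dom)
interpretation \<Lambda>: ring \<Lambda> by (rule ring_algebra.axioms(2)[OF alg])
interpretation L: ring_algebra R \<Lambda> by (rule alg)
interpretation BR: cring "localization R S" by (rule R.localization_cring[OF S(1)])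
interpretation B: ring_algebra R "localization R S" by (rule R.localization_ring_algebra[OF S(1)])

abbreviation (input) B where "B \<equiv> localization R S"
abbreviation (input) P where "P \<equiv> pair_ring \<Lambda> (localization R S)"
abbreviation (input) G where "G \<equiv> genideal (pair_ring \<Lambda> (localization R S)) (tensor_relations R \<Lambda> (localization R S))"
abbreviation (input) T where "T \<equiv> tensor_algebra R \<Lambda> (localization R S)"

interpretation P: ring P by (rule pair_ring_ring[OF \<Lambda>.ring_axioms BR.ring_axioms])

lemma G_ideal: "ideal G P"
  by (rule P.genideal_ideal[OF L.tensor_relations_carrier[OF B.ring_algebra_axioms]])

interpretation G: ideal G P by (rule G_ideal)
interpretation T: ring T by (rule tensor_algebra_ring[OF alg B.ring_algebra_axioms])

lemma Sc: "s \<in> S \<Longrightarrow> s \<in> carrier R" "\<one>\<^bsub>R\<^esub> \<in> S" "\<lbrakk>s \<in> S; t \<in> S\<rbrakk> \<Longrightarrow> s \<otimes>\<^bsub>R\<^esub> t \<in> S"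
  using R.S_closed[OF S(1)] by auto

subsection \<open>Clearing denominators\<close>

text \<open>The aim is that \<open>\<Lambda>\<close> embeds into \<open>\<Lambda> \<otimes> S\<inverse>R\<close>, the latter being the quotient of a free abelian group
  by an ideal of relations.  The natural map \<open>a \<otimes> X \<mapsto> (d X) a\<close> into \<open>\<Lambda>\<close>, for a denominator \<open>d\<close>, makes
  sense only for those fractions \<open>X\<close> with \<open>d X \<in> R\<close>.  For all others \<open>cleared\<close> has the value \<open>\<zero>\<close>, and only
  what happens for all multiples of some \<open>d\<close> is taken into account.\<close>

definition clears :: "'r \<Rightarrow> ('r \<times> 'r) set \<Rightarrow> bool" where
  "clears d X \<longleftrightarrow> d \<in> S \<and> X \<in> carrier B \<and> (\<exists>y \<in> carrier R. d \<odot>\<^bsub>B\<^esub> X = fraction R S y \<one>\<^bsub>R\<^esub>)"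

definition cleared :: "'r \<Rightarrow> ('r \<times> 'r) set \<Rightarrow> 'r" where
  "cleared d X = (if clears d X then SOME y. y \<in> carrier R \<and> d \<odot>\<^bsub>B\<^esub> X = fraction R S y \<one>\<^bsub>R\<^esub> else \<zero>\<^bsub>R\<^esub>)"

lemma cleared_closed: "cleared d X \<in> carrier R"
  and cleared_eq: "clears d X \<Longrightarrow> d \<odot>\<^bsub>B\<^esub> X = fraction R S (cleared d X) \<one>\<^bsub>R\<^esub>"
proof -
  have *: "cleared d X \<in> carrier R \<and> d \<odot>\<^bsub>B\<^esub> X = fraction R S (cleared d X) \<one>\<^bsub>R\<^esub>" if c: "clears d X"
  proof -
    have "\<exists>y. y \<in> carrier R \<and> d \<odot>\<^bsub>B\<^esub> X = fraction R S y \<one>\<^bsub>R\<^esub>" using c by (auto simp: clears_def)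
    from someI_ex[OF this] show ?thesis using c by (simp add: cleared_def)
  qed
  show "cleared d X \<in> carrier R" using * by (cases "clears d X") (auto simp: cleared_def)
  show "d \<odot>\<^bsub>B\<^esub> X = fraction R S (cleared d X) \<one>\<^bsub>R\<^esub>" if "clears d X" using * that by blast
qed

lemma clearsI:
  assumes "d \<in> S" "X \<in> carrier B" "y \<in> carrier R" "d \<odot>\<^bsub>B\<^esub> X = fraction R S y \<one>\<^bsub>R\<^esub>"
  shows "clears d X" "cleared d X = y"
proof -
  show c: "clears d X" using assms by (auto simp: clears_def)
  have "fraction R S (cleared d X) \<one>\<^bsub>R\<^esub> = fraction R S y \<one>\<^bsub>R\<^esub>" using cleared_eq[OF c] assms(4) by simp
  then show "cleared d X = y"
    using R.fraction_eq_iff[OF S cleared_closed assms(3) Sc(2) Sc(2)] cleared_closed assms(3) by simp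
qed

lemma clearsD: "clears d X \<Longrightarrow> d \<in> S" "clears d X \<Longrightarrow> X \<in> carrier B" "clears d X \<Longrightarrow> d \<in> carrier R"
  using Sc by (auto simp: clears_def)

lemma clears_fraction:
  assumes "a \<in> carrier R" "s \<in> S"
  shows "clears s (fraction R S a s)" "cleared s (fraction R S a s) = a"
proof -
  have "s \<odot>\<^bsub>B\<^esub> fraction R S a s = fraction R S (s \<otimes>\<^bsub>R\<^esub> a) s"
    using R.localization_simps(3)[OF S(1)] assms Sc by simp
  also have "\<dots> = fraction R S a \<one>\<^bsub>R\<^esub>"
    using assms Sc by (subst R.fraction_eq_iff[OF S]) auto
  finally have eq: "s \<odot>\<^bsub>B\<^esub> fraction R S a s = fraction R S a \<one>\<^bsub>R\<^esub>" .
  show "clears s (fraction R S a s)" "cleared s (fraction R S a s) = a"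
    using clearsI[OF assms(2) _ assms(1) eq] R.localization_carrier(1)[OF S(1) assms] by auto
qed

lemma clears_mult:
  assumes "clears d X" "clears e Y"
  shows "clears (d \<otimes>\<^bsub>R\<^esub> e) (X \<otimes>\<^bsub>B\<^esub> Y)"
    "cleared (d \<otimes>\<^bsub>R\<^esub> e) (X \<otimes>\<^bsub>B\<^esub> Y) = cleared d X \<otimes>\<^bsub>R\<^esub> cleared e Y"
proof -
  note c = clearsD[OF assms(1)] clearsD[OF assms(2)] cleared_closed[of d X] cleared_closed[of e Y]
  have "(d \<otimes>\<^bsub>R\<^esub> e) \<odot>\<^bsub>B\<^esub> (X \<otimes>\<^bsub>B\<^esub> Y) = (d \<odot>\<^bsub>B\<^esub> X) \<otimes>\<^bsub>B\<^esub> (e \<odot>\<^bsub>B\<^esub> Y)"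
    using c by (simp add: B.smult_mult_left B.smult_mult_right B.smult_assoc1[symmetric] R.m_comm)
  also have "\<dots> = fraction R S (cleared d X \<otimes>\<^bsub>R\<^esub> cleared e Y) \<one>\<^bsub>R\<^esub>"
    using R.localization_simps(1)[OF S(1) c(7,8) Sc(2) Sc(2)] cleared_eq[OF assms(1)] cleared_eq[OF assms(2)]
    by simp
  finally have eq: "(d \<otimes>\<^bsub>R\<^esub> e) \<odot>\<^bsub>B\<^esub> (X \<otimes>\<^bsub>B\<^esub> Y) = fraction R S (cleared d X \<otimes>\<^bsub>R\<^esub> cleared e Y) \<one>\<^bsub>R\<^esub>" .
  show "clears (d \<otimes>\<^bsub>R\<^esub> e) (X \<otimes>\<^bsub>B\<^esub> Y)"
    "cleared (d \<otimes>\<^bsub>R\<^esub> e) (X \<otimes>\<^bsub>B\<^esub> Y) = cleared d X \<otimes>\<^bsub>R\<^esub> cleared e Y"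
    using clearsI[OF Sc(3)[OF c(1,4)] BR.m_closed[OF c(2,5)] R.m_closed[OF c(7,8)] eq] by auto
qed

lemma clears_add:
  assumes "clears d X" "clears d Y"
  shows "clears d (X \<oplus>\<^bsub>B\<^esub> Y)" "cleared d (X \<oplus>\<^bsub>B\<^esub> Y) = cleared d X \<oplus>\<^bsub>R\<^esub> cleared d Y"
proof -
  note c = clearsD[OF assms(1)] clearsD[OF assms(2)] cleared_closed[of d X] cleared_closed[of d Y]
  have "d \<odot>\<^bsub>B\<^esub> (X \<oplus>\<^bsub>B\<^esub> Y) = (d \<odot>\<^bsub>B\<^esub> X) \<oplus>\<^bsub>B\<^esub> (d \<odot>\<^bsub>B\<^esub> Y)"
    using c by (simp add: B.smult_r_distr)
  also have "\<dots> = fraction R S (cleared d X \<oplus>\<^bsub>R\<^esub> cleared d Y) \<one>\<^bsub>R\<^esub>"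
    using R.localization_simps(2)[OF S(1) c(7,8) Sc(2) Sc(2)] cleared_eq[OF assms(1)] cleared_eq[OF assms(2)] c
    by simp
  finally have eq: "d \<odot>\<^bsub>B\<^esub> (X \<oplus>\<^bsub>B\<^esub> Y) = fraction R S (cleared d X \<oplus>\<^bsub>R\<^esub> cleared d Y) \<one>\<^bsub>R\<^esub>" .
  show "clears d (X \<oplus>\<^bsub>B\<^esub> Y)" "cleared d (X \<oplus>\<^bsub>B\<^esub> Y) = cleared d X \<oplus>\<^bsub>R\<^esub> cleared d Y"
    using clearsI[OF c(1) BR.a_closed[OF c(2,5)] R.a_closed[OF c(7,8)] eq] by auto
qed

lemma clears_smult:
  assumes "clears d X" "r \<in> carrier R"
  shows "clears d (r \<odot>\<^bsub>B\<^esub> X)" "cleared d (r \<odot>\<^bsub>B\<^esub> X) = r \<otimes>\<^bsub>R\<^esub> cleared d X"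
proof -
  note c = clearsD[OF assms(1)] cleared_closed[of d X]
  have "d \<odot>\<^bsub>B\<^esub> (r \<odot>\<^bsub>B\<^esub> X) = r \<odot>\<^bsub>B\<^esub> (d \<odot>\<^bsub>B\<^esub> X)"
    using c assms(2) by (simp add: B.smult_assoc1[symmetric] R.m_comm)
  also have "\<dots> = fraction R S (r \<otimes>\<^bsub>R\<^esub> cleared d X) \<one>\<^bsub>R\<^esub>"
    using R.localization_simps(3)[OF S(1) assms(2) c(4) Sc(2)] cleared_eq[OF assms(1)] by simp
  finally have eq: "d \<odot>\<^bsub>B\<^esub> (r \<odot>\<^bsub>B\<^esub> X) = fraction R S (r \<otimes>\<^bsub>R\<^esub> cleared d X) \<one>\<^bsub>R\<^esub>" .
  show "clears d (r \<odot>\<^bsub>B\<^esub> X)" "cleared d (r \<odot>\<^bsub>B\<^esub> X) = r \<otimes>\<^bsub>R\<^esub> cleared d X"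
    using clearsI[OF c(1) _ R.m_closed[OF assms(2) c(4)] eq] B.smult_closed[OF assms(2) c(2)] by auto
qed

lemma clears_multiple:
  assumes "clears d X" "k \<in> S"
  shows "clears (d \<otimes>\<^bsub>R\<^esub> k) X"
proof -
  have one: "clears k \<one>\<^bsub>B\<^esub>"
    using clearsI(1)[of k "\<one>\<^bsub>B\<^esub>" k] R.localization_simps(3)[OF S(1), of k "\<one>\<^bsub>R\<^esub>" "\<one>\<^bsub>R\<^esub>"]
      R.localization_carrier(3)[OF S(1)] assms(2) Sc BR.one_closed by simp
  show ?thesis using clears_mult(1)[OF assms(1) one] clearsD(2)[OF assms(1)] by simp
qed

lemma clears_one: "k \<in> S \<Longrightarrow> cleared k \<one>\<^bsub>B\<^esub> = k"
  using clearsI(2)[of k "\<one>\<^bsub>B\<^esub>" k] R.localization_simps(3)[OF S(1), of k "\<one>\<^bsub>R\<^esub>" "\<one>\<^bsub>R\<^esub>"]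
    R.localization_carrier(3)[OF S(1)] Sc BR.one_closed by simp

lemma clears_exists:
  assumes "X \<in> carrier B" obtains d where "clears d X"
  using R.localization_carrier(2)[OF S(1) assms] clears_fraction(1) by blast

lemma clears_finite:
  assumes "finite F" "F \<subseteq> carrier B"
  obtains d where "d \<in> S" "\<And>X. X \<in> F \<Longrightarrow> clears d X"
  using assms
proof (induction F arbitrary: thesis rule: finite_induct)
  case empty then show ?case using Sc(2) by blast
next
  case (insert X F)
  obtain d where d: "d \<in> S" "\<And>X. X \<in> F \<Longrightarrow> clears d X" using insert.IH insert.prems(2) by blast
  obtain e where e: "clears e X" using clears_exists insert.prems(2) by blast
  have eS: "e \<in> S" by (rule clearsD(1)[OF e])
  have "clears (d \<otimes>\<^bsub>R\<^esub> e) Y" if "Y \<in> insert X F" for Y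
    using that clears_multiple[OF d(2) eS] clears_multiple[OF e d(1)] R.m_comm[of d e] Sc(1)[OF d(1)] Sc(1)[OF eS]
    by auto
  then show ?case using insert.prems(1) Sc(3)[OF d(1) eS] by blast
qed

text \<open>The additive map with \<open>(a, X) \<mapsto> (d X) a\<close>.\<close>

definition evaluate :: "'r \<Rightarrow> ('a \<times> ('r \<times> 'r) set \<Rightarrow>\<^sub>0 int) \<Rightarrow> 'a" where
  "evaluate d = (SOME h. h \<in> hom (free_Abelian_group (carrier \<Lambda> \<times> carrier B)) (add_monoid \<Lambda>) \<and>
     (\<forall>a \<in> carrier \<Lambda>. \<forall>X \<in> carrier B. h (frag_of (a, X)) = cleared d X \<odot>\<^bsub>\<Lambda>\<^esub> a))"

lemma evaluate:
  shows "c \<in> carrier P \<Longrightarrow> evaluate d c \<in> carrier \<Lambda>"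
    and "\<lbrakk>c \<in> carrier P; c' \<in> carrier P\<rbrakk> \<Longrightarrow> evaluate d (c + c') = evaluate d c \<oplus>\<^bsub>\<Lambda>\<^esub> evaluate d c'"
    and "\<lbrakk>a \<in> carrier \<Lambda>; X \<in> carrier B\<rbrakk> \<Longrightarrow> evaluate d (frag_of (a, X)) = cleared d X \<odot>\<^bsub>\<Lambda>\<^esub> a"
proof -
  have into: "(\<lambda>(a, X). cleared d X \<odot>\<^bsub>\<Lambda>\<^esub> a) ` (carrier \<Lambda> \<times> carrier B) \<subseteq> carrier (add_monoid \<Lambda>)"
    using cleared_closed by auto
  obtain h where "h \<in> hom (free_Abelian_group (carrier \<Lambda> \<times> carrier B)) (add_monoid \<Lambda>)"
    "\<And>x. x \<in> carrier \<Lambda> \<times> carrier B \<Longrightarrow> h (frag_of x) = (\<lambda>(a, X). cleared d X \<odot>\<^bsub>\<Lambda>\<^esub> a) x"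
    by (rule comm_group.free_Abelian_group_universal[OF \<Lambda>.a_comm_group into]) (rule that)
  then have "\<exists>h. h \<in> hom (free_Abelian_group (carrier \<Lambda> \<times> carrier B)) (add_monoid \<Lambda>) \<and>
     (\<forall>a \<in> carrier \<Lambda>. \<forall>X \<in> carrier B. h (frag_of (a, X)) = cleared d X \<odot>\<^bsub>\<Lambda>\<^esub> a)" by (intro exI[of _ h]) auto
  from someI_ex[OF this] have *: "evaluate d \<in> hom (free_Abelian_group (carrier \<Lambda> \<times> carrier B)) (add_monoid \<Lambda>)"
    "\<And>a X. a \<in> carrier \<Lambda> \<Longrightarrow> X \<in> carrier B \<Longrightarrow> evaluate d (frag_of (a, X)) = cleared d X \<odot>\<^bsub>\<Lambda>\<^esub> a"
    unfolding evaluate_def[symmetric] by auto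
  show "c \<in> carrier P \<Longrightarrow> evaluate d c \<in> carrier \<Lambda>"
    "\<lbrakk>c \<in> carrier P; c' \<in> carrier P\<rbrakk> \<Longrightarrow> evaluate d (c + c') = evaluate d c \<oplus>\<^bsub>\<Lambda>\<^esub> evaluate d c'"
    using *(1) by (auto simp: hom_def pair_ring_simps)
  show "\<lbrakk>a \<in> carrier \<Lambda>; X \<in> carrier B\<rbrakk> \<Longrightarrow> evaluate d (frag_of (a, X)) = cleared d X \<odot>\<^bsub>\<Lambda>\<^esub> a"
    by (rule *(2))
qed

lemma P_minus_closed: "\<lbrakk>c \<in> carrier P; c' \<in> carrier P\<rbrakk> \<Longrightarrow> c - c' \<in> carrier P"
  using P.minus_closed pair_ring_minus[OF \<Lambda>.ring_axioms BR.ring_axioms] by metis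

lemma evaluate_minus:
  assumes "c \<in> carrier P" "c' \<in> carrier P"
  shows "evaluate d (c - c') = evaluate d c \<ominus>\<^bsub>\<Lambda>\<^esub> evaluate d c'"
proof -
  have "evaluate d c = evaluate d (c - c') \<oplus>\<^bsub>\<Lambda>\<^esub> evaluate d c'"
    using evaluate(2)[OF P_minus_closed[OF assms] assms(2), of d] by simp
  then show ?thesis
    using evaluate(1)[OF assms(1)] evaluate(1)[OF assms(2)] evaluate(1)[OF P_minus_closed[OF assms]]
    by (simp add: a_minus_def \<Lambda>.a_assoc \<Lambda>.r_neg)
qed

lemma frag_in_P: "\<lbrakk>a \<in> carrier \<Lambda>; X \<in> carrier B\<rbrakk> \<Longrightarrow> frag_of (a, X) \<in> carrier P"
  by (simp add: pair_ring_simps)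

lemma zero_in_P: "0 \<in> carrier P" by (simp add: pair_ring_simps)

lemma evaluate_zero: "evaluate d 0 = \<zero>\<^bsub>\<Lambda>\<^esub>"
  using evaluate_minus[OF zero_in_P zero_in_P, of d] evaluate(1)[OF zero_in_P, of d]
  by (simp add: a_minus_def \<Lambda>.r_neg)

lemma P_mult_minus:
  assumes "x \<in> carrier P" "y \<in> carrier P" "z \<in> carrier P"
  shows "z \<otimes>\<^bsub>P\<^esub> (x - y) = z \<otimes>\<^bsub>P\<^esub> x - z \<otimes>\<^bsub>P\<^esub> y" "(x - y) \<otimes>\<^bsub>P\<^esub> z = x \<otimes>\<^bsub>P\<^esub> z - y \<otimes>\<^bsub>P\<^esub> z"
proof -
  note m = pair_ring_minus[OF \<Lambda>.ring_axioms BR.ring_axioms, symmetric]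
  show "z \<otimes>\<^bsub>P\<^esub> (x - y) = z \<otimes>\<^bsub>P\<^esub> x - z \<otimes>\<^bsub>P\<^esub> y" "(x - y) \<otimes>\<^bsub>P\<^esub> z = x \<otimes>\<^bsub>P\<^esub> z - y \<otimes>\<^bsub>P\<^esub> z"
    using assms by (simp_all add: m a_minus_def P.r_distr P.l_distr P.r_minus P.l_minus)
qed

text \<open>Multiplicativity in the only case that is needed: against a generator, and for elements whose
  fractions are all cleared by \<open>d\<close>.\<close>

lemma evaluate_mult:
  assumes c: "Poly_Mapping.keys c \<subseteq> {(a, X). a \<in> carrier \<Lambda> \<and> clears d X}"
    and a: "a' \<in> carrier \<Lambda>" "clears e X'"
  shows "evaluate (d \<otimes>\<^bsub>R\<^esub> e) (c \<otimes>\<^bsub>P\<^esub> frag_of (a', X')) = (cleared e X' \<odot>\<^bsub>\<Lambda>\<^esub> evaluate d c) \<otimes>\<^bsub>\<Lambda>\<^esub> a' \<and>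
    evaluate (d \<otimes>\<^bsub>R\<^esub> e) (frag_of (a', X') \<otimes>\<^bsub>P\<^esub> c) = a' \<otimes>\<^bsub>\<Lambda>\<^esub> (cleared e X' \<odot>\<^bsub>\<Lambda>\<^esub> evaluate d c) \<and> c \<in> carrier P"
  using c
proof (induction c rule: frag_induction)
  case zero
  note f = frag_in_P[OF a(1) clearsD(2)[OF a(2)]]
  have "0 \<otimes>\<^bsub>P\<^esub> frag_of (a', X') = 0" "frag_of (a', X') \<otimes>\<^bsub>P\<^esub> 0 = 0"
    using P.l_null[OF f] P.r_null[OF f] by (simp_all add: pair_ring_simps(2))
  then show ?case using a cleared_closed by (simp add: evaluate_zero zero_in_P)
next
  case (one x)
  obtain a1 X1 where x: "x = (a1, X1)" "a1 \<in> carrier \<Lambda>" "clears d X1" using one by auto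
  note cl = clearsD(2)[OF x(3)] clearsD(2)[OF a(2)] clearsD(3)[OF x(3)] clearsD(3)[OF a(2)]
  have comm: "X' \<otimes>\<^bsub>B\<^esub> X1 = X1 \<otimes>\<^bsub>B\<^esub> X'" using cl by (simp add: BR.m_comm)
  show ?case using x a cl cleared_closed[of d X1] cleared_closed[of e X']
    by (simp add: pair_ring_simps(5) evaluate(3) clears_mult(2) comm L.smult_mult_left L.smult_mult_right
        L.smult_assoc1[symmetric] R.m_comm frag_in_P)
next
  case (diff x y)
  note f = frag_in_P[OF a(1) clearsD(2)[OF a(2)]]
  have xy: "x \<in> carrier P" "y \<in> carrier P" using diff by auto
  note cl = evaluate(1)[OF xy(1), of d] evaluate(1)[OF xy(2), of d] cleared_closed[of e X'] a(1)
  show ?case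
    using diff.IH cl xy f P_minus_closed[OF xy]
    by (simp add: P_mult_minus evaluate_minus a_minus_def L.smult_r_distr L.smult_r_minus
        \<Lambda>.l_distr \<Lambda>.r_distr \<Lambda>.l_minus \<Lambda>.r_minus)
qed

text \<open>The universal quantifier over the multiples of \<open>d\<close> excludes the elements whose value is zero only
  because \<open>d\<close> fails to clear them.\<close>

definition vanishing where
  "vanishing = {c \<in> carrier P. \<exists>d \<in> S. \<forall>k \<in> S. evaluate (d \<otimes>\<^bsub>R\<^esub> k) c = \<zero>\<^bsub>\<Lambda>\<^esub>}"

lemma vanishing_minus:
  assumes "c \<in> vanishing" "c' \<in> vanishing" shows "c - c' \<in> vanishing"
proof -
  obtain d e where de: "d \<in> S" "e \<in> S" "\<And>k. k \<in> S \<Longrightarrow> evaluate (d \<otimes>\<^bsub>R\<^esub> k) c = \<zero>\<^bsub>\<Lambda>\<^esub>"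
    "\<And>k. k \<in> S \<Longrightarrow> evaluate (e \<otimes>\<^bsub>R\<^esub> k) c' = \<zero>\<^bsub>\<Lambda>\<^esub>" and c: "c \<in> carrier P" "c' \<in> carrier P"
    using assms by (auto simp: vanishing_def)
  have "evaluate ((d \<otimes>\<^bsub>R\<^esub> e) \<otimes>\<^bsub>R\<^esub> k) (c - c') = \<zero>\<^bsub>\<Lambda>\<^esub>" if k: "k \<in> S" for k
  proof -
    have "(d \<otimes>\<^bsub>R\<^esub> e) \<otimes>\<^bsub>R\<^esub> k = d \<otimes>\<^bsub>R\<^esub> (e \<otimes>\<^bsub>R\<^esub> k)" "(d \<otimes>\<^bsub>R\<^esub> e) \<otimes>\<^bsub>R\<^esub> k = e \<otimes>\<^bsub>R\<^esub> (d \<otimes>\<^bsub>R\<^esub> k)"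
      using Sc(1) de(1,2) k by (simp_all add: R.m_ac)
    then have "evaluate ((d \<otimes>\<^bsub>R\<^esub> e) \<otimes>\<^bsub>R\<^esub> k) c = \<zero>\<^bsub>\<Lambda>\<^esub>" "evaluate ((d \<otimes>\<^bsub>R\<^esub> e) \<otimes>\<^bsub>R\<^esub> k) c' = \<zero>\<^bsub>\<Lambda>\<^esub>"
      using de(3)[OF Sc(3)[OF de(2) k]] de(4)[OF Sc(3)[OF de(1) k]] by simp_all
    then show ?thesis using evaluate_minus[OF c] by (simp add: a_minus_def)
  qed
  then show ?thesis using P_minus_closed[OF c] Sc(3)[OF de(1,2)] by (auto simp: vanishing_def)
qed

lemma vanishing_mult_frag:
  assumes c: "c \<in> vanishing" and a: "a' \<in> carrier \<Lambda>" "X' \<in> carrier B"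
  shows "c \<otimes>\<^bsub>P\<^esub> frag_of (a', X') \<in> vanishing" "frag_of (a', X') \<otimes>\<^bsub>P\<^esub> c \<in> vanishing"
proof -
  obtain d where d: "d \<in> S" "\<And>k. k \<in> S \<Longrightarrow> evaluate (d \<otimes>\<^bsub>R\<^esub> k) c = \<zero>\<^bsub>\<Lambda>\<^esub>" and cP: "c \<in> carrier P"
    using c by (auto simp: vanishing_def)
  have "finite (snd ` Poly_Mapping.keys c)" "snd ` Poly_Mapping.keys c \<subseteq> carrier B"
    using cP by (auto simp: pair_ring_simps)
  then obtain d' where d': "d' \<in> S" "\<And>X. X \<in> snd ` Poly_Mapping.keys c \<Longrightarrow> clears d' X"
    using clears_finite by blast
  obtain e where e: "clears e X'" using clears_exists[OF a(2)] .
  note ce = Sc(1)[OF d(1)] Sc(1)[OF d'(1)] clearsD(3)[OF e]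
  let ?d = "d \<otimes>\<^bsub>R\<^esub> d'"
  have clr: "Poly_Mapping.keys c \<subseteq> {(a, X). a \<in> carrier \<Lambda> \<and> clears ?d X}"
  proof
    fix x assume x: "x \<in> Poly_Mapping.keys c"
    have "clears (d' \<otimes>\<^bsub>R\<^esub> d) (snd x)" using clears_multiple[OF d'(2) d(1)] x by blast
    moreover have "fst x \<in> carrier \<Lambda>" using x cP by (auto simp: pair_ring_simps)
    ultimately show "x \<in> {(a, X). a \<in> carrier \<Lambda> \<and> clears ?d X}"
      using R.m_comm[OF ce(1,2)] by (cases x) auto
  qed
  have "evaluate ((?d \<otimes>\<^bsub>R\<^esub> e) \<otimes>\<^bsub>R\<^esub> k) (c \<otimes>\<^bsub>P\<^esub> frag_of (a', X')) = \<zero>\<^bsub>\<Lambda>\<^esub> \<and>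
      evaluate ((?d \<otimes>\<^bsub>R\<^esub> e) \<otimes>\<^bsub>R\<^esub> k) (frag_of (a', X') \<otimes>\<^bsub>P\<^esub> c) = \<zero>\<^bsub>\<Lambda>\<^esub>" if k: "k \<in> S" for k
  proof -
    have "(?d \<otimes>\<^bsub>R\<^esub> e) \<otimes>\<^bsub>R\<^esub> k = ?d \<otimes>\<^bsub>R\<^esub> (e \<otimes>\<^bsub>R\<^esub> k)" using Sc(1)[OF k] ce by (simp add: R.m_assoc)
    then show ?thesis
      using evaluate_mult[OF clr a(1) clears_multiple[OF e k]] d(2)[OF d'(1)] cleared_closed a(1)
      by simp
  qed
  moreover have "?d \<otimes>\<^bsub>R\<^esub> e \<in> S" using Sc(3) d(1) d'(1) clearsD(1)[OF e] by blast
  moreover have "c \<otimes>\<^bsub>P\<^esub> frag_of (a', X') \<in> carrier P" "frag_of (a', X') \<otimes>\<^bsub>P\<^esub> c \<in> carrier P"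
    using cP frag_in_P[OF a] by (auto simp del: P.m_closed intro: P.m_closed)
  ultimately show "c \<otimes>\<^bsub>P\<^esub> frag_of (a', X') \<in> vanishing" "frag_of (a', X') \<otimes>\<^bsub>P\<^esub> c \<in> vanishing"
    unfolding vanishing_def by blast+
qed

lemma zero_vanishing: "0 \<in> vanishing"
  using zero_in_P Sc(2) by (auto simp: vanishing_def evaluate_zero)

lemma vanishing_ideal: "ideal vanishing P"
proof (rule idealI[OF P.ring_axioms])
  have sub: "vanishing \<subseteq> carrier P" by (auto simp: vanishing_def)
  have inv: "\<ominus>\<^bsub>P\<^esub> c = 0 - c" if "c \<in> vanishing" for c
    using pair_ring_minus[OF \<Lambda>.ring_axioms BR.ring_axioms, of 0 c] that sub zero_in_P
    by (auto simp: a_minus_def pair_ring_simps(3))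
  show "subgroup vanishing (add_monoid P)"
  proof (rule P.add.subgroupI)
    show "vanishing \<subseteq> carrier P" "vanishing \<noteq> {}" using sub zero_vanishing by auto
    show "\<ominus>\<^bsub>P\<^esub> c \<in> vanishing" if "c \<in> vanishing" for c
      using vanishing_minus[OF zero_vanishing that] inv[OF that] by simp
    show "c \<oplus>\<^bsub>P\<^esub> c' \<in> vanishing" if "c \<in> vanishing" "c' \<in> vanishing" for c c'
      using vanishing_minus[OF that(1) vanishing_minus[OF zero_vanishing that(2)]]
      by (simp add: pair_ring_simps)
  qed
  fix c x assume c: "c \<in> vanishing" and x: "x \<in> carrier P"
  have cP: "c \<in> carrier P" using c sub by auto
  have "Poly_Mapping.keys x \<subseteq> carrier \<Lambda> \<times> carrier B"
    using x by (simp add: pair_ring_simps)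
  then have "x \<otimes>\<^bsub>P\<^esub> c \<in> vanishing \<and> c \<otimes>\<^bsub>P\<^esub> x \<in> vanishing \<and> x \<in> carrier P"
  proof (induction x rule: frag_induction)
    case zero
    have "0 \<otimes>\<^bsub>P\<^esub> c = 0" "c \<otimes>\<^bsub>P\<^esub> 0 = 0" using P.l_null[OF cP] P.r_null[OF cP] by (simp_all add: pair_ring_simps(2))
    then show ?case using zero_vanishing zero_in_P by simp
  next
    case (one x)
    then show ?case using vanishing_mult_frag[OF c] frag_in_P by auto
  next
    case (diff x y)
    then show ?case using vanishing_minus P_minus_closed by (simp add: P_mult_minus cP)
  qed
  then show "x \<otimes>\<^bsub>P\<^esub> c \<in> vanishing" "c \<otimes>\<^bsub>P\<^esub> x \<in> vanishing" by auto
qed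

lemma vanishingI:
  assumes "c \<in> carrier P" "d \<in> S" "\<And>k. k \<in> S \<Longrightarrow> evaluate (d \<otimes>\<^bsub>R\<^esub> k) c = \<zero>\<^bsub>\<Lambda>\<^esub>"
  shows "c \<in> vanishing"
  using assms by (auto simp: vanishing_def)

lemma relations_vanish: "tensor_relations R \<Lambda> B \<subseteq> vanishing"
proof
  note m = P_minus_closed frag_in_P
  have cancel: "x \<oplus>\<^bsub>\<Lambda>\<^esub> y \<ominus>\<^bsub>\<Lambda>\<^esub> x \<ominus>\<^bsub>\<Lambda>\<^esub> y = \<zero>\<^bsub>\<Lambda>\<^esub>" if "x \<in> carrier \<Lambda>" "y \<in> carrier \<Lambda>" for x y
  proof -
    have "x \<oplus>\<^bsub>\<Lambda>\<^esub> y \<ominus>\<^bsub>\<Lambda>\<^esub> x = y"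
      using that by (simp add: a_minus_def \<Lambda>.a_comm[of x y] \<Lambda>.a_assoc \<Lambda>.r_neg)
    then show ?thesis using that by (simp add: a_minus_def \<Lambda>.r_neg)
  qed
  fix c assume "c \<in> tensor_relations R \<Lambda> B"
  then consider (left) a a' b where "c = frag_of (a \<oplus>\<^bsub>\<Lambda>\<^esub> a', b) - frag_of (a, b) - frag_of (a', b)"
      "a \<in> carrier \<Lambda>" "a' \<in> carrier \<Lambda>" "b \<in> carrier B"
    | (right) a b b' where "c = frag_of (a, b \<oplus>\<^bsub>B\<^esub> b') - frag_of (a, b) - frag_of (a, b')"
      "a \<in> carrier \<Lambda>" "b \<in> carrier B" "b' \<in> carrier B"
    | (balance) r a b where "c = frag_of (r \<odot>\<^bsub>\<Lambda>\<^esub> a, b) - frag_of (a, r \<odot>\<^bsub>B\<^esub> b)"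
      "r \<in> carrier R" "a \<in> carrier \<Lambda>" "b \<in> carrier B"
    unfolding tensor_relations_def by blast
  then show "c \<in> vanishing"
  proof cases
    case left
    show ?thesis
      using left cleared_closed
      by (intro vanishingI[OF _ Sc(2)])
        (auto simp: m evaluate_minus evaluate(3) L.smult_r_distr cancel)
  next
    case right
    obtain d where d: "d \<in> S" "\<And>X. X \<in> {b, b'} \<Longrightarrow> clears d X"
      using clears_finite[of "{b, b'}"] right by auto
    have "evaluate (d \<otimes>\<^bsub>R\<^esub> k) c = \<zero>\<^bsub>\<Lambda>\<^esub>" if "k \<in> S" for k
      using right cleared_closed clears_add(2)[OF clears_multiple[OF d(2) that] clears_multiple[OF d(2) that], of b b']
      by (auto simp: m evaluate_minus evaluate(3) L.smult_l_distr cancel)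
    then show ?thesis using right by (intro vanishingI[OF _ d(1)]) (auto intro!: m)
  next
    case balance
    obtain d where d: "clears d b" using clears_exists balance by blast
    have "evaluate (d \<otimes>\<^bsub>R\<^esub> k) c = \<zero>\<^bsub>\<Lambda>\<^esub>" if "k \<in> S" for k
      using balance cleared_closed clears_smult(2)[OF clears_multiple[OF d that] balance(2)]
      by (auto simp: m evaluate_minus evaluate(3) L.smult_assoc1[symmetric] R.m_comm a_minus_def \<Lambda>.r_neg)
    then show ?thesis using balance by (intro vanishingI[OF _ clearsD(1)[OF d]]) (auto intro!: m)
  qed
qed

text \<open>The vanishing elements form an ideal that contains the relations, hence contains \<open>G\<close>; and the value
  of \<open>x \<otimes> \<one>\<close> is \<open>d x\<close>, which is non-zero for \<open>x \<noteq> 0\<close> in a torsion-free algebra.\<close>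

lemma pure_tensor_relation_zero:
  assumes "frag_of (x, \<one>\<^bsub>B\<^esub>) \<in> G" "x \<in> carrier \<Lambda>"
  shows "x = \<zero>\<^bsub>\<Lambda>\<^esub>"
proof -
  have "frag_of (x, \<one>\<^bsub>B\<^esub>) \<in> vanishing"
    using P.genideal_minimal[OF vanishing_ideal relations_vanish] assms by blast
  then obtain d where d: "d \<in> S" "evaluate (d \<otimes>\<^bsub>R\<^esub> \<one>\<^bsub>R\<^esub>) (frag_of (x, \<one>\<^bsub>B\<^esub>)) = \<zero>\<^bsub>\<Lambda>\<^esub>"
    using Sc(2) by (auto simp: vanishing_def)
  then have "d \<odot>\<^bsub>\<Lambda>\<^esub> x = \<zero>\<^bsub>\<Lambda>\<^esub>" using assms(2) Sc by (simp add: evaluate(3) clears_one)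
  moreover have "d \<noteq> \<zero>\<^bsub>R\<^esub>" using d(1) S(2) by auto
  ultimately show ?thesis using tf Sc(1)[OF d(1)] assms(2) by (auto simp: torsion_free_def)
qed

definition to_tensor :: "'a \<Rightarrow> ('a \<times> ('r \<times> 'r) set \<Rightarrow>\<^sub>0 int) set" where
  "to_tensor x = G +>\<^bsub>P\<^esub> frag_of (x, \<one>\<^bsub>B\<^esub>)"

abbreviation (input) cls where "cls c \<equiv> G +>\<^bsub>P\<^esub> c"

lemma cls_simps:
  "\<lbrakk>c \<in> carrier P; c' \<in> carrier P\<rbrakk> \<Longrightarrow> cls c \<otimes>\<^bsub>T\<^esub> cls c' = cls (c \<otimes>\<^bsub>P\<^esub> c')"
  "\<lbrakk>c \<in> carrier P; c' \<in> carrier P\<rbrakk> \<Longrightarrow> cls c \<oplus>\<^bsub>T\<^esub> cls c' = cls (c + c')"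
  "c \<in> carrier P \<Longrightarrow> cls c \<in> carrier T" "\<one>\<^bsub>T\<^esub> = cls (frag_of (\<one>\<^bsub>\<Lambda>\<^esub>, \<one>\<^bsub>B\<^esub>))"
  "\<lbrakk>c \<in> carrier P; c' \<in> carrier P\<rbrakk> \<Longrightarrow> cls c = cls c' \<longleftrightarrow> c - c' \<in> G"
proof -
  note h = G.rcos_ring_hom[folded tensor_algebra_def]
  show "\<lbrakk>c \<in> carrier P; c' \<in> carrier P\<rbrakk> \<Longrightarrow> cls c \<otimes>\<^bsub>T\<^esub> cls c' = cls (c \<otimes>\<^bsub>P\<^esub> c')"
    "\<lbrakk>c \<in> carrier P; c' \<in> carrier P\<rbrakk> \<Longrightarrow> cls c \<oplus>\<^bsub>T\<^esub> cls c' = cls (c + c')"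
    "c \<in> carrier P \<Longrightarrow> cls c \<in> carrier T" "\<one>\<^bsub>T\<^esub> = cls (frag_of (\<one>\<^bsub>\<Lambda>\<^esub>, \<one>\<^bsub>B\<^esub>))"
    using ring_hom_memE[OF h] by (simp_all add: pair_ring_simps(3,4))
  show "\<lbrakk>c \<in> carrier P; c' \<in> carrier P\<rbrakk> \<Longrightarrow> cls c = cls c' \<longleftrightarrow> c - c' \<in> G"
    using P.quotient_eq_iff_same_a_r_cos[OF G_ideal] pair_ring_minus[OF \<Lambda>.ring_axioms BR.ring_axioms]
    by metis
qed

lemma relation_in_G: "c \<in> tensor_relations R \<Lambda> B \<Longrightarrow> c \<in> G"
  using P.genideal_self[OF L.tensor_relations_carrier[OF B.ring_algebra_axioms]] by blast

lemma cls_add_left: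
  assumes "a \<in> carrier \<Lambda>" "a' \<in> carrier \<Lambda>" "X \<in> carrier B"
  shows "cls (frag_of (a \<oplus>\<^bsub>\<Lambda>\<^esub> a', X)) = cls (frag_of (a, X)) \<oplus>\<^bsub>T\<^esub> cls (frag_of (a', X))"
proof -
  have "frag_of (a \<oplus>\<^bsub>\<Lambda>\<^esub> a', X) - frag_of (a, X) - frag_of (a', X) \<in> tensor_relations R \<Lambda> B"
    unfolding tensor_relations_def using assms by blast
  then have "frag_of (a \<oplus>\<^bsub>\<Lambda>\<^esub> a', X) - (frag_of (a, X) + frag_of (a', X)) \<in> G"
    using relation_in_G by (simp add: diff_diff_eq)
  moreover have "frag_of (a, X) + frag_of (a', X) \<in> carrier P"
    using P.a_closed[OF frag_in_P frag_in_P] assms by (simp add: pair_ring_simps(3))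
  ultimately show ?thesis using assms by (simp add: cls_simps(2,5) frag_in_P)
qed

lemma cls_balance:
  assumes "r \<in> carrier R" "a \<in> carrier \<Lambda>" "X \<in> carrier B"
  shows "cls (frag_of (r \<odot>\<^bsub>\<Lambda>\<^esub> a, X)) = cls (frag_of (a, r \<odot>\<^bsub>B\<^esub> X))"
proof -
  have "frag_of (r \<odot>\<^bsub>\<Lambda>\<^esub> a, X) - frag_of (a, r \<odot>\<^bsub>B\<^esub> X) \<in> tensor_relations R \<Lambda> B"
    unfolding tensor_relations_def using assms by blast
  then show ?thesis using assms relation_in_G by (simp add: cls_simps(5) frag_in_P)
qed

lemma to_tensor_hom: "to_tensor \<in> ring_hom \<Lambda> T"
proof (rule ring_hom_memI)
  fix x y assume xy: "x \<in> carrier \<Lambda>" "y \<in> carrier \<Lambda>"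
  show "to_tensor x \<in> carrier T" using xy by (simp add: to_tensor_def cls_simps(3) frag_in_P)
  show "to_tensor (x \<otimes>\<^bsub>\<Lambda>\<^esub> y) = to_tensor x \<otimes>\<^bsub>T\<^esub> to_tensor y"
    using xy by (simp add: to_tensor_def cls_simps(1) frag_in_P pair_ring_simps(5))
  show "to_tensor (x \<oplus>\<^bsub>\<Lambda>\<^esub> y) = to_tensor x \<oplus>\<^bsub>T\<^esub> to_tensor y"
    using xy by (simp add: to_tensor_def cls_add_left)
qed (simp add: to_tensor_def cls_simps(4))

lemma to_tensor_inj: "inj_on to_tensor (carrier \<Lambda>)"
proof (rule inj_onI)
  interpret h: ring_hom_ring \<Lambda> T to_tensor
    by (rule ring_hom_ringI2[OF \<Lambda>.ring_axioms T.ring_axioms to_tensor_hom])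
  fix x y assume xy: "x \<in> carrier \<Lambda>" "y \<in> carrier \<Lambda>" "to_tensor x = to_tensor y"
  let ?z = "x \<ominus>\<^bsub>\<Lambda>\<^esub> y"
  have z: "?z \<in> carrier \<Lambda>" using xy by simp
  have "to_tensor ?z = to_tensor \<zero>\<^bsub>\<Lambda>\<^esub>" using xy by (simp add: a_minus_def T.r_neg)
  then have "cls (frag_of (?z, \<one>\<^bsub>B\<^esub>)) = \<zero>\<^bsub>T\<^esub>" by (simp add: to_tensor_def[symmetric])
  then have "cls (frag_of (?z, \<one>\<^bsub>B\<^esub>)) = G" by (simp add: tensor_algebra_def FactRing_def)
  then have "frag_of (?z, \<one>\<^bsub>B\<^esub>) \<in> G"
    using G.rcos_const_imp_mem frag_in_P[OF z BR.one_closed] by blast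
  then have "?z = \<zero>\<^bsub>\<Lambda>\<^esub>" by (rule pure_tensor_relation_zero[OF _ z])
  moreover have "x = ?z \<oplus>\<^bsub>\<Lambda>\<^esub> y" using xy(1,2) by (simp add: a_minus_def \<Lambda>.a_assoc \<Lambda>.l_neg)
  ultimately show "x = y" using xy(1,2) by simp
qed

lemma to_tensor_scalar:
  assumes "r \<in> carrier R"
  shows "to_tensor (r \<odot>\<^bsub>\<Lambda>\<^esub> \<one>\<^bsub>\<Lambda>\<^esub>) = cls (frag_of (\<one>\<^bsub>\<Lambda>\<^esub>, fraction R S r \<one>\<^bsub>R\<^esub>))"
  unfolding to_tensor_def using cls_balance[OF assms \<Lambda>.one_closed BR.one_closed] assms
    R.localization_simps(3)[OF S(1) assms, of "\<one>\<^bsub>R\<^esub>" "\<one>\<^bsub>R\<^esub>"] R.localization_carrier(3)[OF S(1)] Sc(2)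
  by simp

lemma to_tensor_unit:
  assumes "s \<in> S"
  shows "to_tensor (s \<odot>\<^bsub>\<Lambda>\<^esub> \<one>\<^bsub>\<Lambda>\<^esub>) \<in> Units T"
proof -
  note sR = Sc(1)[OF assms]
  let ?X = "fraction R S s \<one>\<^bsub>R\<^esub>" and ?Y = "fraction R S \<one>\<^bsub>R\<^esub> s"
  have c: "?X \<in> carrier B" "?Y \<in> carrier B"
    using R.localization_carrier(1)[OF S(1)] sR assms Sc(2) by auto
  have "?X \<otimes>\<^bsub>B\<^esub> ?Y = fraction R S s s"
    using R.localization_simps(1)[OF S(1) sR R.one_closed Sc(2) assms] sR by simp
  also have "\<dots> = \<one>\<^bsub>B\<^esub>"
    using R.fraction_eq_iff[OF S sR R.one_closed assms Sc(2)] R.localization_carrier(3)[OF S(1)] sR by simp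
  finally have XY: "?X \<otimes>\<^bsub>B\<^esub> ?Y = \<one>\<^bsub>B\<^esub>" .
  then have YX: "?Y \<otimes>\<^bsub>B\<^esub> ?X = \<one>\<^bsub>B\<^esub>" using c by (simp add: BR.m_comm)
  have "cls (frag_of (\<one>\<^bsub>\<Lambda>\<^esub>, ?X)) \<otimes>\<^bsub>T\<^esub> cls (frag_of (\<one>\<^bsub>\<Lambda>\<^esub>, ?Y)) = \<one>\<^bsub>T\<^esub>"
    "cls (frag_of (\<one>\<^bsub>\<Lambda>\<^esub>, ?Y)) \<otimes>\<^bsub>T\<^esub> cls (frag_of (\<one>\<^bsub>\<Lambda>\<^esub>, ?X)) = \<one>\<^bsub>T\<^esub>"
    using c XY YX by (simp_all add: cls_simps(1,4) frag_in_P pair_ring_simps(5))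
  moreover have "cls (frag_of (\<one>\<^bsub>\<Lambda>\<^esub>, ?X)) \<in> carrier T" "cls (frag_of (\<one>\<^bsub>\<Lambda>\<^esub>, ?Y)) \<in> carrier T"
    using c by (simp_all add: cls_simps(3) frag_in_P)
  ultimately show ?thesis unfolding to_tensor_scalar[OF sR] Units_def by blast
qed

lemma to_tensor_fraction:
  assumes t: "t \<in> carrier T"
  shows "\<exists>s \<in> S. \<exists>x \<in> carrier \<Lambda>. to_tensor (s \<odot>\<^bsub>\<Lambda>\<^esub> \<one>\<^bsub>\<Lambda>\<^esub>) \<otimes>\<^bsub>T\<^esub> t = to_tensor x"
proof -
  interpret h: ring_hom_ring \<Lambda> T to_tensor
    by (rule ring_hom_ringI2[OF \<Lambda>.ring_axioms T.ring_axioms to_tensor_hom])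
  obtain c where c: "t = cls c" "c \<in> carrier P"
    using t by (auto simp: tensor_algebra_def FactRing_def A_RCOSETS_def')
  have scal: "to_tensor (r \<odot>\<^bsub>\<Lambda>\<^esub> \<one>\<^bsub>\<Lambda>\<^esub>) \<otimes>\<^bsub>T\<^esub> to_tensor x = to_tensor (r \<odot>\<^bsub>\<Lambda>\<^esub> x)"
    if "r \<in> carrier R" "x \<in> carrier \<Lambda>" for r x
    using that by (simp flip: h.hom_mult add: L.smult_mult_left)
  have "Poly_Mapping.keys c \<subseteq> carrier \<Lambda> \<times> carrier B" using c(2) by (simp add: pair_ring_simps)
  then have "c \<in> carrier P \<and> (\<exists>s \<in> S. \<exists>x \<in> carrier \<Lambda>. to_tensor (s \<odot>\<^bsub>\<Lambda>\<^esub> \<one>\<^bsub>\<Lambda>\<^esub>) \<otimes>\<^bsub>T\<^esub> cls c = to_tensor x)"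
  proof (induction c rule: frag_induction)
    case zero
    have "cls 0 = \<zero>\<^bsub>T\<^esub>"
      using P.a_rcos_zero[OF G_ideal G.zero_closed] by (simp add: tensor_algebra_def FactRing_def pair_ring_simps(2))
    moreover have "to_tensor (\<one>\<^bsub>R\<^esub> \<odot>\<^bsub>\<Lambda>\<^esub> \<one>\<^bsub>\<Lambda>\<^esub>) \<otimes>\<^bsub>T\<^esub> \<zero>\<^bsub>T\<^esub> = to_tensor \<zero>\<^bsub>\<Lambda>\<^esub>" by simp
    ultimately show ?case using Sc(2) zero_in_P by (metis \<Lambda>.zero_closed)
  next
    case (one p)
    then obtain a X where p: "p = (a, X)" "a \<in> carrier \<Lambda>" "X \<in> carrier B" by auto
    obtain b s where X: "X = fraction R S b s" "b \<in> carrier R" "s \<in> S" by (rule R.localizationE[OF S(1) p(3)])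
    note sR = Sc(1)[OF X(3)]
    have sX: "s \<odot>\<^bsub>B\<^esub> X = b \<odot>\<^bsub>B\<^esub> \<one>\<^bsub>B\<^esub>"
      using cleared_eq[OF clears_fraction(1)[OF X(2,3)]] clears_fraction(2)[OF X(2,3)]
        R.localization_simps(3)[OF S(1) X(2) R.one_closed Sc(2)] R.localization_carrier(3)[OF S(1)] X by simp
    have "to_tensor (s \<odot>\<^bsub>\<Lambda>\<^esub> \<one>\<^bsub>\<Lambda>\<^esub>) \<otimes>\<^bsub>T\<^esub> cls (frag_of p) = cls (frag_of (s \<odot>\<^bsub>\<Lambda>\<^esub> a, X))"
      using p sR by (simp add: to_tensor_def cls_simps(1) frag_in_P pair_ring_simps(5) L.smult_mult_left)
    also have "\<dots> = cls (frag_of (a, b \<odot>\<^bsub>B\<^esub> \<one>\<^bsub>B\<^esub>))" using cls_balance[OF sR p(2,3)] sX by simp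
    also have "\<dots> = to_tensor (b \<odot>\<^bsub>\<Lambda>\<^esub> a)"
      using cls_balance[OF X(2) p(2) BR.one_closed] by (simp add: to_tensor_def)
    finally show ?case using X(2,3) p frag_in_P by (metis L.smult_closed)
  next
    case (diff c c')
    then obtain s x s' x' where *: "s \<in> S" "s' \<in> S" "x \<in> carrier \<Lambda>" "x' \<in> carrier \<Lambda>"
      "to_tensor (s \<odot>\<^bsub>\<Lambda>\<^esub> \<one>\<^bsub>\<Lambda>\<^esub>) \<otimes>\<^bsub>T\<^esub> cls c = to_tensor x"
      "to_tensor (s' \<odot>\<^bsub>\<Lambda>\<^esub> \<one>\<^bsub>\<Lambda>\<^esub>) \<otimes>\<^bsub>T\<^esub> cls c' = to_tensor x'" and cP: "c \<in> carrier P" "c' \<in> carrier P" by blast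
    note sR = Sc(1)[OF *(1)] Sc(1)[OF *(2)]
    have cl: "cls c \<in> carrier T" "cls c' \<in> carrier T" using cP by (simp_all add: cls_simps(3))
    have "cls c = cls (c - c') \<oplus>\<^bsub>T\<^esub> cls c'"
      using cls_simps(2)[OF P_minus_closed[OF cP] cP(2)] by simp
    then have mi: "cls (c - c') = cls c \<ominus>\<^bsub>T\<^esub> cls c'"
      using cl cls_simps(3)[OF P_minus_closed[OF cP]] by (simp add: a_minus_def T.a_assoc T.r_neg)
    have e: "(s \<otimes>\<^bsub>R\<^esub> s') \<odot>\<^bsub>\<Lambda>\<^esub> \<one>\<^bsub>\<Lambda>\<^esub> = (s' \<odot>\<^bsub>\<Lambda>\<^esub> \<one>\<^bsub>\<Lambda>\<^esub>) \<otimes>\<^bsub>\<Lambda>\<^esub> (s \<odot>\<^bsub>\<Lambda>\<^esub> \<one>\<^bsub>\<Lambda>\<^esub>)"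
      "(s \<otimes>\<^bsub>R\<^esub> s') \<odot>\<^bsub>\<Lambda>\<^esub> \<one>\<^bsub>\<Lambda>\<^esub> = (s \<odot>\<^bsub>\<Lambda>\<^esub> \<one>\<^bsub>\<Lambda>\<^esub>) \<otimes>\<^bsub>\<Lambda>\<^esub> (s' \<odot>\<^bsub>\<Lambda>\<^esub> \<one>\<^bsub>\<Lambda>\<^esub>)"
      using sR by (simp_all add: L.smult_mult_left L.smult_assoc1[symmetric] R.m_comm)
    have assoc: "to_tensor (y \<otimes>\<^bsub>\<Lambda>\<^esub> z) \<otimes>\<^bsub>T\<^esub> t = to_tensor y \<otimes>\<^bsub>T\<^esub> (to_tensor z \<otimes>\<^bsub>T\<^esub> t)"
      if "y \<in> carrier \<Lambda>" "z \<in> carrier \<Lambda>" "t \<in> carrier T" for y z t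
      using that by (simp add: T.m_assoc)
    have "to_tensor ((s \<otimes>\<^bsub>R\<^esub> s') \<odot>\<^bsub>\<Lambda>\<^esub> \<one>\<^bsub>\<Lambda>\<^esub>) \<otimes>\<^bsub>T\<^esub> cls c = to_tensor (s' \<odot>\<^bsub>\<Lambda>\<^esub> x)"
      unfolding e(1) using assoc[of "s' \<odot>\<^bsub>\<Lambda>\<^esub> \<one>\<^bsub>\<Lambda>\<^esub>" "s \<odot>\<^bsub>\<Lambda>\<^esub> \<one>\<^bsub>\<Lambda>\<^esub>" "cls c"] sR cl(1) *(3,5) scal[OF sR(2) *(3)]
      by simp
    moreover have "to_tensor ((s \<otimes>\<^bsub>R\<^esub> s') \<odot>\<^bsub>\<Lambda>\<^esub> \<one>\<^bsub>\<Lambda>\<^esub>) \<otimes>\<^bsub>T\<^esub> cls c' = to_tensor (s \<odot>\<^bsub>\<Lambda>\<^esub> x')"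
      unfolding e(2) using assoc[of "s \<odot>\<^bsub>\<Lambda>\<^esub> \<one>\<^bsub>\<Lambda>\<^esub>" "s' \<odot>\<^bsub>\<Lambda>\<^esub> \<one>\<^bsub>\<Lambda>\<^esub>" "cls c'"] sR cl(2) *(4,6) scal[OF sR(1) *(4)]
      by simp
    moreover have "to_tensor ((s \<otimes>\<^bsub>R\<^esub> s') \<odot>\<^bsub>\<Lambda>\<^esub> \<one>\<^bsub>\<Lambda>\<^esub>) \<in> carrier T"
      using sR by (intro h.hom_closed) simp
    ultimately have "to_tensor ((s \<otimes>\<^bsub>R\<^esub> s') \<odot>\<^bsub>\<Lambda>\<^esub> \<one>\<^bsub>\<Lambda>\<^esub>) \<otimes>\<^bsub>T\<^esub> cls (c - c')
        = to_tensor ((s' \<odot>\<^bsub>\<Lambda>\<^esub> x) \<ominus>\<^bsub>\<Lambda>\<^esub> (s \<odot>\<^bsub>\<Lambda>\<^esub> x'))"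
      using cl sR * by (simp add: mi a_minus_def T.r_distr T.r_minus)
    then show ?case using Sc(3)[OF *(1,2)] P_minus_closed[OF cP] sR *(3,4)
      by (metis L.smult_closed \<Lambda>.minus_closed)
  qed
  then show ?thesis using c(1) by simp
qed

end

text \<open>All that is used about \<open>\<Lambda> \<otimes> S\<inverse>R\<close> is that it is the ring of fractions of \<open>\<Lambda>\<close> with denominators in
  \<open>S\<close>, with \<open>\<Lambda>\<close> as a subring.  Both \<open>\<Lambda>\<^sub>m\<close> and \<open>\<Lambda> \<otimes> Q\<close> are instances.\<close>

locale ring_of_fractions =
  R: "domain" R + \<Lambda>: ring \<Lambda> + L: ring_algebra R \<Lambda> + T: ring T
  for R :: "('r, 'b) ring_scheme" and \<Lambda> :: "('r, 'a) module" and S :: "'r set"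
    and T :: "('t, 'd) ring_scheme" and \<iota> :: "'a \<Rightarrow> 't" +
  assumes torsion_free: "torsion_free R \<Lambda>"
    and S: "submonoid S R" "\<zero>\<^bsub>R\<^esub> \<notin> S"
    and \<iota>_hom: "\<iota> \<in> ring_hom \<Lambda> T" and \<iota>_inj: "inj_on \<iota> (carrier \<Lambda>)"
    and \<iota>_unit: "s \<in> S \<Longrightarrow> \<iota> (s \<odot>\<^bsub>\<Lambda>\<^esub> \<one>\<^bsub>\<Lambda>\<^esub>) \<in> Units T"
    and is_fraction: "t \<in> carrier T \<Longrightarrow>
      \<exists>s \<in> S. \<exists>x \<in> carrier \<Lambda>. \<iota> (s \<odot>\<^bsub>\<Lambda>\<^esub> \<one>\<^bsub>\<Lambda>\<^esub>) \<otimes>\<^bsub>T\<^esub> t = \<iota> x"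

lemma tensor_localization_ring_of_fractions:
  assumes "ring_algebra R \<Lambda>" "domain R" "torsion_free R \<Lambda>" "submonoid S R" "\<zero>\<^bsub>R\<^esub> \<notin> S"
  shows "ring_of_fractions R \<Lambda> S (tensor_algebra R \<Lambda> (localization R S)) (to_tensor R \<Lambda> S)"
proof -
  interpret domain R by fact
  note a = assms
  show ?thesis
    by (intro ring_of_fractions.intro ring_of_fractions_axioms.intro a
        ring_algebra.axioms(2)[OF a(1)] tensor_algebra_ring[OF a(1) localization_ring_algebra[OF a(4)]]
        to_tensor_hom[OF a] to_tensor_inj[OF a] to_tensor_unit[OF a] to_tensor_fraction[OF a])
qed

section \<open>Idempotents of a simple artinian ring\<close>

lemma left_artinian_minimal:
  assumes art: "left_artinian R" and I0: "I0 \<in> F" and F: "\<And>I. I \<in> F \<Longrightarrow> left_ideal I R"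
  shows "\<exists>I \<in> F. \<forall>J \<in> F. J \<subseteq> I \<longrightarrow> J = I"
proof (rule ccontr)
    assume "\<not> ?thesis"
    then obtain h where h: "\<And>I. I \<in> F \<Longrightarrow> h I \<in> F \<and> h I \<subseteq> I \<and> h I \<noteq> I" by metis
    have iter: "(h ^^ n) I0 \<in> F" for n by (induction n) (use I0 h in auto)
    have "\<exists>n. \<forall>m \<ge> n. (h ^^ m) I0 = (h ^^ n) I0"
      using art[unfolded left_artinian_def, rule_format, of "\<lambda>n. (h ^^ n) I0"] F[OF iter] h[OF iter] by simp
    then obtain n where n: "(h ^^ Suc n) I0 = (h ^^ n) I0" by (metis le_SucI order_refl)
    then show False using h[OF iter[of n]] by simp
qed

lemma (in ring) eq_if_minus_zero:
  assumes "x \<ominus> y = \<zero>" "x \<in> carrier R" "y \<in> carrier R" shows "x = y"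
proof -
  have "x = (x \<ominus> y) \<oplus> y" using assms(2,3) by (simp add: a_minus_def a_assoc l_neg)
  then show ?thesis using assms by simp
qed

lemma (in ring) two_sided_idealI:
  assumes "I \<subseteq> carrier R" "\<zero> \<in> I" "\<And>x y. \<lbrakk>x \<in> I; y \<in> I\<rbrakk> \<Longrightarrow> x \<oplus> y \<in> I"
    and l: "\<And>a x. \<lbrakk>a \<in> carrier R; x \<in> I\<rbrakk> \<Longrightarrow> a \<otimes> x \<in> I"
    and r: "\<And>a x. \<lbrakk>a \<in> carrier R; x \<in> I\<rbrakk> \<Longrightarrow> x \<otimes> a \<in> I"
  shows "ideal I R"
proof (rule idealI[OF ring_axioms])
  have "\<ominus> x \<in> I" if x: "x \<in> I" for x
  proof -
    have "(\<ominus> \<one>) \<otimes> x \<in> I" using l x by simp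
    then show ?thesis using assms(1) x by (simp add: l_minus subset_iff)
  qed
  then show "subgroup I (add_monoid R)"
    using assms(1-3) by (intro add.subgroupI) (auto simp: a_inv_def)
qed (use l r in auto)

text \<open>Let \<open>V\<close> be a minimal left ideal.  Its annihilator, a proper two-sided ideal, is zero, so \<open>V a = V\<close> for
  some \<open>a \<in> V\<close>, and right multiplication by \<open>a\<close> is injective on \<open>V\<close>; so the \<open>f \<in> V\<close> with \<open>f a = a\<close> is an idempotent.  The last
  property expresses that \<open>f R f\<close> is a division ring, and follows from \<open>R b = V\<close>.\<close>

lemma simple_artinian_primitive_idempotent:
  fixes R (structure)
  assumes sa: "simple_artinian R"
  obtains f where "f \<in> carrier R" "f \<noteq> \<zero>" "f \<otimes> f = f"
    "\<And>b. \<lbrakk>b \<in> carrier R; f \<otimes> b \<otimes> f = b; b \<noteq> \<zero>\<rbrakk> \<Longrightarrow> \<exists>c \<in> carrier R. c \<otimes> b = f"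
proof -
  interpret ring R using sa by (simp add: simple_artinian_def)
  have one: "\<one> \<noteq> \<zero>" and simp: "\<And>I. ideal I R \<Longrightarrow> I = {\<zero>} \<or> I = carrier R"
    and art: "left_artinian R" using sa by (auto simp: simple_artinian_def)
  let ?F = "{I. left_ideal I R \<and> I \<noteq> {\<zero>}}"
  have F: "carrier R \<in> ?F" using one ideal_imp_left_ideal[OF oneideal] by auto
  have "\<exists>I \<in> ?F. \<forall>J \<in> ?F. J \<subseteq> I \<longrightarrow> J = I" by (rule left_artinian_minimal[OF art F]) simp
  then obtain V where V: "left_ideal V R" "V \<noteq> {\<zero>}"
    "\<And>J. \<lbrakk>left_ideal J R; J \<noteq> {\<zero>}; J \<subseteq> V\<rbrakk> \<Longrightarrow> J = V" by blast
  note Vd = left_idealD[OF V(1)]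
  have "\<exists>a \<in> V. \<exists>x \<in> V. x \<otimes> a \<noteq> \<zero>"
  proof (rule ccontr)
    assume neg: "\<not> ?thesis"
    let ?W = "{x \<in> carrier R. \<forall>v \<in> V. x \<otimes> v = \<zero>}"
    have "ideal ?W R"
    proof (rule two_sided_idealI)
      fix a x assume a: "a \<in> carrier R" "x \<in> ?W"
      have "x \<otimes> a \<otimes> v = \<zero>" if "v \<in> V" for v
        using a Vd(4)[OF a(1) that] Vd(1) that by (simp add: m_assoc subset_iff)
      then show "x \<otimes> a \<in> ?W" using a by simp
      show "a \<otimes> x \<in> ?W" using a Vd(1) by (auto simp: m_assoc subset_iff)
    qed (use Vd(1) in \<open>auto simp: l_distr subset_iff\<close>)
    moreover have "V \<subseteq> ?W" using neg Vd(1) by auto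
    then have "?W \<noteq> {\<zero>}" using V(2) Vd(2) by blast
    ultimately have "\<one> \<in> ?W" using simp[of ?W] by blast
    then have "\<one> \<otimes> v = \<zero>" if "v \<in> V" for v using that by blast
    then have "v = \<zero>" if "v \<in> V" for v by (metis Vd(1) l_one subsetD that mem_Collect_eq)
    then show False using V(2) Vd(2) by blast
  qed
  then obtain a x where ax: "a \<in> V" "x \<in> V" "x \<otimes> a \<noteq> \<zero>" by blast
  have aR: "a \<in> carrier R" using ax(1) Vd(1) by blast
  have a0: "a \<noteq> \<zero>" using ax Vd(1) by auto
  let ?Va = "(\<lambda>v. v \<otimes> a) ` V"
  have "left_ideal ?Va R"
    unfolding left_ideal_iff
  proof (intro conjI ballI)
    show "\<zero> \<in> ?Va" using Vd(2) aR by (intro image_eqI[of _ _ \<zero>]) auto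
    show "y \<oplus> z \<in> ?Va" if yz: "y \<in> ?Va" "z \<in> ?Va" for y z
    proof -
      obtain v v' where v: "v \<in> V" "v' \<in> V" "y = v \<otimes> a" "z = v' \<otimes> a" using yz by auto
      then have "y \<oplus> z = (v \<oplus> v') \<otimes> a" using aR Vd(1) by (simp add: l_distr subset_iff)
      then show ?thesis using Vd(3)[OF v(1,2)] by blast
    qed
    show "c \<otimes> y \<in> ?Va" if c: "c \<in> carrier R" and y: "y \<in> ?Va" for c y
    proof -
      obtain v where v: "v \<in> V" "y = v \<otimes> a" using y by auto
      then have "c \<otimes> y = (c \<otimes> v) \<otimes> a" using aR c Vd(1) by (simp add: m_assoc subset_iff)
      then show ?thesis using Vd(4)[OF c v(1)] by blast
    qed
  qed (use Vd(1) aR in auto)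
  moreover have "?Va \<noteq> {\<zero>}" using ax by blast
  moreover have "?Va \<subseteq> V" using Vd(1,4) ax(1) by blast
  ultimately have "?Va = V" by (rule V(3))
  then obtain f where f: "f \<in> V" "f \<otimes> a = a" using ax(1) by (metis (no_types, lifting) image_iff)
  have fR: "f \<in> carrier R" using f Vd(1) by blast
  let ?N = "{v \<in> V. v \<otimes> a = \<zero>}"
  have "left_ideal ?N R"
    unfolding left_ideal_iff using Vd aR by (auto simp: l_distr m_assoc subset_iff)
  moreover have "f \<notin> ?N" using f a0 by simp
  then have "?N \<noteq> V" using f(1) by metis
  ultimately have N: "?N = {\<zero>}" using V(3)[of ?N] by blast
  have "f \<otimes> f \<ominus> f \<in> ?N"
  proof -
    have "(f \<otimes> f \<ominus> f) \<otimes> a = \<zero>"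
      using fR aR f(2) by (simp add: a_minus_def l_distr l_minus m_assoc r_neg)
    then show ?thesis using Vd(5)[OF Vd(4)[OF fR f(1)] f(1)] by simp
  qed
  then have "f \<otimes> f \<ominus> f = \<zero>" using N by blast
  then have ff: "f \<otimes> f = f" by (rule eq_if_minus_zero) (use fR in auto)
  have f0: "f \<noteq> \<zero>" using f(2) a0 aR by auto
  have "\<exists>c \<in> carrier R. c \<otimes> b = f" if b: "b \<in> carrier R" "f \<otimes> b \<otimes> f = b" "b \<noteq> \<zero>" for b
  proof -
    have "b \<in> V" using Vd(4)[of "f \<otimes> b" f] b f(1) fR by simp
    then have "(\<lambda>c. c \<otimes> b) ` carrier R \<subseteq> V" using Vd(4) by blast
    moreover have "\<one> \<otimes> b \<in> (\<lambda>c. c \<otimes> b) ` carrier R" by blast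
    then have "(\<lambda>c. c \<otimes> b) ` carrier R \<noteq> {\<zero>}" using b by (metis l_one singletonD)
    ultimately have "(\<lambda>c. c \<otimes> b) ` carrier R = V"
      using V(3)[OF left_ideal_principal[OF b(1)]] by blast
    then show ?thesis using f(1) by (metis (no_types, lifting) image_iff)
  qed
  then show thesis using that fR f0 ff by blast
qed

text \<open>The families \<open>u\<close> and \<open>w\<close> are the components of an isomorphism from \<open>(f R)\<^sup>d\<close> to \<open>e R\<close> and of its
  inverse.\<close>

definition free_over_idempotent :: "('a, 'b) ring_scheme \<Rightarrow> 'a \<Rightarrow> 'a \<Rightarrow> nat \<Rightarrow> (nat \<Rightarrow> 'a) \<Rightarrow> (nat \<Rightarrow> 'a) \<Rightarrow> bool" where
  "free_over_idempotent R f e d u w \<longleftrightarrow>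
     (\<forall>i<d. u i \<in> carrier R \<and> w i \<in> carrier R \<and> e \<otimes>\<^bsub>R\<^esub> u i = u i \<and> w i \<otimes>\<^bsub>R\<^esub> e = w i \<and>
       u i \<otimes>\<^bsub>R\<^esub> f = u i \<and> f \<otimes>\<^bsub>R\<^esub> w i = w i) \<and>
     (\<forall>i<d. \<forall>j<d. w i \<otimes>\<^bsub>R\<^esub> u j = (if i = j then f else \<zero>\<^bsub>R\<^esub>)) \<and>
     (\<Oplus>\<^bsub>R\<^esub>i\<in>{..<d}. u i \<otimes>\<^bsub>R\<^esub> w i) = e"

text \<open>The idempotent \<open>u w\<close> is equivalent to \<open>f\<close> and orthogonal to \<open>e - u w\<close>.\<close>

lemma (in ring) free_over_idempotent_extend:
  assumes f: "f \<in> carrier R" and e: "e \<in> carrier R"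
    and u: "u \<in> carrier R" "e \<otimes> u = u" "u \<otimes> f = u" and w: "w \<in> carrier R" "w \<otimes> e = w" "f \<otimes> w = w"
    and wu: "w \<otimes> u = f"
    and rest: "free_over_idempotent R f (e \<ominus> u \<otimes> w) d u' w'"
  shows "free_over_idempotent R f e (Suc d) (u'(d := u)) (w'(d := w))"
proof -
  let ?e = "e \<ominus> u \<otimes> w"
  have c: "?e \<in> carrier R" using e u w by simp
  have wuw: "w \<otimes> (u \<otimes> w) = w" using wu w u by (simp add: m_assoc[symmetric])
  have uwu: "(u \<otimes> w) \<otimes> u = u" using wu u w by (simp add: m_assoc)
  have we: "w \<otimes> ?e = \<zero>" using w u e wuw by (simp add: a_minus_def r_distr r_minus r_neg)
  have eu: "?e \<otimes> u = \<zero>" using w u e uwu by (simp add: a_minus_def l_distr l_minus r_neg)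
  have r: "u' i \<in> carrier R" "w' i \<in> carrier R" "?e \<otimes> u' i = u' i" "w' i \<otimes> ?e = w' i"
    "u' i \<otimes> f = u' i" "f \<otimes> w' i = w' i" if "i < d" for i
    using rest that by (auto simp: free_over_idempotent_def)
  have wu': "w \<otimes> u' i = \<zero>" "w' i \<otimes> u = \<zero>" if "i < d" for i
  proof -
    have "w \<otimes> (?e \<otimes> u' i) = \<zero>" using we w(1) c r(1)[OF that] by (simp add: m_assoc[symmetric])
    then show "w \<otimes> u' i = \<zero>" using r(3)[OF that] by simp
    have "(w' i \<otimes> ?e) \<otimes> u = \<zero>" using eu u(1) c r(2)[OF that] by (simp add: m_assoc)
    then show "w' i \<otimes> u = \<zero>" using r(4)[OF that] by simp
  qed
  have eu': "e \<otimes> u' i = u' i" "w' i \<otimes> e = w' i" if i: "i < d" for i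
  proof -
    have "?e \<otimes> u' i = e \<otimes> u' i" "w' i \<otimes> ?e = w' i \<otimes> e"
      using u(1) w(1) e r(1,2)[OF i] wu'[OF i]
      by (simp_all add: a_minus_def l_distr l_minus r_distr r_minus m_assoc)
        (simp add: m_assoc[symmetric])
    then show "e \<otimes> u' i = u' i" "w' i \<otimes> e = w' i" using r(3,4)[OF i] by simp_all
  qed
  have "(\<Oplus>i\<in>{..<Suc d}. (u'(d := u)) i \<otimes> (w'(d := w)) i)
      = u \<otimes> w \<oplus> (\<Oplus>i\<in>{..<d}. (u'(d := u)) i \<otimes> (w'(d := w)) i)"
    unfolding lessThan_Suc using r(1,2) u(1) w(1) by (subst finsum_insert) auto
  also have "(\<Oplus>i\<in>{..<d}. (u'(d := u)) i \<otimes> (w'(d := w)) i) = (\<Oplus>i\<in>{..<d}. u' i \<otimes> w' i)"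
    using r(1,2) by (intro finsum_cong') auto
  also have "\<dots> = ?e" using rest by (simp add: free_over_idempotent_def)
  also have "u \<otimes> w \<oplus> ?e = e" using u(1) w(1) e by (simp add: a_minus_def a_comm[of e] a_assoc[symmetric] r_neg)
  finally have sum: "(\<Oplus>i\<in>{..<Suc d}. (u'(d := u)) i \<otimes> (w'(d := w)) i) = e" .
  show ?thesis
    unfolding free_over_idempotent_def
  proof (intro conjI allI impI sum)
    fix i j assume ij: "i < Suc d" "j < Suc d"
    show "(w'(d := w)) i \<otimes> (u'(d := u)) j = (if i = j then f else \<zero>)"
      using ij rest wu wu' by (cases "i < d"; cases "j < d") (auto simp: free_over_idempotent_def less_Suc_eq)
  qed (use r eu' u w in \<open>auto simp: less_Suc_eq\<close>)
qed

text \<open>Suppose that some \<open>e R\<close> is not a power of \<open>f R\<close>, and let \<open>R e\<close> be minimal among the left ideals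
  generated by such idempotents.  The two-sided ideal generated by \<open>f\<close> is \<open>R\<close>, so there are
  \<open>u \<in> e R f\<close> and \<open>w \<in> f R e\<close> with \<open>w u = f\<close>.  Then \<open>e - u w\<close> is an idempotent of the same kind, and its
  left ideal is strictly smaller.\<close>

lemma simple_artinian_free_over_idempotent:
  fixes R (structure)
  assumes sa: "simple_artinian R"
  obtains f where "f \<in> carrier R" "f \<noteq> \<zero>" "f \<otimes> f = f"
    "\<And>e. \<lbrakk>e \<in> carrier R; e \<otimes> e = e\<rbrakk> \<Longrightarrow> \<exists>d u w. free_over_idempotent R f e d u w"
proof -
  interpret ring R using sa by (simp add: simple_artinian_def)
  have simp: "\<And>I. ideal I R \<Longrightarrow> I = {\<zero>} \<or> I = carrier R"
    and art: "left_artinian R" using sa by (auto simp: simple_artinian_def)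
  obtain f where f: "f \<in> carrier R" "f \<noteq> \<zero>" "f \<otimes> f = f"
    "\<And>b. \<lbrakk>b \<in> carrier R; f \<otimes> b \<otimes> f = b; b \<noteq> \<zero>\<rbrakk> \<Longrightarrow> \<exists>c \<in> carrier R. c \<otimes> b = f"
    using simple_artinian_primitive_idempotent[OF sa] by metis
  have left: "\<exists>y \<in> carrier R. x \<otimes> y \<otimes> f \<noteq> \<zero>" if x: "x \<in> carrier R" "x \<noteq> \<zero>" for x
  proof (rule ccontr)
    assume neg: "\<not> ?thesis"
    let ?W = "{x \<in> carrier R. \<forall>y \<in> carrier R. x \<otimes> y \<otimes> f = \<zero>}"
    have "ideal ?W R"
    proof (rule two_sided_idealI)
      fix a x assume a: "a \<in> carrier R" "x \<in> ?W"
      have "a \<otimes> x \<otimes> y \<otimes> f = a \<otimes> (x \<otimes> y \<otimes> f)" "x \<otimes> a \<otimes> y \<otimes> f = x \<otimes> (a \<otimes> y) \<otimes> f"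
        if "y \<in> carrier R" for y using a f(1) that by (simp_all add: m_assoc)
      then show "a \<otimes> x \<in> ?W" "x \<otimes> a \<in> ?W" using a by simp_all
    qed (use f(1) in \<open>auto simp: l_distr\<close>)
    moreover have "x \<in> ?W" using neg x by blast
    ultimately have "\<one> \<in> ?W" using simp[of ?W] x by blast
    then have "\<one> \<otimes> \<one> \<otimes> f = \<zero>" by blast
    then show False using f by simp
  qed
  have right: "\<exists>y \<in> carrier R. f \<otimes> y \<otimes> x \<noteq> \<zero>" if x: "x \<in> carrier R" "x \<noteq> \<zero>" for x
  proof (rule ccontr)
    assume neg: "\<not> ?thesis"
    let ?W = "{x \<in> carrier R. \<forall>y \<in> carrier R. f \<otimes> y \<otimes> x = \<zero>}"
    have "ideal ?W R"
    proof (rule two_sided_idealI)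
      fix a x assume a: "a \<in> carrier R" "x \<in> ?W"
      have "f \<otimes> y \<otimes> (a \<otimes> x) = f \<otimes> (y \<otimes> a) \<otimes> x" "f \<otimes> y \<otimes> (x \<otimes> a) = (f \<otimes> y \<otimes> x) \<otimes> a"
        if "y \<in> carrier R" for y using a f(1) that by (simp_all add: m_assoc)
      then show "a \<otimes> x \<in> ?W" "x \<otimes> a \<in> ?W" using a by simp_all
    qed (use f(1) in \<open>auto simp: r_distr\<close>)
    moreover have "x \<in> ?W" using neg x by blast
    ultimately have "\<one> \<in> ?W" using simp[of ?W] x by blast
    then have "f \<otimes> \<one> \<otimes> \<one> = \<zero>" by blast
    then show False using f by simp
  qed
  have "\<exists>d u w. free_over_idempotent R f e d u w" if e: "e \<in> carrier R" "e \<otimes> e = e" for e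
  proof (rule ccontr)
    assume neg: "\<not> ?thesis"
    define Q where "Q = (\<lambda>e. e \<in> carrier R \<and> e \<otimes> e = e \<and> \<not> (\<exists>d u w. free_over_idempotent R f e d u w))"
    define F where "F = {I. \<exists>e. Q e \<and> I = (\<lambda>a. a \<otimes> e) ` carrier R}"
    have "(\<lambda>a. a \<otimes> e) ` carrier R \<in> F" unfolding F_def Q_def using e neg by blast
    then have "\<exists>I \<in> F. \<forall>J \<in> F. J \<subseteq> I \<longrightarrow> J = I"
      by (rule left_artinian_minimal[OF art]) (use left_ideal_principal in \<open>auto simp: F_def Q_def\<close>)
    then obtain I where I: "I \<in> F" "\<And>J. \<lbrakk>J \<in> F; J \<subseteq> I\<rbrakk> \<Longrightarrow> J = I" by blast
    from I(1) obtain e where Qe: "Q e" and Ie: "I = (\<lambda>a. a \<otimes> e) ` carrier R" by (auto simp: F_def)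
    from Qe have e: "e \<in> carrier R" "e \<otimes> e = e" "\<And>d u w. \<not> free_over_idempotent R f e d u w"
      by (auto simp: Q_def)
    have "free_over_idempotent R f \<zero> 0 (\<lambda>_. \<zero>) (\<lambda>_. \<zero>)" by (simp add: free_over_idempotent_def)
    then have "e \<noteq> \<zero>" using e(3) by blast
    then obtain y where y: "y \<in> carrier R" "e \<otimes> y \<otimes> f \<noteq> \<zero>" using left[OF e(1)] by blast
    define u where "u = e \<otimes> y \<otimes> f"
    have u: "u \<in> carrier R" "e \<otimes> u = u" "u \<otimes> f = u" "u \<noteq> \<zero>"
      unfolding u_def using e f y by (simp_all add: m_assoc[symmetric]) (simp add: m_assoc)
    obtain z where z: "z \<in> carrier R" "f \<otimes> z \<otimes> u \<noteq> \<zero>" using right[OF u(1,4)] by blast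
    have "f \<otimes> (f \<otimes> z \<otimes> u) \<otimes> f = f \<otimes> z \<otimes> u"
      using f z u(1,3) by (simp add: m_assoc) (simp add: m_assoc[symmetric])
    then obtain c where c: "c \<in> carrier R" "c \<otimes> (f \<otimes> z \<otimes> u) = f"
      using f(4)[of "f \<otimes> z \<otimes> u"] z u(1) f(1) by auto
    define w where "w = f \<otimes> c \<otimes> f \<otimes> z \<otimes> e"
    have w: "w \<in> carrier R" "w \<otimes> e = w" "f \<otimes> w = w"
    proof -
      show "w \<in> carrier R" unfolding w_def using e f c z by simp
      show "w \<otimes> e = w" unfolding w_def using e f c z by (simp add: m_assoc)
      have "f \<otimes> w = (f \<otimes> f) \<otimes> (c \<otimes> f \<otimes> z \<otimes> e)" unfolding w_def using e(1) f(1) c z by (simp add: m_assoc)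
      then show "f \<otimes> w = w" unfolding w_def using e(1) f(1,3) c z by (simp add: m_assoc)
    qed
    have "w \<otimes> u = f \<otimes> (c \<otimes> (f \<otimes> z \<otimes> u))"
      unfolding w_def using e f(1) c z u(1,2) by (simp add: m_assoc)
    then have wu: "w \<otimes> u = f" using c f by simp
    let ?e = "e \<ominus> u \<otimes> w"
    have eR: "?e \<in> carrier R" using e u w by simp
    have wuw: "w \<otimes> (u \<otimes> w) = w" using wu w u by (simp add: m_assoc[symmetric])
    have ee: "e \<otimes> ?e = ?e" "?e \<otimes> e = ?e"
    proof -
      have "e \<otimes> (u \<otimes> w) = u \<otimes> w" using e(1) u w by (simp add: m_assoc[symmetric])
      moreover have "(u \<otimes> w) \<otimes> e = u \<otimes> w" using e(1) u w by (simp add: m_assoc)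
      ultimately show "e \<otimes> ?e = ?e" "?e \<otimes> e = ?e"
        using e(1,2) u w by (simp_all add: a_minus_def r_distr l_distr r_minus l_minus)
    qed
    have uwe: "(u \<otimes> w) \<otimes> ?e = \<zero>"
    proof -
      have "w \<otimes> ?e = \<zero>" using w u e wuw by (simp add: a_minus_def r_distr r_minus r_neg)
      then show ?thesis using u w eR by (simp add: m_assoc)
    qed
    have idem: "?e \<otimes> ?e = ?e"
    proof -
      have "(e \<ominus> x) \<otimes> y = e \<otimes> y \<ominus> x \<otimes> y" if "x \<in> carrier R" "y \<in> carrier R" for x y
        using e(1) that by (simp add: a_minus_def l_distr l_minus)
      then have "?e \<otimes> ?e = e \<otimes> ?e \<ominus> (u \<otimes> w) \<otimes> ?e" using eR u(1) w(1) by blast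
      then show ?thesis using ee(1) uwe eR by (simp add: a_minus_def)
    qed
    have no: "\<not> (\<exists>d u w. free_over_idempotent R f ?e d u w)"
      using free_over_idempotent_extend[OF f(1) e(1) u(1-3) w wu] e(3) by blast
    let ?J = "(\<lambda>a. a \<otimes> ?e) ` carrier R"
    have "?J \<in> F" unfolding F_def Q_def using eR idem no by blast
    moreover have "?J \<subseteq> I"
    proof
      fix x assume "x \<in> ?J"
      then obtain a where a: "a \<in> carrier R" "x = a \<otimes> ?e" by blast
      then have "x = (a \<otimes> ?e) \<otimes> e" using eR e(1) ee(2) by (simp add: m_assoc)
      then show "x \<in> I" unfolding Ie using a eR by blast
    qed
    ultimately have "?J = I" by (rule I(2))
    moreover have "e \<in> I" unfolding Ie using e by (intro image_eqI[of _ _ e]) auto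
    ultimately obtain a where a: "a \<in> carrier R" "e = a \<otimes> ?e" by blast
    have euw: "?e \<otimes> (u \<otimes> w) = \<zero>"
    proof -
      have "?e \<otimes> u = \<zero>"
      proof -
        have "(u \<otimes> w) \<otimes> u = u" using wu u w by (simp add: m_assoc)
        then show ?thesis using w u e by (simp add: a_minus_def l_distr l_minus r_neg)
      qed
      then show ?thesis using u(1) w(1) eR by (simp add: m_assoc[symmetric])
    qed
    have "u \<otimes> w = e \<otimes> (u \<otimes> w)" using e(1) u w by (simp add: m_assoc[symmetric])
    also have "\<dots> = (a \<otimes> ?e) \<otimes> (u \<otimes> w)" using a(2) by simp
    also have "\<dots> = \<zero>" using euw a(1) eR u(1) w(1) by (simp add: m_assoc)
    finally have "u \<otimes> w = \<zero>" .
    then have "w \<otimes> u \<otimes> (w \<otimes> u) = \<zero>" using u(1) w(1) by (simp add: m_assoc) (metis m_assoc l_null r_null)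
    then show False using wu f by simp
  qed
  then show thesis using that f by blast
qed

section \<open>Separating maximal ideals of an h-local domain\<close>

lemma (in cring) prime_ideal_avoiding:
  assumes S: "submonoid S R" and H: "ideal H R" "H \<inter> S = {}"
  obtains P where "primeideal P R" "H \<subseteq> P" "P \<inter> S = {}"
proof -
  note Sc = S_closed[OF S]
  obtain M where M: "left_ideal M R" "H \<subseteq> M" "M \<inter> S = {}"
    "\<And>M'. \<lbrakk>left_ideal M' R; M \<subseteq> M'; M' \<inter> S = {}\<rbrakk> \<Longrightarrow> M' = M"
    using left_ideal_maximal_disjoint[OF ideal_imp_left_ideal[OF H(1)] H(2)] by metis
  note Md = left_idealD[OF M(1)]
  have meet: "\<exists>x \<in> carrier R. \<exists>s \<in> S. \<exists>m \<in> M. s = m \<oplus> x \<otimes> a" if a: "a \<in> carrier R" "a \<notin> M" for a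
  proof -
    note pr = left_ideal_principal[OF a(1)]
    let ?K = "{h \<oplus> k | h k. h \<in> M \<and> k \<in> (\<lambda>x. x \<otimes> a) ` carrier R}"
    have "\<one> \<otimes> a \<in> (\<lambda>x. x \<otimes> a) ` carrier R" by blast
    then have "a \<in> ?K" using left_ideal_sum_upper(2)[OF M(1) pr] a(1) by (auto simp del: image_iff)
    then have "?K \<noteq> M" using a(2) by blast
    then have "?K \<inter> S \<noteq> {}"
      using M(4)[OF left_ideal_sum[OF M(1) pr] left_ideal_sum_upper(1)[OF M(1) pr]] by blast
    then show ?thesis by blast
  qed
  have "primeideal M R"
  proof (rule primeidealI[OF left_ideal_imp_ideal[OF M(1)] is_cring])
    show "carrier R \<noteq> M" using M(3) Sc(1,2) by blast
    fix a b assume ab: "a \<in> carrier R" "b \<in> carrier R" "a \<otimes> b \<in> M"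
    show "a \<in> M \<or> b \<in> M"
    proof (rule ccontr)
      assume neg: "\<not> (a \<in> M \<or> b \<in> M)"
      obtain x s m where x: "x \<in> carrier R" "s \<in> S" "m \<in> M" "s = m \<oplus> x \<otimes> a" using meet ab(1) neg by blast
      obtain y t n where y: "y \<in> carrier R" "t \<in> S" "n \<in> M" "t = n \<oplus> y \<otimes> b" using meet ab(2) neg by blast
      have c: "m \<in> carrier R" "n \<in> carrier R" using x y Md(1) by auto
      have "s \<otimes> t = t \<otimes> m \<oplus> ((x \<otimes> a) \<otimes> n \<oplus> (x \<otimes> y) \<otimes> (a \<otimes> b))"
        unfolding x(4) y(4) using c x(1) y(1) ab(1,2) by algebra
      moreover have "\<dots> \<in> M"
        using Md(3,4) x(1,3) y(1,3) ab Sc(1)[OF y(2)] by simp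
      ultimately show False using M(3) Sc(3)[OF x(2) y(2)] by auto
    qed
  qed
  then show thesis using that M(2,3) by blast
qed

lemma (in cring) maximalideal_complement:
  assumes "maximalideal m R"
  shows "submonoid (carrier R - m) R" "\<zero> \<in> m" "m \<subseteq> carrier R"
proof -
  interpret m: primeideal m R by (rule maximalideal_prime[OF assms])
  have "\<one> \<notin> m" using m.I_notcarr m.one_imp_carrier by blast
  then show "submonoid (carrier R - m) R"
    by unfold_locales (use m.I_prime in auto)
  show "\<zero> \<in> m" "m \<subseteq> carrier R" using m.Icarr by auto
qed

text \<open>If no such product existed, a prime ideal containing \<open>b\<close> would avoid all of them, and hence
  lie in both maximal ideals.\<close>

lemma h_local_two_maximal_ideals:
  fixes R (structure)
  assumes h: "h_local_domain R" and b: "b \<in> carrier R" "b \<noteq> \<zero>"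
    and m: "maximalideal m R" "maximalideal m' R" "m \<noteq> m'"
  obtains s t y where "s \<in> carrier R - m" "t \<in> carrier R - m'" "y \<in> carrier R" "s \<otimes> t = b \<otimes> y"
proof -
  interpret domain R using h by (simp add: h_local_domain_def)
  note Sm = S_closed[OF maximalideal_complement(1)[OF m(1)]]
    and Sm' = S_closed[OF maximalideal_complement(1)[OF m(2)]]
  let ?S = "{s \<otimes> t | s t. s \<in> carrier R - m \<and> t \<in> carrier R - m'}"
  have S: "submonoid ?S R"
  proof (unfold_locales)
    show "?S \<subseteq> carrier R" by auto
    show "\<one> \<in> ?S" using Sm(2) Sm'(2) r_one[OF one_closed] by (metis (mono_tags, lifting) mem_Collect_eq)
    fix x y assume "x \<in> ?S" "y \<in> ?S"
    then obtain s t s' t' where *: "x = s \<otimes> t" "y = s' \<otimes> t'" "s \<in> carrier R - m" "s' \<in> carrier R - m"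
      "t \<in> carrier R - m'" "t' \<in> carrier R - m'" by blast
    have "x \<otimes> y = (s \<otimes> s') \<otimes> (t \<otimes> t')" using * by (simp add: m_ac)
    then show "x \<otimes> y \<in> ?S" using Sm(3)[OF *(3,4)] Sm'(3)[OF *(5,6)] by blast
  qed
  let ?b = "(\<lambda>y. y \<otimes> b) ` carrier R"
  have "?b \<inter> ?S \<noteq> {}"
  proof
    assume disj: "?b \<inter> ?S = {}"
    obtain P where P: "primeideal P R" "?b \<subseteq> P" "P \<inter> ?S = {}"
      by (rule prime_ideal_avoiding[OF S left_ideal_imp_ideal[OF left_ideal_principal[OF b(1)]] disj]) (rule that)
    have Pc: "x \<in> carrier R" if "x \<in> P" for x
      by (rule ideal.Icarr[OF primeideal.axioms(1)[OF P(1)] that])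
    have "\<one> \<otimes> b \<in> P" using P(2) by blast
    then have "P \<noteq> {\<zero>}" using b by auto
    moreover have "P \<subseteq> m"
    proof
      fix x assume x: "x \<in> P"
      show "x \<in> m"
      proof (rule ccontr)
        assume "x \<notin> m"
        then have "x \<otimes> \<one> \<in> ?S" using Pc[OF x] Sm'(2) by blast
        then show False using x Pc[OF x] P(3) by auto
      qed
    qed
    moreover have "P \<subseteq> m'"
    proof
      fix x assume x: "x \<in> P"
      show "x \<in> m'"
      proof (rule ccontr)
        assume "x \<notin> m'"
        then have "\<one> \<otimes> x \<in> ?S" using Pc[OF x] Sm(2) by blast
        then show False using x Pc[OF x] P(3) by auto
      qed
    qed
    ultimately show False using h P(1) m unfolding h_local_domain_def by blast
  qed
  then obtain x where x: "x \<in> ?b" "x \<in> ?S" by blast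
  from x(1) obtain y where y: "y \<in> carrier R" "x = y \<otimes> b" by (elim imageE)
  from x(2) obtain s t where "s \<in> carrier R - m" "t \<in> carrier R - m'" "x = s \<otimes> t" by blast
  then show thesis using that[of s t y] y b(1) m_comm[of y b] by simp
qed

text \<open>In the localization at \<open>m'\<close>, the element \<open>c\<close> is a multiple of \<open>b\<close>.  This is automatic if \<open>b \<notin> m'\<close>, where
  \<open>t = b\<close> will do; for the finitely many other \<open>m'\<close>, the product of the elements \<open>s\<close> from the preceding
  lemma is taken.\<close>

lemma h_local_separation:
  fixes R (structure)
  assumes h: "h_local_domain R" and b: "b \<in> carrier R" "b \<noteq> \<zero>" and m: "maximalideal m R"
  obtains c where "c \<in> carrier R" "c \<notin> m"
    "\<And>m'. \<lbrakk>maximalideal m' R; m' \<noteq> m\<rbrakk> \<Longrightarrow> \<exists>t \<in> carrier R - m'. \<exists>y \<in> carrier R. t \<otimes> c = b \<otimes> y"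
proof -
  interpret domain R using h by (simp add: h_local_domain_def)
  note Sm = S_closed[OF maximalideal_complement(1)[OF m]]
  have "\<exists>c \<in> carrier R - m. \<forall>m' \<in> F. \<exists>t \<in> carrier R - m'. \<exists>y \<in> carrier R. t \<otimes> c = b \<otimes> y"
    if "finite F" "\<And>m'. m' \<in> F \<Longrightarrow> maximalideal m' R \<and> m' \<noteq> m" for F
    using that
  proof (induction F rule: finite_induct)
    case empty then show ?case using Sm(2) by auto
  next
    case (insert m' F)
    then obtain c where c: "c \<in> carrier R - m"
      "\<And>m'. m' \<in> F \<Longrightarrow> \<exists>t \<in> carrier R - m'. \<exists>y \<in> carrier R. t \<otimes> c = b \<otimes> y" by (metis insertCI)
    have m': "maximalideal m' R" "m \<noteq> m'" using insert.prems by auto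
    obtain s t y where s: "s \<in> carrier R - m" "t \<in> carrier R - m'" "y \<in> carrier R" "s \<otimes> t = b \<otimes> y"
      using h_local_two_maximal_ideals[OF h b m m'] by metis
    have "\<exists>t \<in> carrier R - m''. \<exists>y \<in> carrier R. t \<otimes> (c \<otimes> s) = b \<otimes> y" if m'': "m'' \<in> insert m' F" for m''
    proof (cases "m'' = m'")
      case True
      have "t \<otimes> (c \<otimes> s) = c \<otimes> (s \<otimes> t)" using s c(1) by (simp add: m_ac)
      also have "\<dots> = b \<otimes> (c \<otimes> y)" using s b(1) c(1) by (simp add: m_ac)
      finally show ?thesis using True s(2,3) c(1) by auto
    next
      case False
      then obtain t' y' where t': "t' \<in> carrier R - m''" "y' \<in> carrier R" "t' \<otimes> c = b \<otimes> y'"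
        using c(2) m'' by blast
      have "t' \<otimes> (c \<otimes> s) = (t' \<otimes> c) \<otimes> s" using t'(1) s(1) c(1) by (simp add: m_assoc)
      also have "\<dots> = b \<otimes> (y' \<otimes> s)" unfolding t'(3) using t'(2) s(1) b(1) by (simp add: m_assoc)
      finally show ?thesis using t' s(1) by auto
    qed
    then show ?case using Sm(3)[OF c(1) s(1)] by blast
  qed
  moreover have "finite {m'. maximalideal m' R \<and> b \<in> m' \<and> m' \<noteq> m}"
    using h b unfolding h_local_domain_def by (auto intro: finite_subset[rotated])
  ultimately have "\<exists>c \<in> carrier R - m. \<forall>m' \<in> {m'. maximalideal m' R \<and> b \<in> m' \<and> m' \<noteq> m}.
      \<exists>t \<in> carrier R - m'. \<exists>y \<in> carrier R. t \<otimes> c = b \<otimes> y" by blast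
  then obtain c where c: "c \<in> carrier R - m"
    "\<And>m'. \<lbrakk>maximalideal m' R; m' \<noteq> m; b \<in> m'\<rbrakk> \<Longrightarrow> \<exists>t \<in> carrier R - m'. \<exists>y \<in> carrier R. t \<otimes> c = b \<otimes> y"
    by blast
  have "\<exists>t \<in> carrier R - m'. \<exists>y \<in> carrier R. t \<otimes> c = b \<otimes> y" if "maximalideal m' R" "m' \<noteq> m" for m'
    using c(2)[OF that] c(1) b(1) by (cases "b \<in> m'") auto
  then show thesis using that c(1) by blast
qed

section \<open>Idempotent matrices and finitely generated projective modules\<close>

definition idempotent_matrix :: "('a, 'b) ring_scheme \<Rightarrow> nat \<Rightarrow> (nat \<Rightarrow> nat \<Rightarrow> 'a) \<Rightarrow> bool" where
  "idempotent_matrix R n E \<longleftrightarrow> (\<forall>i<n. \<forall>j<n. E i j \<in> carrier R) \<and>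
     (\<forall>i<n. \<forall>j<n. (\<Oplus>\<^bsub>R\<^esub>k\<in>{..<n}. E i k \<otimes>\<^bsub>R\<^esub> E k j) = E i j)"

definition entries :: "nat \<Rightarrow> (nat \<Rightarrow> nat \<Rightarrow> 'a) \<Rightarrow> 'a set" where
  "entries n E = (\<lambda>(i, j). E i j) ` ({..<n} \<times> {..<n})"

lemma (in abelian_monoid) finsum_mem:
  assumes "H \<subseteq> carrier G" "\<zero> \<in> H" "\<And>x y. \<lbrakk>x \<in> H; y \<in> H\<rbrakk> \<Longrightarrow> x \<oplus> y \<in> H" "\<And>k. k \<in> S \<Longrightarrow> f k \<in> H"
  shows "finsum G f S \<in> H"
  using assms(4)
proof (induction S rule: infinite_finite_induct)
  case (insert k S)
  then have "f k \<in> carrier G" "f \<in> S \<rightarrow> carrier G" using assms(1) by auto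
  then show ?case using insert assms(3) by simp
qed (use assms(2) in auto)

lemma (in ideal) finsum_in_ideal:
  assumes "\<And>k. k \<in> S \<Longrightarrow> f k \<in> I" shows "(\<Oplus>k\<in>S. f k) \<in> I"
  by (rule finsum_mem) (use assms Icarr in auto)

lemma (in left_module) submodule_left_module:
  assumes H: "submodule H R M"
  shows "left_module R (M\<lparr>carrier := H\<rparr>)"
proof -
  note g = submodule.axioms(1)[OF H]
  have sub: "H \<subseteq> carrier M" using subgroup.subset[OF g] by simp
  let ?L = "M\<lparr>carrier := H\<rparr>"
  have "abelian_group ?L"
  proof (rule abelian_groupI)
    fix f assume f: "f \<in> carrier ?L"
    show "\<exists>g\<in>carrier ?L. g \<oplus>\<^bsub>?L\<^esub> f = \<zero>\<^bsub>?L\<^esub>"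
    proof
      show "\<ominus>\<^bsub>M\<^esub> f \<in> carrier ?L" using subgroup.m_inv_closed[OF g] f by (simp add: a_inv_def)
      show "\<ominus>\<^bsub>M\<^esub> f \<oplus>\<^bsub>?L\<^esub> f = \<zero>\<^bsub>?L\<^esub>" using f sub by (auto simp: M.l_neg)
    qed
  next
    show "\<zero>\<^bsub>?L\<^esub> \<in> carrier ?L" using subgroup.one_closed[OF g] by simp
  next
    fix x y assume "x \<in> carrier ?L" "y \<in> carrier ?L"
    then show "x \<oplus>\<^bsub>?L\<^esub> y \<in> carrier ?L" using subgroup.m_closed[OF g] by simp
  qed (use sub in \<open>auto simp: M.a_ac subset_iff\<close>)
  then show ?thesis
    using submodule.smult_closed[OF H] sub
    by (auto simp: left_module_def left_module_axioms_def ring_axioms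
        smult_l_distr smult_r_distr smult_assoc subset_iff)
qed

text \<open>The module is the image of \<open>v \<mapsto> v E\<close>, a direct summand of the free module, and is generated by the
  rows of \<open>E\<close>.  The coordinate functions have the entries of \<open>E\<close> among their values.  Conversely, an
  arbitrary functional \<open>h\<close> satisfies \<open>h (row i) = \<Sum> E i k h (row k)\<close>, since the rows are fixed by \<open>E\<close>.\<close>

lemma (in ring) idempotent_matrix_module:
  assumes E: "idempotent_matrix R n E"
  obtains N :: "('a, nat \<Rightarrow> 'a) module"
  where "projective R N" "finitely_generated R N" "trace_ideal R N = genideal R (entries n E)"
proof -
  let ?F = "free_module R {..<n} :: ('a, nat \<Rightarrow> 'a) module"
  interpret F: left_module R ?F by (rule free_left_module)
  have Ec: "E i j \<in> carrier R" and Ei: "E i j = (\<Oplus>k\<in>{..<n}. E i k \<otimes> E k j)" if "i < n" "j < n" for i j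
    using E that by (auto simp: idempotent_matrix_def)
  define row where "row = (\<lambda>i j. if j < n then E i j else \<zero>)"
  have row: "row i \<in> carrier ?F" if "i < n" for i
  proof -
    have "{j. row i j \<noteq> \<zero>} \<subseteq> {..<n}" by (auto simp: row_def)
    then have "finite {j. row i j \<noteq> \<zero>}" by (rule finite_subset) simp
    then show ?thesis using Ec[OF that] by (auto simp: free_module_carrier row_def)
  qed
  have rowK: "row \<in> {..<n} \<rightarrow> carrier ?F" using row by auto
  let ?g = "lincomb R ?F row"
  have g: "?g \<in> mod_hom R ?F ?F" by (rule F.lincomb_hom[OF rowK])
  have gb: "?g (basis_vec R i) = row i" if "i < n" for i
    using F.lincomb_basis_vec[OF rowK] that by simp
  have bc: "basis_vec R i \<in> carrier ?F" if "i < n" for i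
    using basis_vec_carrier[of i "{..<n}"] that by simp
  have supp: "{k. v k \<noteq> \<zero>} \<subseteq> {..<n}" if "v \<in> carrier ?F" for v
    using that by (auto simp: free_module_carrier simp flip: not_less)
  have expand: "h v = (\<Oplus>k\<in>{..<n}. v k \<otimes> h (basis_vec R k))"
    if "h \<in> mod_hom R ?F (regular_module R)" "v \<in> carrier ?F" for h v
    by (rule functional_on_free[OF that _ supp[OF that(2)]]) auto
  have grow: "?g (row i) = row i" if i: "i < n" for i
  proof
    fix j
    have "(\<lambda>v. ?g v j) \<in> mod_hom R ?F (regular_module R)" by (rule mod_hom_comp[OF g coordinate_hom])
    then have "?g (row i) j = (\<Oplus>k\<in>{..<n}. row i k \<otimes> ?g (basis_vec R k) j)"
      using expand row[OF i] by blast
    also have "\<dots> = (\<Oplus>k\<in>{..<n}. E i k \<otimes> row k j)"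
    proof (rule finsum_cong')
      show "(\<lambda>k. E i k \<otimes> row k j) \<in> {..<n} \<rightarrow> carrier R" using Ec i by (auto simp: row_def)
      show "row i k \<otimes> ?g (basis_vec R k) j = E i k \<otimes> row k j" if "k \<in> {..<n}" for k
        using that gb[of k] row_def by simp
    qed simp
    also have "\<dots> = row i j"
    proof (cases "j < n")
      case True then show ?thesis using Ei[OF i True] by (simp add: row_def)
    next
      case False
      have "(\<Oplus>k\<in>{..<n}. E i k \<otimes> row k j) = (\<Oplus>k\<in>{..<n}. \<zero>)"
        using False Ec i by (intro finsum_cong') (auto simp: row_def)
      then show ?thesis using False by (simp add: row_def)
    qed
    finally show "?g (row i) j = row i j" .
  qed
  have gg: "?g (?g v) = ?g v" if v: "v \<in> carrier ?F" for v
    using F.free_module_hom_eq[OF mod_hom_comp[OF g g] g _ v] gb grow by simp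
  define N where "N = ?F\<lparr>carrier := ?g ` carrier ?F\<rparr>"
  have Ns: "carrier N = ?g ` carrier ?F" "x \<oplus>\<^bsub>N\<^esub> y = x \<oplus>\<^bsub>?F\<^esub> y" "a \<odot>\<^bsub>N\<^esub> x = a \<odot>\<^bsub>?F\<^esub> x" "\<zero>\<^bsub>N\<^esub> = \<zero>\<^bsub>?F\<^esub>" for a x y
    by (simp_all add: N_def)
  have NF: "carrier N \<subseteq> carrier ?F" using mod_homD(1)[OF g] Ns(1) by auto
  have gN: "?g v = v" if "v \<in> carrier N" for v using that gg by (auto simp: Ns(1))
  have N: "left_module R N"
    unfolding N_def by (rule F.submodule_left_module[OF F.hom_image_submodule[OF F.left_module_axioms g]])
  interpret N: left_module R N by (rule N)
  have incl: "(\<lambda>v. v) \<in> mod_hom R N ?F" using NF by (auto simp: mod_hom_def Ns)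
  have gN': "?g \<in> mod_hom R ?F N" using g by (auto simp: mod_hom_def Ns)
  have "summand_of R N ?F"
    unfolding summand_of_def by (rule bexI[OF _ incl], rule bexI[OF _ gN']) (simp add: gN)
  then have proj: "projective R N" by (rule projectiveI[OF N])
  have rowN: "row i \<in> carrier N" if "i < n" for i
    unfolding Ns(1) using gb[OF that] bc[OF that] by (intro image_eqI[of _ _ "basis_vec R i"]) auto
  have fg: "finitely_generated R N"
    unfolding finitely_generated_def
  proof (intro exI conjI)
    show "row ` {..<n} \<subseteq> carrier N" using rowN by auto
    show "finite (row ` {..<n})" by simp
    have "carrier N \<subseteq> H" if H: "submodule H R N" "row ` {..<n} \<subseteq> H" for H
    proof
      fix v assume v: "v \<in> carrier N"
      then have vF: "v \<in> carrier ?F" using NF by blast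
      note gH = submodule.axioms(1)[OF H(1)]
      have "v = ?g v" using gN[OF v] by simp
      also have "?g v = finsum ?F (\<lambda>k. v k \<odot>\<^bsub>?F\<^esub> row k) {..<n}"
        by (rule F.lincomb_superset[OF vF rowK _ supp[OF vF]]) auto
      also have "\<dots> \<in> H"
      proof (rule F.M.finsum_mem)
        show "H \<subseteq> carrier ?F" using subgroup.subset[OF gH] NF by auto
        show "\<zero>\<^bsub>?F\<^esub> \<in> H" using subgroup.one_closed[OF gH] by (simp add: Ns)
        show "x \<oplus>\<^bsub>?F\<^esub> y \<in> H" if "x \<in> H" "y \<in> H" for x y
          using subgroup.m_closed[OF gH that] by (simp add: Ns)
        show "v k \<odot>\<^bsub>?F\<^esub> row k \<in> H" if "k \<in> {..<n}" for k
          using submodule.smult_closed[OF H(1), of "v k" "row k"] H(2) that vF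
          by (auto simp: Ns free_module_carrier)
      qed
      finally show "v \<in> H" .
    qed
    then show "mod_span R N (row ` {..<n}) = carrier N" by (auto simp: mod_span_def)
  qed
  have ent: "entries n E \<subseteq> carrier R" using Ec by (auto simp: entries_def)
  interpret I: ideal "genideal R (entries n E)" R by (rule genideal_ideal[OF ent])
  have EI: "E i j \<in> genideal R (entries n E)" if "i < n" "j < n" for i j
    using genideal_self[OF ent] that by (auto simp: entries_def)
  have "trace_ideal R N \<subseteq> genideal R (entries n E)"
  proof (rule trace_ideal_subset[OF N I.is_ideal])
    fix h v assume h: "h \<in> mod_hom R N (regular_module R)" and v: "v \<in> carrier N"
    have hg: "(\<lambda>v. h (?g v)) \<in> mod_hom R ?F (regular_module R)" by (rule mod_hom_comp[OF gN' h])
    have hr: "h (row k) \<in> carrier R" if "k < n" for k using mod_homD(1)[OF h rowN[OF that]] by simp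
    have "h (row i) \<in> genideal R (entries n E)" if i: "i < n" for i
    proof -
      have "h (row i) = (\<Oplus>k\<in>{..<n}. row i k \<otimes> h (?g (basis_vec R k)))"
        using expand[OF hg row[OF i]] grow[OF i] by simp
      also have "\<dots> \<in> genideal R (entries n E)"
      proof (rule I.finsum_in_ideal)
        fix k assume k: "k \<in> {..<n}"
        then have "row i k \<in> genideal R (entries n E)" using EI[OF i] by (simp add: row_def)
        moreover have "h (?g (basis_vec R k)) \<in> carrier R" using hr k by (simp add: gb)
        ultimately show "row i k \<otimes> h (?g (basis_vec R k)) \<in> genideal R (entries n E)"
          by (rule I.I_r_closed)
      qed
      finally show ?thesis .
    qed
    moreover have "h (?g v) = (\<Oplus>k\<in>{..<n}. v k \<otimes> h (?g (basis_vec R k)))"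
      by (rule expand[OF hg subsetD[OF NF v]])
    then have "h v = (\<Oplus>k\<in>{..<n}. v k \<otimes> h (?g (basis_vec R k)))" by (simp only: gN[OF v])
    moreover have "v k \<in> carrier R" for k using v NF by (auto simp: free_module_carrier)
    ultimately show "h v \<in> genideal R (entries n E)"
      by (auto simp: gb intro!: I.finsum_in_ideal I.I_l_closed)
  qed
  moreover have "genideal R (entries n E) \<subseteq> trace_ideal R N"
  proof (rule genideal_minimal[OF trace_ideal_closed(2)[OF N]])
    show "entries n E \<subseteq> trace_ideal R N"
    proof
      fix x assume "x \<in> entries n E"
      then obtain i j where ij: "i < n" "j < n" "x = E i j" by (auto simp: entries_def)
      have "(\<lambda>v. v j) \<in> mod_hom R N (regular_module R)" by (rule mod_hom_comp[OF incl coordinate_hom])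
      from trace_ideal_closed(1)[OF N this rowN[OF ij(1)]] show "x \<in> trace_ideal R N"
        using ij by (simp add: row_def)
    qed
  qed
  ultimately show thesis using that proj fg by blast
qed

lemma ideal_opposite_iff: "ring R \<Longrightarrow> ideal I (opposite R) \<longleftrightarrow> ideal I R"
proof -
  assume R: "ring R"
  interpret R: ring R by (rule R)
  interpret O: ring "opposite R" by (rule R.ring_opposite)
  show ?thesis
  proof
    assume "ideal I R"
    then interpret I: ideal I R .
    show "ideal I (opposite R)"
      by (rule idealI[OF R.ring_opposite])
        (use I.a_subgroup I.I_l_closed I.I_r_closed in \<open>auto simp: subgroup_def opposite_def m_inv_def\<close>)
  next
    assume "ideal I (opposite R)"
    then interpret I: ideal I "opposite R" .
    show "ideal I R"
      by (rule idealI[OF R])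
        (use I.a_subgroup I.I_l_closed I.I_r_closed in \<open>auto simp: subgroup_def opposite_def m_inv_def\<close>)
  qed
qed

lemma genideal_opposite: "ring R \<Longrightarrow> genideal (opposite R) X = genideal R X"
  by (simp add: genideal_def ideal_opposite_iff)

lemma (in ring) finsum_opposite:
  assumes "f \<in> S \<rightarrow> carrier R" shows "finsum (opposite R) f S = finsum R f S"
proof -
  interpret O: ring "opposite R" by (rule ring_opposite)
  show ?thesis using assms
    by (induction S rule: infinite_finite_induct) (auto simp: Pi_iff)
qed

lemma (in ring) idempotent_matrix_opposite:
  assumes "idempotent_matrix R n E"
  shows "idempotent_matrix (opposite R) n (\<lambda>i j. E j i)"
  unfolding idempotent_matrix_def
proof (intro allI impI conjI)
  fix i j assume ij: "i < n" "j < n"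
  show "E j i \<in> carrier (opposite R)" using assms ij by (simp add: idempotent_matrix_def)
  have "(\<Oplus>\<^bsub>opposite R\<^esub>k\<in>{..<n}. E k i \<otimes>\<^bsub>opposite R\<^esub> E j k) = (\<Oplus>k\<in>{..<n}. E j k \<otimes> E k i)"
    using assms ij by (simp, intro finsum_opposite) (auto simp: idempotent_matrix_def)
  then show "(\<Oplus>\<^bsub>opposite R\<^esub>k\<in>{..<n}. E k i \<otimes>\<^bsub>opposite R\<^esub> E j k) = E j i"
    using assms ij by (auto simp: idempotent_matrix_def)
qed

lemma entries_transpose: "entries n (\<lambda>i j. E j i) = entries n E"
  unfolding entries_def by force

section \<open>Ideals in a ring of fractions\<close>

lemma (in ring) Units_opposite: "Units (opposite R) = Units R"
  by (auto simp: Units_def)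

lemma (in ring) minus_opposite:
  assumes "x \<in> carrier R" "y \<in> carrier R"
  shows "x \<ominus>\<^bsub>opposite R\<^esub> y = x \<ominus> y"
proof -
  interpret O: ring "opposite R" by (rule ring_opposite)
  have "\<ominus>\<^bsub>opposite R\<^esub> y = \<ominus> y" using assms by (intro O.minus_equality) (auto simp: l_neg)
  then show ?thesis by (simp add: a_minus_def)
qed

lemma ring_hom_opposite: "h \<in> ring_hom R S \<Longrightarrow> h \<in> ring_hom (opposite R) (opposite S)"
  by (auto simp: ring_hom_def)

sublocale ring_of_fractions \<subseteq> h: ring_hom_ring \<Lambda> T \<iota>
  by (rule ring_hom_ringI2[OF \<Lambda>.ring_axioms T.ring_axioms \<iota>_hom])

context ring_of_fractions
begin

definition scalar :: "'r \<Rightarrow> 't" where "scalar r = \<iota> (r \<odot>\<^bsub>\<Lambda>\<^esub> \<one>\<^bsub>\<Lambda>\<^esub>)"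

lemma scalar_closed [simp]: "r \<in> carrier R \<Longrightarrow> scalar r \<in> carrier T"
  by (simp add: scalar_def)

lemma smult_as_mult:
  assumes "r \<in> carrier R" "x \<in> carrier \<Lambda>"
  shows "r \<odot>\<^bsub>\<Lambda>\<^esub> x = (r \<odot>\<^bsub>\<Lambda>\<^esub> \<one>\<^bsub>\<Lambda>\<^esub>) \<otimes>\<^bsub>\<Lambda>\<^esub> x" "r \<odot>\<^bsub>\<Lambda>\<^esub> x = x \<otimes>\<^bsub>\<Lambda>\<^esub> (r \<odot>\<^bsub>\<Lambda>\<^esub> \<one>\<^bsub>\<Lambda>\<^esub>)"
  using assms by (simp_all add: L.smult_mult_left L.smult_mult_right)

lemma scalar_\<iota>:
  assumes "r \<in> carrier R" "x \<in> carrier \<Lambda>"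
  shows "scalar r \<otimes>\<^bsub>T\<^esub> \<iota> x = \<iota> (r \<odot>\<^bsub>\<Lambda>\<^esub> x)" "\<iota> x \<otimes>\<^bsub>T\<^esub> scalar r = \<iota> (r \<odot>\<^bsub>\<Lambda>\<^esub> x)"
proof -
  have "scalar r \<otimes>\<^bsub>T\<^esub> \<iota> x = \<iota> ((r \<odot>\<^bsub>\<Lambda>\<^esub> \<one>\<^bsub>\<Lambda>\<^esub>) \<otimes>\<^bsub>\<Lambda>\<^esub> x)" "\<iota> x \<otimes>\<^bsub>T\<^esub> scalar r = \<iota> (x \<otimes>\<^bsub>\<Lambda>\<^esub> (r \<odot>\<^bsub>\<Lambda>\<^esub> \<one>\<^bsub>\<Lambda>\<^esub>))"
    using assms by (simp_all add: scalar_def)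
  then show "scalar r \<otimes>\<^bsub>T\<^esub> \<iota> x = \<iota> (r \<odot>\<^bsub>\<Lambda>\<^esub> x)" "\<iota> x \<otimes>\<^bsub>T\<^esub> scalar r = \<iota> (r \<odot>\<^bsub>\<Lambda>\<^esub> x)"
    by (simp_all only: flip: smult_as_mult[OF assms])
qed

lemma scalar_mult: "\<lbrakk>r \<in> carrier R; s \<in> carrier R\<rbrakk> \<Longrightarrow> scalar r \<otimes>\<^bsub>T\<^esub> scalar s = scalar (r \<otimes>\<^bsub>R\<^esub> s)"
  unfolding scalar_def[of s] scalar_def[of "r \<otimes>\<^bsub>R\<^esub> s"] by (simp add: scalar_\<iota> L.smult_assoc1)

lemma scalar_add: "\<lbrakk>r \<in> carrier R; s \<in> carrier R\<rbrakk> \<Longrightarrow> scalar r \<oplus>\<^bsub>T\<^esub> scalar s = scalar (r \<oplus>\<^bsub>R\<^esub> s)"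
  unfolding scalar_def by (simp add: L.smult_l_distr)

lemma scalar_one [simp]: "scalar \<one>\<^bsub>R\<^esub> = \<one>\<^bsub>T\<^esub>" and scalar_zero [simp]: "scalar \<zero>\<^bsub>R\<^esub> = \<zero>\<^bsub>T\<^esub>"
  unfolding scalar_def by simp_all

lemma scalar_unit: "s \<in> S \<Longrightarrow> scalar s \<in> Units T"
  unfolding scalar_def by (rule \<iota>_unit)

lemma S_carrier: "s \<in> S \<Longrightarrow> s \<in> carrier R" "\<one>\<^bsub>R\<^esub> \<in> S" "\<lbrakk>s \<in> S; t \<in> S\<rbrakk> \<Longrightarrow> s \<otimes>\<^bsub>R\<^esub> t \<in> S"
  using R.S_closed[OF S(1)] by auto

lemma scalar_cancel:
  assumes "s \<in> S" "a \<in> carrier T" "b \<in> carrier T" "scalar s \<otimes>\<^bsub>T\<^esub> a = scalar s \<otimes>\<^bsub>T\<^esub> b"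
  shows "a = b"
  using T.Units_l_cancel[OF scalar_unit[OF assms(1)] assms(2,3)] assms(4) by blast

lemma fractionE:
  assumes "t \<in> carrier T"
  obtains s x where "s \<in> S" "x \<in> carrier \<Lambda>" "scalar s \<otimes>\<^bsub>T\<^esub> t = \<iota> x"
  using is_fraction[OF assms] unfolding scalar_def by blast

lemma scalar_central:
  assumes r: "r \<in> carrier R" and t: "t \<in> carrier T"
  shows "scalar r \<otimes>\<^bsub>T\<^esub> t = t \<otimes>\<^bsub>T\<^esub> scalar r"
proof -
  obtain s x where s: "s \<in> S" "x \<in> carrier \<Lambda>" "scalar s \<otimes>\<^bsub>T\<^esub> t = \<iota> x" using fractionE[OF t] .
  have sR: "s \<in> carrier R" by (rule S_carrier(1)[OF s(1)])
  have "scalar s \<otimes>\<^bsub>T\<^esub> (scalar r \<otimes>\<^bsub>T\<^esub> t) = (scalar r \<otimes>\<^bsub>T\<^esub> scalar s) \<otimes>\<^bsub>T\<^esub> t"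
    using r sR t by (simp add: T.m_assoc[symmetric] scalar_mult R.m_comm)
  also have "\<dots> = scalar r \<otimes>\<^bsub>T\<^esub> \<iota> x" using r sR t s(3) by (simp add: T.m_assoc)
  also have "\<dots> = \<iota> x \<otimes>\<^bsub>T\<^esub> scalar r" using r s(2) by (simp add: scalar_\<iota>)
  also have "\<dots> = scalar s \<otimes>\<^bsub>T\<^esub> (t \<otimes>\<^bsub>T\<^esub> scalar r)" using r sR t by (simp add: T.m_assoc flip: s(3))
  finally show ?thesis using scalar_cancel[OF s(1)] r t by simp
qed

lemma \<iota>_eq_iff: "\<lbrakk>x \<in> carrier \<Lambda>; y \<in> carrier \<Lambda>\<rbrakk> \<Longrightarrow> \<iota> x = \<iota> y \<longleftrightarrow> x = y"
  using \<iota>_inj by (auto simp: inj_on_def)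

lemma ideal_smult:
  assumes "ideal X \<Lambda>" "r \<in> carrier R" "x \<in> X" shows "r \<odot>\<^bsub>\<Lambda>\<^esub> x \<in> X"
proof -
  interpret X: ideal X \<Lambda> by fact
  show ?thesis using smult_as_mult(1)[OF assms(2) X.Icarr[OF assms(3)]] X.I_l_closed[OF assms(3)] assms(2)
    by simp
qed

text \<open>The localization of \<open>X\<close> at \<open>U\<close>, as a subset of \<open>T\<close>.  When \<open>T\<close> is \<open>\<Lambda> \<otimes> Q\<close>, the ring \<open>\<Lambda>\<^sub>m\<close> is
  \<open>frac (carrier R - m) (carrier \<Lambda>)\<close>; so all the localizations can be compared inside one ring.\<close>

definition frac :: "'r set \<Rightarrow> 'a set \<Rightarrow> 't set" where
  "frac U X = {t \<in> carrier T. \<exists>s \<in> U. \<exists>x \<in> X. scalar s \<otimes>\<^bsub>T\<^esub> t = \<iota> x}"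

lemma fracI: "\<lbrakk>t \<in> carrier T; s \<in> U; x \<in> X; scalar s \<otimes>\<^bsub>T\<^esub> t = \<iota> x\<rbrakk> \<Longrightarrow> t \<in> frac U X"
  by (auto simp: frac_def)

lemma fracE:
  assumes "t \<in> frac U X"
  obtains s x where "t \<in> carrier T" "s \<in> U" "x \<in> X" "scalar s \<otimes>\<^bsub>T\<^esub> t = \<iota> x"
  using assms by (auto simp: frac_def)

lemma frac_carrier: "t \<in> frac U X \<Longrightarrow> t \<in> carrier T"
  by (auto simp: frac_def)

lemma frac_S_carrier: "frac S (carrier \<Lambda>) = carrier T"
proof
  show "frac S (carrier \<Lambda>) \<subseteq> carrier T" using frac_carrier by blast
  show "carrier T \<subseteq> frac S (carrier \<Lambda>)"
  proof
    fix t assume t: "t \<in> carrier T"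
    obtain s x where "s \<in> S" "x \<in> carrier \<Lambda>" "scalar s \<otimes>\<^bsub>T\<^esub> t = \<iota> x" using fractionE[OF t] .
    then show "t \<in> frac S (carrier \<Lambda>)" by (rule fracI[OF t])
  qed
qed

context
  fixes U assumes U: "submonoid U R"
begin

lemma U_closed: "s \<in> U \<Longrightarrow> s \<in> carrier R" "\<one>\<^bsub>R\<^esub> \<in> U" "\<lbrakk>s \<in> U; t \<in> U\<rbrakk> \<Longrightarrow> s \<otimes>\<^bsub>R\<^esub> t \<in> U"
  using R.S_closed[OF U] by auto

lemma \<iota>_in_frac: "\<lbrakk>x \<in> X; x \<in> carrier \<Lambda>\<rbrakk> \<Longrightarrow> \<iota> x \<in> frac U X"
  by (rule fracI[OF _ U_closed(2)]) auto

lemma frac_mult: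
  assumes a: "a \<in> frac U X" and b: "b \<in> frac U Y" and XY: "X \<subseteq> carrier \<Lambda>" "Y \<subseteq> carrier \<Lambda>"
    and Z: "\<And>x y. \<lbrakk>x \<in> X; y \<in> Y\<rbrakk> \<Longrightarrow> x \<otimes>\<^bsub>\<Lambda>\<^esub> y \<in> Z"
  shows "a \<otimes>\<^bsub>T\<^esub> b \<in> frac U Z"
proof -
  obtain s x where s: "a \<in> carrier T" "s \<in> U" "x \<in> X" "scalar s \<otimes>\<^bsub>T\<^esub> a = \<iota> x" using fracE[OF a] .
  obtain t y where t: "b \<in> carrier T" "t \<in> U" "y \<in> Y" "scalar t \<otimes>\<^bsub>T\<^esub> b = \<iota> y" using fracE[OF b] .
  have c: "s \<in> carrier R" "t \<in> carrier R" "x \<in> carrier \<Lambda>" "y \<in> carrier \<Lambda>" using s t U_closed XY by auto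
  have "scalar (s \<otimes>\<^bsub>R\<^esub> t) \<otimes>\<^bsub>T\<^esub> (a \<otimes>\<^bsub>T\<^esub> b) = scalar s \<otimes>\<^bsub>T\<^esub> (scalar t \<otimes>\<^bsub>T\<^esub> a) \<otimes>\<^bsub>T\<^esub> b"
    using c s(1) t(1) by (simp add: scalar_mult[symmetric] T.m_assoc)
  also have "\<dots> = scalar s \<otimes>\<^bsub>T\<^esub> (a \<otimes>\<^bsub>T\<^esub> scalar t) \<otimes>\<^bsub>T\<^esub> b" using scalar_central[OF c(2) s(1)] by simp
  also have "\<dots> = (scalar s \<otimes>\<^bsub>T\<^esub> a) \<otimes>\<^bsub>T\<^esub> (scalar t \<otimes>\<^bsub>T\<^esub> b)" using c s(1) t(1) by (simp add: T.m_assoc)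
  also have "\<dots> = \<iota> (x \<otimes>\<^bsub>\<Lambda>\<^esub> y)" using s t c by simp
  finally show ?thesis using s t U_closed(3) Z by (intro fracI[of _ "s \<otimes>\<^bsub>R\<^esub> t"]) auto
qed

lemma frac_add:
  assumes a: "a \<in> frac U X" and b: "b \<in> frac U X" and X: "ideal X \<Lambda>"
  shows "a \<oplus>\<^bsub>T\<^esub> b \<in> frac U X"
proof -
  interpret X: ideal X \<Lambda> by (rule X)
  obtain s x where s: "a \<in> carrier T" "s \<in> U" "x \<in> X" "scalar s \<otimes>\<^bsub>T\<^esub> a = \<iota> x" using fracE[OF a] .
  obtain t y where t: "b \<in> carrier T" "t \<in> U" "y \<in> X" "scalar t \<otimes>\<^bsub>T\<^esub> b = \<iota> y" using fracE[OF b] .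
  have c: "s \<in> carrier R" "t \<in> carrier R" "x \<in> carrier \<Lambda>" "y \<in> carrier \<Lambda>" using s t U_closed X.Icarr by auto
  have "scalar (s \<otimes>\<^bsub>R\<^esub> t) \<otimes>\<^bsub>T\<^esub> a = scalar t \<otimes>\<^bsub>T\<^esub> (scalar s \<otimes>\<^bsub>T\<^esub> a)"
    using c s(1) by (simp add: scalar_mult T.m_assoc[symmetric] R.m_comm)
  also have "\<dots> = \<iota> (t \<odot>\<^bsub>\<Lambda>\<^esub> x)" using c s by (simp add: scalar_\<iota>)
  finally have 1: "scalar (s \<otimes>\<^bsub>R\<^esub> t) \<otimes>\<^bsub>T\<^esub> a = \<iota> (t \<odot>\<^bsub>\<Lambda>\<^esub> x)" .
  have "scalar (s \<otimes>\<^bsub>R\<^esub> t) \<otimes>\<^bsub>T\<^esub> b = scalar s \<otimes>\<^bsub>T\<^esub> (scalar t \<otimes>\<^bsub>T\<^esub> b)"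
    using c t(1) by (simp add: scalar_mult T.m_assoc[symmetric])
  also have "\<dots> = \<iota> (s \<odot>\<^bsub>\<Lambda>\<^esub> y)" using c t by (simp add: scalar_\<iota>)
  finally have "scalar (s \<otimes>\<^bsub>R\<^esub> t) \<otimes>\<^bsub>T\<^esub> b = \<iota> (s \<odot>\<^bsub>\<Lambda>\<^esub> y)" .
  with 1 have "scalar (s \<otimes>\<^bsub>R\<^esub> t) \<otimes>\<^bsub>T\<^esub> (a \<oplus>\<^bsub>T\<^esub> b) = \<iota> (t \<odot>\<^bsub>\<Lambda>\<^esub> x \<oplus>\<^bsub>\<Lambda>\<^esub> s \<odot>\<^bsub>\<Lambda>\<^esub> y)"
    using c s(1) t(1) by (simp add: T.r_distr)
  moreover have "t \<odot>\<^bsub>\<Lambda>\<^esub> x \<oplus>\<^bsub>\<Lambda>\<^esub> s \<odot>\<^bsub>\<Lambda>\<^esub> y \<in> X"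
    using ideal_smult[OF X c(2) s(3)] ideal_smult[OF X c(1) t(3)] by (rule X.a_closed)
  ultimately show ?thesis using s t U_closed(3) by (intro fracI[of _ "s \<otimes>\<^bsub>R\<^esub> t"]) auto
qed

lemma zero_in_frac:
  assumes X: "ideal X \<Lambda>"
  shows "\<zero>\<^bsub>T\<^esub> \<in> frac U X"
proof -
  interpret X: ideal X \<Lambda> by (rule X)
  show ?thesis using \<iota>_in_frac[OF X.zero_closed] by simp
qed

lemma frac_finsum:
  assumes X: "ideal X \<Lambda>" and "\<And>k. k \<in> K \<Longrightarrow> g k \<in> frac U X"
  shows "(\<Oplus>\<^bsub>T\<^esub>k\<in>K. g k) \<in> frac U X"
proof (rule T.finsum_mem)
  show "frac U X \<subseteq> carrier T" using frac_carrier by blast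
qed (use zero_in_frac[OF X] frac_add[OF _ _ X] assms(2) in auto)

lemma frac_mult_left:
  assumes "a \<in> frac U (carrier \<Lambda>)" "b \<in> frac U X" and X: "ideal X \<Lambda>"
  shows "a \<otimes>\<^bsub>T\<^esub> b \<in> frac U X"
proof (rule frac_mult[OF assms(1,2)])
  show "X \<subseteq> carrier \<Lambda>" using ideal.Icarr[OF X] by blast
  show "x \<otimes>\<^bsub>\<Lambda>\<^esub> y \<in> X" if "x \<in> carrier \<Lambda>" "y \<in> X" for x y
    by (rule ideal.I_l_closed[OF X that(2,1)])
qed simp

lemma frac_mult_right:
  assumes "a \<in> frac U X" "b \<in> frac U (carrier \<Lambda>)" and X: "ideal X \<Lambda>"
  shows "a \<otimes>\<^bsub>T\<^esub> b \<in> frac U X"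
proof (rule frac_mult[OF assms(1,2)])
  show "X \<subseteq> carrier \<Lambda>" using ideal.Icarr[OF X] by blast
  show "x \<otimes>\<^bsub>\<Lambda>\<^esub> y \<in> X" if "x \<in> X" "y \<in> carrier \<Lambda>" for x y
    by (rule ideal.I_r_closed[OF X that])
qed simp

lemma scalar_in_frac: "r \<in> carrier R \<Longrightarrow> scalar r \<in> frac U (carrier \<Lambda>)"
  unfolding scalar_def by (rule \<iota>_in_frac) simp_all

end

lemma frac_ideal:
  assumes X: "ideal X \<Lambda>" shows "ideal (frac S X) T"
proof (rule T.two_sided_idealI)
  show "frac S X \<subseteq> carrier T" using frac_carrier by blast
  show "\<zero>\<^bsub>T\<^esub> \<in> frac S X" by (rule zero_in_frac[OF S(1) X])
  show "a \<oplus>\<^bsub>T\<^esub> b \<in> frac S X" if "a \<in> frac S X" "b \<in> frac S X" for a b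
    by (rule frac_add[OF S(1) that X])
  show "a \<otimes>\<^bsub>T\<^esub> b \<in> frac S X" "b \<otimes>\<^bsub>T\<^esub> a \<in> frac S X" if "a \<in> carrier T" "b \<in> frac S X" for a b
    using that frac_mult_left[OF S(1) _ _ X] frac_mult_right[OF S(1) _ _ X] by (simp_all add: frac_S_carrier)
qed

text \<open>The idempotent \<open>e\<close> of the semiperfect ring \<open>T\<close> that generates the extension of \<open>I\<close> modulo the
  Jacobson radical generates it outright: a trace ideal inside \<open>J + K\<close> lies in \<open>K\<close>.  Writing
  \<open>e = x/s\<close> turns this into a statement about elements of \<open>\<Lambda>\<close>, which can be transported from \<open>\<Lambda>\<^sub>m\<close> to
  \<open>\<Lambda> \<otimes> Q\<close>.\<close>

lemma semiperfect_trace_generator: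
  fixes M :: "('a, 'm) module"
  assumes sp: "semiperfect T" and I: "ideal I \<Lambda>"
    and tr: "(projective (opposite \<Lambda>) M \<and> trace_ideal (opposite \<Lambda>) M = I) \<or>
      (projective \<Lambda> M \<and> trace_ideal \<Lambda> M = I)"
  obtains x s where "x \<in> I" "s \<in> S" "x \<otimes>\<^bsub>\<Lambda>\<^esub> x = s \<odot>\<^bsub>\<Lambda>\<^esub> x"
    "\<And>z. z \<in> I \<Longrightarrow> \<exists>t \<in> S. t \<odot>\<^bsub>\<Lambda>\<^esub> z \<in> genideal \<Lambda> {x}"
proof -
  interpret I: ideal I \<Lambda> by (rule I)
  let ?J = "jacobson_radical T"
  have J: "ideal ?J T" by (rule T.jacobson_radical_ideal)
  interpret J: ideal ?J T by (rule J)
  obtain e where e: "e \<in> frac S I" "e \<otimes>\<^bsub>T\<^esub> e = e" "\<And>z. z \<in> frac S I \<Longrightarrow> z \<ominus>\<^bsub>T\<^esub> z \<otimes>\<^bsub>T\<^esub> e \<in> ?J"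
    by (rule semiperfect_ideal_idempotent[OF sp frac_ideal[OF I]]) (rule that)
  obtain s x where s: "e \<in> carrier T" "s \<in> S" "x \<in> I" "scalar s \<otimes>\<^bsub>T\<^esub> e = \<iota> x" using fracE[OF e(1)] .
  have c: "s \<in> carrier R" "x \<in> carrier \<Lambda>" using s S_carrier I.Icarr by auto
  have "\<iota> (x \<otimes>\<^bsub>\<Lambda>\<^esub> x) = scalar s \<otimes>\<^bsub>T\<^esub> (e \<otimes>\<^bsub>T\<^esub> scalar s) \<otimes>\<^bsub>T\<^esub> e" using c s by (simp add: T.m_assoc flip: s(4))
  also have "\<dots> = scalar s \<otimes>\<^bsub>T\<^esub> (scalar s \<otimes>\<^bsub>T\<^esub> (e \<otimes>\<^bsub>T\<^esub> e))"
    using c s(1) by (simp add: T.m_assoc flip: scalar_central)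
  also have "\<dots> = \<iota> (s \<odot>\<^bsub>\<Lambda>\<^esub> x)" using c e(2) s(4) by (simp add: scalar_\<iota>)
  finally have xx: "x \<otimes>\<^bsub>\<Lambda>\<^esub> x = s \<odot>\<^bsub>\<Lambda>\<^esub> x" by (subst (asm) \<iota>_eq_iff) (use c in auto)
  let ?x = "genideal \<Lambda> {x}" and ?K = "frac S (genideal \<Lambda> {x})"
  have gx: "ideal ?x \<Lambda>" using c by (intro \<Lambda>.genideal_ideal) auto
  have K: "ideal ?K T" by (rule frac_ideal[OF gx])
  interpret K: ideal ?K T by (rule K)
  have eK: "e \<in> ?K" using s \<Lambda>.genideal_self'[OF c(2)] by (intro fracI) auto
  have JK: "\<exists>b \<in> ?J. \<iota> z \<ominus>\<^bsub>T\<^esub> b \<in> ?K" if z: "z \<in> I" for z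
  proof -
    have zc: "\<iota> z \<in> carrier T" using I.Icarr[OF z] by simp
    have "\<iota> z \<ominus>\<^bsub>T\<^esub> (\<iota> z \<ominus>\<^bsub>T\<^esub> \<iota> z \<otimes>\<^bsub>T\<^esub> e) = \<iota> z \<otimes>\<^bsub>T\<^esub> e"
      using zc s(1) by (simp add: a_minus_def T.minus_add T.a_assoc[symmetric] T.r_neg)
    then have "\<iota> z \<ominus>\<^bsub>T\<^esub> (\<iota> z \<ominus>\<^bsub>T\<^esub> \<iota> z \<otimes>\<^bsub>T\<^esub> e) \<in> ?K" using K.I_l_closed[OF eK zc] by simp
    then show ?thesis using e(3)[OF \<iota>_in_frac[OF S(1) z I.Icarr[OF z]]] by blast
  qed
  have zK: "\<iota> z \<in> ?K" if z: "z \<in> I" for z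
    using tr
  proof
    assume M: "projective \<Lambda> M \<and> trace_ideal \<Lambda> M = I"
    then show ?thesis
      using projective_trace_image_subset[OF conjunct1[OF M] T.ring_axioms \<iota>_hom J T.jacobson_radical_unit K, of z] JK z
      by simp
  next
    assume M: "projective (opposite \<Lambda>) M \<and> trace_ideal (opposite \<Lambda>) M = I"
    show ?thesis
    proof (rule projective_trace_image_subset[OF conjunct1[OF M] T.ring_opposite ring_hom_opposite[OF \<iota>_hom]])
      show "ideal ?J (opposite T)" "ideal ?K (opposite T)" using J K by (simp_all add: ideal_opposite_iff T.ring_axioms)
      show "z \<in> trace_ideal (opposite \<Lambda>) M" using M z by simp
      show "\<one>\<^bsub>opposite T\<^esub> \<ominus>\<^bsub>opposite T\<^esub> j \<in> Units (opposite T)" if "j \<in> ?J" for j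
        using T.jacobson_radical_unit[OF that] J.Icarr[OF that] by (simp add: T.Units_opposite T.minus_opposite)
      show "\<exists>b \<in> ?J. \<iota> z \<ominus>\<^bsub>opposite T\<^esub> b \<in> ?K" if "z \<in> trace_ideal (opposite \<Lambda>) M" for z
        using JK[of z] M that I.Icarr J.Icarr by (auto simp: T.minus_opposite)
    qed
  qed
  have "\<exists>t \<in> S. t \<odot>\<^bsub>\<Lambda>\<^esub> z \<in> ?x" if z: "z \<in> I" for z
  proof -
    obtain t y where t: "t \<in> S" "y \<in> ?x" "scalar t \<otimes>\<^bsub>T\<^esub> \<iota> z = \<iota> y" using fracE[OF zK[OF z]] .
    then have "t \<odot>\<^bsub>\<Lambda>\<^esub> z = y"
      using scalar_\<iota>(1)[OF S_carrier(1)[OF t(1)] I.Icarr[OF z]] I.Icarr[OF z] S_carrier(1)[OF t(1)] ideal.Icarr[OF gx t(2)]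
      by (simp add: \<iota>_eq_iff)
    then show ?thesis using t by blast
  qed
  then show thesis using that s xx by blast
qed

end

section \<open>Powers of a module that is free over an idempotent\<close>

lemma (in ring) finsum_single:
  assumes "finite S" "i \<in> S" "x \<in> carrier R" "\<And>j. j \<in> S \<Longrightarrow> g j = (if j = i then x else \<zero>)"
  shows "(\<Oplus>j\<in>S. g j) = x"
proof -
  have "(\<Oplus>j\<in>S. g j) = (\<Oplus>j\<in>S. if i = j then x else \<zero>)"
    using assms(3,4) by (intro finsum_cong') auto
  also have "\<dots> = x"
    using add.finprod_singleton[OF assms(2,1), of "\<lambda>_. x"] assms(3) by simp
  finally show ?thesis .
qed

text \<open>If \<open>e R\<close> is isomorphic to \<open>(f R)\<^sup>d\<close> and \<open>n = l d\<close>, then \<open>(e R)\<^sup>l\<close> is isomorphic to \<open>(f R)\<^sup>n\<close>, an index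
  \<open>k < n\<close> standing for the pair \<open>(k div d, k mod d)\<close>.  The image of the \<open>q\<close>-th basis vector of \<open>(e R)\<^sup>l\<close> is
  \<open>patch_column\<close>, and \<open>patch_row\<close> is the \<open>q\<close>-th coordinate as a function on \<open>(f R)\<^sup>n\<close>.  The elements of
  \<open>(f R)\<^sup>n\<close> are the vectors \<open>v\<close> of the free right module with \<open>f v k = v k\<close>.\<close>

definition patch_column :: "('a, 'b) ring_scheme \<Rightarrow> nat \<Rightarrow> nat \<Rightarrow> (nat \<Rightarrow> 'a) \<Rightarrow> nat \<Rightarrow> nat \<Rightarrow> 'a" where
  "patch_column R n d w q = (\<lambda>k. if k < n \<and> k div d = q then w (k mod d) else \<zero>\<^bsub>R\<^esub>)"

definition patch_row :: "('a, 'b) ring_scheme \<Rightarrow> nat \<Rightarrow> (nat \<Rightarrow> 'a) \<Rightarrow> nat \<Rightarrow> (nat \<Rightarrow> 'a) \<Rightarrow> 'a" where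
  "patch_row R d u q v = (\<Oplus>\<^bsub>R\<^esub>j\<in>{..<d}. u j \<otimes>\<^bsub>R\<^esub> v (q * d + j))"

context ring
begin

context
  fixes f e d u w n l
  assumes f: "f \<in> carrier R" "f \<otimes> f = f" and free: "free_over_idempotent R f e d u w"
    and d: "0 < d" and n: "n = l * d"
begin

abbreviation (input) V where "V \<equiv> free_module (opposite R) {..<n} :: ('a, nat \<Rightarrow> 'a) module"

lemma patch_u: "j < d \<Longrightarrow> u j \<in> carrier R" "j < d \<Longrightarrow> e \<otimes> u j = u j"
  and patch_w: "j < d \<Longrightarrow> w j \<in> carrier R" "j < d \<Longrightarrow> f \<otimes> w j = w j"
  and patch_wu: "\<lbrakk>i < d; j < d\<rbrakk> \<Longrightarrow> w i \<otimes> u j = (if i = j then f else \<zero>)"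
  and patch_uw: "(\<Oplus>i\<in>{..<d}. u i \<otimes> w i) = e"
  using free by (auto simp: free_over_idempotent_def)

lemma patch_e: "e \<in> carrier R"
  unfolding patch_uw[symmetric] using patch_u(1) patch_w(1) by (intro finsum_closed) auto

lemma V_carrier: "v \<in> carrier V \<Longrightarrow> v k \<in> carrier R" "v \<in> carrier V \<Longrightarrow> n \<le> k \<Longrightarrow> v k = \<zero>"
  by (auto simp: free_module_carrier)

lemma patch_column_carrier: "patch_column R n d w q \<in> carrier V"
proof -
  have "{k. patch_column R n d w q k \<noteq> \<zero>} \<subseteq> {..<n}" by (auto simp: patch_column_def)
  then have "finite {k. patch_column R n d w q k \<noteq> \<zero>}" by (rule finite_subset) simp
  then show ?thesis
    using patch_w(1) d by (auto simp: free_module_carrier patch_column_def)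
qed

lemma patch_column_fixed: "f \<otimes> patch_column R n d w q k = patch_column R n d w q k"
  using patch_w(2) d f by (auto simp: patch_column_def)

lemma patch_row_closed: "v \<in> carrier V \<Longrightarrow> patch_row R d u q v \<in> carrier R"
  unfolding patch_row_def using patch_u(1) V_carrier by (intro finsum_closed) auto

lemma patch_row_hom: "patch_row R d u q \<in> mod_hom (opposite R) V (regular_module (opposite R))"
  unfolding mod_hom_def
proof (intro CollectI conjI ballI)
  show "patch_row R d u q \<in> carrier V \<rightarrow> carrier (regular_module (opposite R))"
    using patch_row_closed by auto
next
  fix x y assume xy: "x \<in> carrier V" "y \<in> carrier V"
  have "patch_row R d u q (x \<oplus>\<^bsub>V\<^esub> y) = (\<Oplus>j\<in>{..<d}. u j \<otimes> x (q * d + j) \<oplus> u j \<otimes> y (q * d + j))"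
    unfolding patch_row_def using patch_u(1) V_carrier(1) xy
    by (intro finsum_cong') (auto simp: free_module_simps r_distr)
  also have "\<dots> = patch_row R d u q x \<oplus> patch_row R d u q y"
    unfolding patch_row_def using patch_u(1) V_carrier(1) xy by (intro finsum_addf) auto
  finally show "patch_row R d u q (x \<oplus>\<^bsub>V\<^esub> y)
      = patch_row R d u q x \<oplus>\<^bsub>regular_module (opposite R)\<^esub> patch_row R d u q y" by simp
next
  fix a x assume a: "a \<in> carrier (opposite R)" "x \<in> carrier V"
  have "patch_row R d u q (a \<odot>\<^bsub>V\<^esub> x) = (\<Oplus>j\<in>{..<d}. (u j \<otimes> x (q * d + j)) \<otimes> a)"
    unfolding patch_row_def using patch_u(1) V_carrier(1) a
    by (intro finsum_cong') (auto simp: free_module_simps m_assoc)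
  also have "\<dots> = patch_row R d u q x \<otimes> a"
    unfolding patch_row_def using patch_u(1) V_carrier(1) a by (intro finsum_ldistr[symmetric]) auto
  finally show "patch_row R d u q (a \<odot>\<^bsub>V\<^esub> x) = a \<odot>\<^bsub>regular_module (opposite R)\<^esub> patch_row R d u q x"
    by simp
qed

lemma patch_row_fixed: "v \<in> carrier V \<Longrightarrow> e \<otimes> patch_row R d u q v = patch_row R d u q v"
proof -
  assume v: "v \<in> carrier V"
  have "e \<otimes> patch_row R d u q v = (\<Oplus>j\<in>{..<d}. e \<otimes> (u j \<otimes> v (q * d + j)))"
    unfolding patch_row_def using patch_u(1) V_carrier(1)[OF v] patch_e by (intro finsum_rdistr) auto
  also have "\<dots> = (\<Oplus>j\<in>{..<d}. u j \<otimes> v (q * d + j))"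
    using patch_u V_carrier(1)[OF v] patch_e by (intro finsum_cong') (auto simp: m_assoc[symmetric])
  finally show ?thesis by (simp add: patch_row_def)
qed

lemma patch_row_column:
  assumes q: "q < l" "q' < l"
  shows "patch_row R d u q (patch_column R n d w q') = (if q = q' then e else \<zero>)"
proof -
  have idx: "q * d + j < n" "(q * d + j) div d = q" "(q * d + j) mod d = j" if "j < d" for j
  proof -
    have "Suc q * d \<le> n" unfolding n using q(1) by (intro mult_le_mono1) simp
    then show "q * d + j < n" using that by simp
  qed (use that in auto)
  show ?thesis
  proof (cases "q = q'")
    case True
    have "patch_row R d u q (patch_column R n d w q') = (\<Oplus>j\<in>{..<d}. u j \<otimes> w j)"
      unfolding patch_row_def using True idx patch_u(1) patch_w(1)
      by (intro finsum_cong') (auto simp: patch_column_def)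
    then show ?thesis using True patch_uw by simp
  next
    case False
    have "patch_row R d u q (patch_column R n d w q') = (\<Oplus>j\<in>{..<d}. \<zero>)"
      unfolding patch_row_def using False idx patch_u(1) by (intro finsum_cong') (auto simp: patch_column_def)
    then show ?thesis using False by simp
  qed
qed

lemma patch_expand:
  assumes v: "v \<in> carrier V" "\<And>k. f \<otimes> v k = v k"
  shows "(\<Oplus>\<^bsub>V\<^esub>q\<in>{..<l}. patch_row R d u q v \<odot>\<^bsub>V\<^esub> patch_column R n d w q) = v"
proof
  fix k
  interpret O: ring "opposite R" by (rule ring_opposite)
  interpret V: left_module "opposite R" V by (rule O.free_left_module)
  note vc = V_carrier(1)[OF v(1)]
  have "(\<Oplus>\<^bsub>V\<^esub>q\<in>{..<l}. patch_row R d u q v \<odot>\<^bsub>V\<^esub> patch_column R n d w q) k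
      = (\<Oplus>q\<in>{..<l}. (patch_row R d u q v \<odot>\<^bsub>V\<^esub> patch_column R n d w q) k)"
  proof (rule additive_finsum[OF V.M.abelian_group_axioms abelian_group_axioms, where f = "\<lambda>v. v k"])
    show "(\<lambda>q. patch_row R d u q v \<odot>\<^bsub>V\<^esub> patch_column R n d w q) \<in> {..<l} \<rightarrow> carrier V"
      using patch_row_closed[OF v(1)] patch_column_carrier by (intro funcsetI V.smult_closed) auto
  qed (use V_carrier(1) in \<open>auto simp: free_module_simps\<close>)
  also have "\<dots> = (\<Oplus>q\<in>{..<l}. patch_column R n d w q k \<otimes> patch_row R d u q v)"
    by (simp add: free_module_simps)
  also have "\<dots> = v k"
  proof (cases "k < n")
    case False
    have "(\<Oplus>q\<in>{..<l}. patch_column R n d w q k \<otimes> patch_row R d u q v) = (\<Oplus>q\<in>{..<l}. \<zero>)"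
      using False patch_row_closed[OF v(1)] by (intro finsum_cong') (auto simp: patch_column_def)
    then show ?thesis using False V_carrier(2)[OF v(1)] by simp
  next
    case True
    have kd: "k div d < l" using True d unfolding n by (simp add: less_mult_imp_div_less)
    have km: "k mod d < d" "k div d * d + k mod d = k" using d by auto
    have "w (k mod d) \<otimes> patch_row R d u (k div d) v = (\<Oplus>j\<in>{..<d}. w (k mod d) \<otimes> (u j \<otimes> v (k div d * d + j)))"
      unfolding patch_row_def using patch_u(1) patch_w(1)[OF km(1)] vc by (intro finsum_rdistr) auto
    also have "\<dots> = v k"
    proof (rule finsum_single)
      show "w (k mod d) \<otimes> (u j \<otimes> v (k div d * d + j)) = (if j = k mod d then v k else \<zero>)" if "j \<in> {..<d}" for j
      proof -
        have "w (k mod d) \<otimes> (u j \<otimes> v (k div d * d + j)) = (w (k mod d) \<otimes> u j) \<otimes> v (k div d * d + j)"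
          using that patch_u(1) patch_w(1)[OF km(1)] vc by (simp add: m_assoc)
        then show ?thesis using that patch_wu[OF km(1), of j] km v(2) vc by auto
      qed
    qed (use km vc in auto)
    finally have *: "w (k mod d) \<otimes> patch_row R d u (k div d) v = v k" .
    show ?thesis
    proof (rule finsum_single)
      show "patch_column R n d w q k \<otimes> patch_row R d u q v = (if q = k div d then v k else \<zero>)"
        if "q \<in> {..<l}" for q
        using True * patch_row_closed[OF v(1)] by (auto simp: patch_column_def)
    qed (use kd vc in auto)
  qed
  finally show "(\<Oplus>\<^bsub>V\<^esub>q\<in>{..<l}. patch_row R d u q v \<odot>\<^bsub>V\<^esub> patch_column R n d w q) k = v k" .
qed

end

end

section \<open>Gluing local dual bases\<close>

context ring_of_fractions
begin

abbreviation (input) compl where "compl m \<equiv> carrier R - m"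

lemma compl_submonoid: "maximalideal m R \<Longrightarrow> submonoid (compl m) R"
  by (rule R.maximalideal_complement(1))

text \<open>The elements \<open>s\<close> of \<open>R\<close> with \<open>s a \<in> X\<close> form an ideal that is contained in no maximal ideal.\<close>

lemma frac_local_global:
  assumes X: "ideal X \<Lambda>" and a: "a \<in> carrier T" "\<And>m. maximalideal m R \<Longrightarrow> a \<in> frac (compl m) X"
  shows "a \<in> \<iota> ` X"
proof -
  interpret X: ideal X \<Lambda> by (rule X)
  let ?A = "{s \<in> carrier R. scalar s \<otimes>\<^bsub>T\<^esub> a \<in> \<iota> ` X}"
  have "left_ideal ?A R"
    unfolding R.left_ideal_iff
  proof (intro conjI ballI)
    show "\<zero>\<^bsub>R\<^esub> \<in> ?A" using a(1) X.zero_closed by (auto intro!: image_eqI[of _ _ "\<zero>\<^bsub>\<Lambda>\<^esub>"])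
    show "s \<oplus>\<^bsub>R\<^esub> t \<in> ?A" if st: "s \<in> ?A" "t \<in> ?A" for s t
    proof -
      obtain x y where xy: "x \<in> X" "y \<in> X" "scalar s \<otimes>\<^bsub>T\<^esub> a = \<iota> x" "scalar t \<otimes>\<^bsub>T\<^esub> a = \<iota> y" using st by auto
      then have "scalar (s \<oplus>\<^bsub>R\<^esub> t) \<otimes>\<^bsub>T\<^esub> a = \<iota> (x \<oplus>\<^bsub>\<Lambda>\<^esub> y)"
        using st a(1) X.Icarr by (simp add: T.l_distr flip: scalar_add)
      then have "scalar (s \<oplus>\<^bsub>R\<^esub> t) \<otimes>\<^bsub>T\<^esub> a \<in> \<iota> ` X" using X.a_closed[OF xy(1,2)] by (simp only: imageI)
      then show ?thesis using st by simp
    qed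
    show "r \<otimes>\<^bsub>R\<^esub> s \<in> ?A" if r: "r \<in> carrier R" and s: "s \<in> ?A" for r s
    proof -
      obtain x where x: "x \<in> X" "scalar s \<otimes>\<^bsub>T\<^esub> a = \<iota> x" using s by auto
      have "scalar (r \<otimes>\<^bsub>R\<^esub> s) \<otimes>\<^bsub>T\<^esub> a = scalar r \<otimes>\<^bsub>T\<^esub> (scalar s \<otimes>\<^bsub>T\<^esub> a)"
        using r s a(1) by (simp add: T.m_assoc flip: scalar_mult)
      also have "\<dots> = \<iota> (r \<odot>\<^bsub>\<Lambda>\<^esub> x)" using x r X.Icarr by (simp add: scalar_\<iota>)
      finally show ?thesis using r s ideal_smult[OF X r x(1)] by auto
    qed
  qed auto
  then have "ideal ?A R" by (rule R.left_ideal_imp_ideal)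
  then have "\<one>\<^bsub>R\<^esub> \<in> ?A"
  proof (rule R.ideal_eq_carrier_local)
    fix m assume "maximalideal m R"
    from fracE[OF a(2)[OF this]] show "\<exists>s \<in> ?A. s \<notin> m" by blast
  qed
  then show ?thesis using a(1) by simp
qed

text \<open>If \<open>b\<close> clears the denominator of \<open>a\<close>, then so does, in a localization, every multiple \<open>c\<close> of \<open>b\<close>.\<close>

lemma frac_from_multiple:
  assumes X: "ideal X \<Lambda>" and U: "submonoid U R" and t: "t \<in> U" "t \<otimes>\<^bsub>R\<^esub> c = b \<otimes>\<^bsub>R\<^esub> y"
    and c: "c \<in> carrier R" "b \<in> carrier R" "y \<in> carrier R" "a \<in> carrier T"
    and ba: "scalar b \<otimes>\<^bsub>T\<^esub> a \<in> \<iota> ` X"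
  shows "scalar c \<otimes>\<^bsub>T\<^esub> a \<in> frac U X"
proof -
  obtain x where x: "x \<in> X" "scalar b \<otimes>\<^bsub>T\<^esub> a = \<iota> x" using ba by blast
  have tR: "t \<in> carrier R" using R.S_closed(1)[OF U t(1)] .
  have "scalar t \<otimes>\<^bsub>T\<^esub> (scalar c \<otimes>\<^bsub>T\<^esub> a) = scalar (t \<otimes>\<^bsub>R\<^esub> c) \<otimes>\<^bsub>T\<^esub> a"
    using c tR by (simp add: T.m_assoc[symmetric] scalar_mult)
  also have "\<dots> = scalar y \<otimes>\<^bsub>T\<^esub> (scalar b \<otimes>\<^bsub>T\<^esub> a)"
    unfolding t(2) using c by (simp add: T.m_assoc[symmetric] scalar_mult R.m_comm)
  also have "\<dots> = \<iota> (y \<odot>\<^bsub>\<Lambda>\<^esub> x)" using x c ideal.Icarr[OF X x(1)] by (simp add: scalar_\<iota>)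
  finally show ?thesis using c t(1) ideal_smult[OF X c(3) x(1)] by (intro fracI) auto
qed

lemma frac_mono: "X \<subseteq> Y \<Longrightarrow> a \<in> frac U X \<Longrightarrow> a \<in> frac U Y"
  by (auto simp: frac_def)

lemma common_denominator:
  assumes X: "ideal X \<Lambda>" and F: "finite F" "F \<subseteq> frac S X"
  obtains b where "b \<in> S" "\<And>a. a \<in> F \<Longrightarrow> scalar b \<otimes>\<^bsub>T\<^esub> a \<in> \<iota> ` X"
proof -
  interpret X: ideal X \<Lambda> by (rule X)
  have "\<exists>b \<in> S. \<forall>a \<in> F. scalar b \<otimes>\<^bsub>T\<^esub> a \<in> \<iota> ` X"
    using F
  proof (induction F rule: finite_induct)
    case empty then show ?case using S_carrier(2) by auto
  next
    case (insert a F)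
    then obtain b where b: "b \<in> S" "\<And>a. a \<in> F \<Longrightarrow> scalar b \<otimes>\<^bsub>T\<^esub> a \<in> \<iota> ` X" by auto
    obtain s x where s: "a \<in> carrier T" "s \<in> S" "x \<in> X" "scalar s \<otimes>\<^bsub>T\<^esub> a = \<iota> x"
      using insert.prems fracE[of a S X] by blast
    note c = S_carrier(1)[OF b(1)] S_carrier(1)[OF s(2)]
    have mul: "scalar (r \<otimes>\<^bsub>R\<^esub> t) \<otimes>\<^bsub>T\<^esub> a' \<in> \<iota> ` X"
      if "r \<in> carrier R" "t \<in> carrier R" "a' \<in> carrier T" and ta: "scalar t \<otimes>\<^bsub>T\<^esub> a' \<in> \<iota> ` X" for r t a'
    proof -
      obtain x where x: "x \<in> X" "scalar t \<otimes>\<^bsub>T\<^esub> a' = \<iota> x" using ta by blast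
      have "scalar (r \<otimes>\<^bsub>R\<^esub> t) \<otimes>\<^bsub>T\<^esub> a' = scalar r \<otimes>\<^bsub>T\<^esub> \<iota> x"
        using that(1-3) by (simp add: T.m_assoc flip: x(2) scalar_mult)
      then show ?thesis using ideal_smult[OF X that(1) x(1)] that(1) X.Icarr[OF x(1)] by (simp add: scalar_\<iota>)
    qed
    have "scalar (s \<otimes>\<^bsub>R\<^esub> b) \<otimes>\<^bsub>T\<^esub> a' \<in> \<iota> ` X" if a': "a' \<in> insert a F" for a'
    proof (cases "a' = a")
      case True
      have "scalar (b \<otimes>\<^bsub>R\<^esub> s) \<otimes>\<^bsub>T\<^esub> a \<in> \<iota> ` X" using s by (intro mul c) auto
      then show ?thesis using True c by (simp add: R.m_comm)
    next
      case False
      then show ?thesis using a' insert.prems frac_carrier b(2) by (intro mul c) auto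
    qed
    then show ?case using S_carrier(3)[OF s(2) b(1)] by blast
  qed
  then show thesis using that by blast
qed

end

context ring_of_fractions
begin

text \<open>For each maximal ideal \<open>m\<close>, the vectors \<open>U m q\<close> and the coordinate functions \<open>W m q\<close> identify the subset
  \<open>L0\<close> of the right \<open>T\<close>-module \<open>V\<close> with a non-trivial power of \<open>e\<^sub>m T\<close>, where the idempotent \<open>e\<^sub>m\<close> lies in the
  localization of \<open>I\<close> and generates it: by \<open>gen\<close>, an ideal of \<open>\<Lambda>\<close> that contains \<open>e\<^sub>m\<close> locally contains \<open>I\<close>
  locally.  The element \<open>b\<close> is a common denominator of all changes of coordinates.\<close>

context
  fixes V :: "('t, 'v, 'z) module_scheme" and L0 :: "'v set" and I :: "'a set" and b :: 'r
    and e :: "'r set \<Rightarrow> 't" and l :: "'r set \<Rightarrow> nat"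
    and U :: "'r set \<Rightarrow> nat \<Rightarrow> 'v" and W :: "'r set \<Rightarrow> nat \<Rightarrow> 'v \<Rightarrow> 't"
  assumes h: "h_local_domain R" and I: "ideal I \<Lambda>"
    and V: "left_module (opposite T) V"
    and L0: "L0 \<subseteq> carrier V" "\<And>r v. \<lbrakk>r \<in> carrier R; v \<in> L0\<rbrakk> \<Longrightarrow> scalar r \<odot>\<^bsub>V\<^esub> v \<in> L0"
    and e: "\<And>m. maximalideal m R \<Longrightarrow> e m \<in> frac (carrier R - m) I"
    and gen: "\<And>m K z. \<lbrakk>maximalideal m R; ideal K \<Lambda>; e m \<in> frac (carrier R - m) K; z \<in> I\<rbrakk> \<Longrightarrow>
      \<exists>t \<in> carrier R - m. t \<odot>\<^bsub>\<Lambda>\<^esub> z \<in> K"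
    and l: "\<And>m. maximalideal m R \<Longrightarrow> 0 < l m"
    and U: "\<And>m q. \<lbrakk>maximalideal m R; q < l m\<rbrakk> \<Longrightarrow> U m q \<in> L0"
    and W: "\<And>m q. \<lbrakk>maximalideal m R; q < l m\<rbrakk> \<Longrightarrow> W m q \<in> mod_hom (opposite T) V (regular_module (opposite T))"
    and UW: "\<And>m v. \<lbrakk>maximalideal m R; v \<in> L0\<rbrakk> \<Longrightarrow> (\<Oplus>\<^bsub>V\<^esub>q\<in>{..<l m}. W m q v \<odot>\<^bsub>V\<^esub> U m q) = v"
    and eW: "\<And>m q v. \<lbrakk>maximalideal m R; q < l m; v \<in> L0\<rbrakk> \<Longrightarrow> e m \<otimes>\<^bsub>T\<^esub> W m q v = W m q v"
    and WU: "\<And>m q q'. \<lbrakk>maximalideal m R; q < l m; q' < l m\<rbrakk> \<Longrightarrow>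
      W m q (U m q') = (if q = q' then e m else \<zero>\<^bsub>T\<^esub>)"
    and b: "b \<in> carrier R" "b \<noteq> \<zero>\<^bsub>R\<^esub>"
      "\<And>m q m' q'. \<lbrakk>maximalideal m R; q < l m; maximalideal m' R; q' < l m'\<rbrakk> \<Longrightarrow>
        scalar b \<otimes>\<^bsub>T\<^esub> W m q (U m' q') \<in> \<iota> ` I"
begin

interpretation I: ideal I \<Lambda> by (rule I)
interpretation O: ring "opposite T" by (rule T.ring_opposite)
interpretation V: left_module "opposite T" V by (rule V)

abbreviation (input) Hom where "Hom \<equiv> mod_hom (opposite T) V (regular_module (opposite T))"

text \<open>Locally at \<open>m\<close>, the lattice will be the corresponding power of \<open>e\<^sub>m \<Lambda>\<^sub>m\<close>.\<close>

definition lattice :: "'v set" where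
  "lattice = {v \<in> L0. \<forall>m. maximalideal m R \<longrightarrow> (\<forall>q < l m. W m q v \<in> frac (carrier R - m) (carrier \<Lambda>))}"

definition functionals :: "('v \<Rightarrow> 't) set" where
  "functionals = {g \<in> Hom. \<forall>v \<in> lattice. g v \<in> \<iota> ` I}"

lemma HomD:
  assumes "g \<in> Hom"
  shows "v \<in> carrier V \<Longrightarrow> g v \<in> carrier T"
    "\<lbrakk>v \<in> carrier V; v' \<in> carrier V\<rbrakk> \<Longrightarrow> g (v \<oplus>\<^bsub>V\<^esub> v') = g v \<oplus>\<^bsub>T\<^esub> g v'"
    "\<lbrakk>a \<in> carrier T; v \<in> carrier V\<rbrakk> \<Longrightarrow> g (a \<odot>\<^bsub>V\<^esub> v) = g v \<otimes>\<^bsub>T\<^esub> a"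
  using mod_homD[OF assms] by simp_all

lemma Hom_finsum:
  assumes g: "g \<in> Hom" and "\<And>k. k \<in> K \<Longrightarrow> a k \<in> carrier T" "\<And>k. k \<in> K \<Longrightarrow> x k \<in> carrier V"
  shows "g (\<Oplus>\<^bsub>V\<^esub>k\<in>K. a k \<odot>\<^bsub>V\<^esub> x k) = (\<Oplus>\<^bsub>T\<^esub>k\<in>K. g (x k) \<otimes>\<^bsub>T\<^esub> a k)"
proof -
  have "g (\<Oplus>\<^bsub>V\<^esub>k\<in>K. a k \<odot>\<^bsub>V\<^esub> x k) = (\<Oplus>\<^bsub>T\<^esub>k\<in>K. g (a k \<odot>\<^bsub>V\<^esub> x k))"
    using HomD(1,2)[OF g] assms(2,3) V.smult_closed
    by (intro additive_finsum[OF V.M.abelian_group_axioms T.abelian_group_axioms]) auto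
  also have "\<dots> = (\<Oplus>\<^bsub>T\<^esub>k\<in>K. g (x k) \<otimes>\<^bsub>T\<^esub> a k)"
    using HomD[OF g] assms(2,3) by (intro T.finsum_cong') auto
  finally show ?thesis .
qed

lemma smult_smult: "\<lbrakk>a \<in> carrier T; a' \<in> carrier T; v \<in> carrier V\<rbrakk> \<Longrightarrow> a \<odot>\<^bsub>V\<^esub> (a' \<odot>\<^bsub>V\<^esub> v) = (a' \<otimes>\<^bsub>T\<^esub> a) \<odot>\<^bsub>V\<^esub> v"
  using V.smult_assoc[of a a' v] by simp

lemma V_smult_closed: "\<lbrakk>a \<in> carrier T; v \<in> carrier V\<rbrakk> \<Longrightarrow> a \<odot>\<^bsub>V\<^esub> v \<in> carrier V"
  using V.smult_closed[of a v] by simp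

lemma lattice_carrier: "v \<in> lattice \<Longrightarrow> v \<in> L0" "v \<in> lattice \<Longrightarrow> v \<in> carrier V"
  using L0(1) by (auto simp: lattice_def)

lemma U_carrier: "\<lbrakk>maximalideal m R; q < l m\<rbrakk> \<Longrightarrow> U m q \<in> carrier V"
  using U L0(1) by blast

lemma frac_I_carrier: "a \<in> frac X I \<Longrightarrow> a \<in> frac X (carrier \<Lambda>)"
  by (rule frac_mono[of I]) (use I.Icarr in auto)

lemma lattice_scalar:
  assumes r: "r \<in> carrier R" and v: "v \<in> lattice"
  shows "scalar r \<odot>\<^bsub>V\<^esub> v \<in> lattice"
proof -
  have "W m q (scalar r \<odot>\<^bsub>V\<^esub> v) \<in> frac (carrier R - m) (carrier \<Lambda>)" if m: "maximalideal m R" "q < l m" for m q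
  proof -
    have "W m q (scalar r \<odot>\<^bsub>V\<^esub> v) = W m q v \<otimes>\<^bsub>T\<^esub> scalar r"
      using HomD(3)[OF W[OF m]] r lattice_carrier(2)[OF v] by simp
    moreover have "W m q v \<in> frac (carrier R - m) (carrier \<Lambda>)" using v m by (simp add: lattice_def)
    ultimately show ?thesis
      using frac_mult_left[OF compl_submonoid[OF m(1)] _ scalar_in_frac[OF compl_submonoid[OF m(1)] r] \<Lambda>.oneideal]
      by simp
  qed
  then show ?thesis using L0(2)[OF r lattice_carrier(1)[OF v]] by (simp add: lattice_def)
qed

text \<open>Here the h-local property is used, to choose \<open>c\<close> outside \<open>m\<close> as a multiple of \<open>b\<close> at all other maximal
  ideals.  There, \<open>c\<close> clears the denominators of the changes of coordinates, even with values in \<open>I\<close>.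
  At \<open>m\<close> there is nothing to clear: the coordinates of the basis vectors are \<open>e\<^sub>m\<close> and \<open>\<zero>\<close>, and
  \<open>W m q v = e\<^sub>m (W m q v)\<close> lies in the localization of \<open>I\<close>.\<close>

lemma scaled_local_basis:
  assumes m: "maximalideal m R"
  obtains c where "c \<in> carrier R" "c \<notin> m"
    "\<And>q. q < l m \<Longrightarrow> scalar c \<odot>\<^bsub>V\<^esub> U m q \<in> lattice"
    "\<And>q. q < l m \<Longrightarrow> (\<lambda>v. scalar c \<otimes>\<^bsub>T\<^esub> W m q v) \<in> functionals"
proof -
  obtain c where c: "c \<in> carrier R" "c \<notin> m"
    and sep: "\<And>m'. \<lbrakk>maximalideal m' R; m' \<noteq> m\<rbrakk> \<Longrightarrow> \<exists>t \<in> carrier R - m'. \<exists>y \<in> carrier R. t \<otimes>\<^bsub>R\<^esub> c = b \<otimes>\<^bsub>R\<^esub> y"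
    by (rule h_local_separation[OF h b(1,2) m]) (rule that)
  have sc: "scalar c \<in> carrier T" using c by simp
  have off: "scalar c \<otimes>\<^bsub>T\<^esub> a \<in> frac (carrier R - m') I"
    if m': "maximalideal m' R" "m' \<noteq> m" and a: "a \<in> carrier T" "scalar b \<otimes>\<^bsub>T\<^esub> a \<in> \<iota> ` I" for m' a
  proof -
    obtain t y where "t \<in> carrier R - m'" "y \<in> carrier R" "t \<otimes>\<^bsub>R\<^esub> c = b \<otimes>\<^bsub>R\<^esub> y" using sep[OF m'] by blast
    then show ?thesis using frac_from_multiple[OF I compl_submonoid[OF m'(1)] _ _ c(1) b(1) _ a] by blast
  qed
  have Wc: "W m' q v \<in> carrier T" if "maximalideal m' R" "q < l m'" "v \<in> carrier V" for m' q v
    by (rule HomD(1)[OF W[OF that(1,2)] that(3)])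
  have 1: "scalar c \<odot>\<^bsub>V\<^esub> U m q \<in> lattice" if q: "q < l m" for q
  proof -
    have "W m' q' (scalar c \<odot>\<^bsub>V\<^esub> U m q) \<in> frac (carrier R - m') (carrier \<Lambda>)"
      if m': "maximalideal m' R" "q' < l m'" for m' q'
    proof -
      note sub = compl_submonoid[OF m'(1)]
      have eq: "W m' q' (scalar c \<odot>\<^bsub>V\<^esub> U m q) = scalar c \<otimes>\<^bsub>T\<^esub> W m' q' (U m q)"
        using HomD(3)[OF W[OF m'] sc U_carrier[OF m q]] scalar_central[OF c(1) Wc[OF m' U_carrier[OF m q]]] by simp
      show ?thesis
      proof (cases "m' = m")
        case True
        have "W m q' (U m q) \<in> frac (carrier R - m) I"
          using WU[OF m _ q, of q'] m'(2) True e[OF m] zero_in_frac[OF compl_submonoid[OF m] I] by simp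
        then show ?thesis unfolding eq
          using frac_mult_left[OF sub scalar_in_frac[OF sub c(1)] _ \<Lambda>.oneideal] frac_I_carrier True by simp
      next
        case False
        show ?thesis unfolding eq
          by (rule frac_I_carrier[OF off[OF m'(1) False Wc[OF m' U_carrier[OF m q]] b(3)[OF m' m q]]])
      qed
    qed
    then show ?thesis using L0(2)[OF c(1) U[OF m q]] by (simp add: lattice_def)
  qed
  have 2: "(\<lambda>v. scalar c \<otimes>\<^bsub>T\<^esub> W m q v) \<in> functionals" if q: "q < l m" for q
  proof -
    note Wh = HomD[OF W[OF m q]]
    have "(\<lambda>v. scalar c \<otimes>\<^bsub>T\<^esub> W m q v) \<in> Hom"
      unfolding mod_hom_def using Wh sc by (auto simp: T.r_distr T.m_assoc)
    moreover have "scalar c \<otimes>\<^bsub>T\<^esub> W m q v \<in> \<iota> ` I" if v: "v \<in> lattice" for v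
    proof (rule frac_local_global[OF I])
      note vV = lattice_carrier(2)[OF v]
      show "scalar c \<otimes>\<^bsub>T\<^esub> W m q v \<in> carrier T" using Wh(1)[OF vV] sc by simp
      fix m' assume m': "maximalideal m' R"
      note sub = compl_submonoid[OF m']
      have vW: "W m' q' v \<in> frac (carrier R - m') (carrier \<Lambda>)" if "q' < l m'" for q'
        using v m' that by (simp add: lattice_def)
      show "scalar c \<otimes>\<^bsub>T\<^esub> W m q v \<in> frac (carrier R - m') I"
      proof (cases "m' = m")
        case True
        have "e m \<otimes>\<^bsub>T\<^esub> W m q v \<in> frac (carrier R - m) I"
          by (rule frac_mult_right[OF sub[unfolded True] e[OF m] vW[unfolded True, OF q] I])
        then show ?thesis
          using frac_mult_left[OF sub scalar_in_frac[OF sub c(1)] _ I] eW[OF m q lattice_carrier(1)[OF v]] True by simp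
      next
        case False
        \<comment> \<open>Expand \<open>v\<close> in the basis at \<open>m'\<close>, where its coordinates are integral.\<close>
        have "W m q v = W m q (\<Oplus>\<^bsub>V\<^esub>q'\<in>{..<l m'}. W m' q' v \<odot>\<^bsub>V\<^esub> U m' q')"
          using UW[OF m' lattice_carrier(1)[OF v]] by simp
        also have "\<dots> = (\<Oplus>\<^bsub>T\<^esub>q'\<in>{..<l m'}. W m q (U m' q') \<otimes>\<^bsub>T\<^esub> W m' q' v)"
          using Wc[OF m' _ vV] U_carrier[OF m'] by (intro Hom_finsum[OF W[OF m q]]) auto
        finally have "scalar c \<otimes>\<^bsub>T\<^esub> W m q v = scalar c \<otimes>\<^bsub>T\<^esub> (\<Oplus>\<^bsub>T\<^esub>q'\<in>{..<l m'}. W m q (U m' q') \<otimes>\<^bsub>T\<^esub> W m' q' v)"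
          by (rule arg_cong)
        also have "\<dots> = (\<Oplus>\<^bsub>T\<^esub>q'\<in>{..<l m'}. scalar c \<otimes>\<^bsub>T\<^esub> (W m q (U m' q') \<otimes>\<^bsub>T\<^esub> W m' q' v))"
          using Wc[OF m' _ vV] Wc[OF m q U_carrier[OF m']] sc by (intro T.finsum_rdistr) auto
        also have "\<dots> \<in> frac (carrier R - m') I"
        proof (rule frac_finsum[OF sub I])
          fix q' assume "q' \<in> {..<l m'}"
          then have q': "q' < l m'" by simp
          note cl = Wc[OF m q U_carrier[OF m' q']] Wc[OF m' q' vV]
          have "scalar c \<otimes>\<^bsub>T\<^esub> W m q (U m' q') \<in> frac (carrier R - m') I"
            by (rule off[OF m' False cl(1) b(3)[OF m q m' q']])
          then show "scalar c \<otimes>\<^bsub>T\<^esub> (W m q (U m' q') \<otimes>\<^bsub>T\<^esub> W m' q' v) \<in> frac (carrier R - m') I"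
            using frac_mult_right[OF sub _ vW[OF q'] I] sc cl by (simp flip: T.m_assoc)
        qed
        finally show ?thesis .
      qed
    qed
    ultimately show ?thesis by (simp add: functionals_def)
  qed
  show thesis using that c 1 2 by blast
qed

text \<open>Multiplication by \<open>s\<close> is a sum of maps \<open>v \<mapsto> x j g j (v)\<close>; for \<open>s = \<one>\<close> this is a dual basis of the
  lattice in the usual sense.\<close>

definition dual_basis :: "'r \<Rightarrow> nat \<Rightarrow> (nat \<Rightarrow> 'v) \<Rightarrow> (nat \<Rightarrow> 'v \<Rightarrow> 't) \<Rightarrow> bool" where
  "dual_basis s k x g \<longleftrightarrow> (\<forall>j<k. x j \<in> lattice \<and> g j \<in> functionals) \<and>
     (\<forall>v \<in> lattice. (\<Oplus>\<^bsub>V\<^esub>j\<in>{..<k}. g j v \<odot>\<^bsub>V\<^esub> x j) = scalar s \<odot>\<^bsub>V\<^esub> v)"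

lemma functionals_closed: "\<lbrakk>g \<in> functionals; v \<in> lattice\<rbrakk> \<Longrightarrow> g v \<in> carrier T"
  using HomD(1) lattice_carrier(2) by (auto simp: functionals_def)

lemma dual_basis_add:
  assumes s: "s \<in> carrier R" "dual_basis s k x g" and t: "t \<in> carrier R" "dual_basis t k' x' g'"
  shows "dual_basis (s \<oplus>\<^bsub>R\<^esub> t) (k + k') (\<lambda>j. if j < k then x j else x' (j - k)) (\<lambda>j. if j < k then g j else g' (j - k))"
    (is "dual_basis _ _ ?x ?g")
proof -
  have mem: "?x j \<in> lattice \<and> ?g j \<in> functionals" if "j < k + k'" for j
    using s(2) t(2) that by (auto simp: dual_basis_def)
  have "(\<Oplus>\<^bsub>V\<^esub>j\<in>{..<k + k'}. ?g j v \<odot>\<^bsub>V\<^esub> ?x j) = scalar (s \<oplus>\<^bsub>R\<^esub> t) \<odot>\<^bsub>V\<^esub> v" if v: "v \<in> lattice" for v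
  proof -
    have cl: "?g j v \<odot>\<^bsub>V\<^esub> ?x j \<in> carrier V" if "j < k + k'" for j
      using mem[OF that] functionals_closed v lattice_carrier(2) by (intro V_smult_closed) auto
    have cl1: "g j v \<odot>\<^bsub>V\<^esub> x j \<in> carrier V" if "j < k" for j using cl[of j] that by simp
    have cl2: "g' j v \<odot>\<^bsub>V\<^esub> x' j \<in> carrier V" if "j < k'" for j using cl[of "k + j"] that by simp
    have un: "{..<k + k'} = {..<k} \<union> (\<lambda>j. k + j) ` {..<k'}"
      using lessThan_atLeast0 by (auto simp: image_iff)
    have "(\<Oplus>\<^bsub>V\<^esub>j\<in>{..<k + k'}. ?g j v \<odot>\<^bsub>V\<^esub> ?x j) =
        (\<Oplus>\<^bsub>V\<^esub>j\<in>{..<k}. ?g j v \<odot>\<^bsub>V\<^esub> ?x j) \<oplus>\<^bsub>V\<^esub> (\<Oplus>\<^bsub>V\<^esub>j\<in>(\<lambda>j. k + j) ` {..<k'}. ?g j v \<odot>\<^bsub>V\<^esub> ?x j)"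
      unfolding un using cl1 cl2 by (intro V.M.finsum_Un_disjoint) auto
    also have "(\<Oplus>\<^bsub>V\<^esub>j\<in>{..<k}. ?g j v \<odot>\<^bsub>V\<^esub> ?x j) = (\<Oplus>\<^bsub>V\<^esub>j\<in>{..<k}. g j v \<odot>\<^bsub>V\<^esub> x j)"
      using cl1 by (intro V.M.finsum_cong') auto
    also have "(\<Oplus>\<^bsub>V\<^esub>j\<in>(\<lambda>j. k + j) ` {..<k'}. ?g j v \<odot>\<^bsub>V\<^esub> ?x j) = (\<Oplus>\<^bsub>V\<^esub>j\<in>{..<k'}. ?g (k + j) v \<odot>\<^bsub>V\<^esub> ?x (k + j))"
      using cl2 by (intro V.M.add.finprod_reindex) (auto simp: inj_on_def)
    also have "\<dots> = (\<Oplus>\<^bsub>V\<^esub>j\<in>{..<k'}. g' j v \<odot>\<^bsub>V\<^esub> x' j)"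
      using cl2 by (intro V.M.finsum_cong') auto
    also have "(\<Oplus>\<^bsub>V\<^esub>j\<in>{..<k}. g j v \<odot>\<^bsub>V\<^esub> x j) \<oplus>\<^bsub>V\<^esub> (\<Oplus>\<^bsub>V\<^esub>j\<in>{..<k'}. g' j v \<odot>\<^bsub>V\<^esub> x' j)
        = scalar s \<odot>\<^bsub>V\<^esub> v \<oplus>\<^bsub>V\<^esub> scalar t \<odot>\<^bsub>V\<^esub> v"
      using s(2) t(2) v by (simp add: dual_basis_def)
    also have "\<dots> = scalar (s \<oplus>\<^bsub>R\<^esub> t) \<odot>\<^bsub>V\<^esub> v"
      using V.smult_l_distr[of "scalar s" "scalar t" v] s(1) t(1) lattice_carrier(2)[OF v] by (simp add: scalar_add)
    finally show ?thesis .
  qed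
  then show ?thesis unfolding dual_basis_def using mem by blast
qed

lemma dual_basis_scale:
  assumes s: "s \<in> carrier R" "dual_basis s k x g" and r: "r \<in> carrier R"
  shows "dual_basis (r \<otimes>\<^bsub>R\<^esub> s) k (\<lambda>j. scalar r \<odot>\<^bsub>V\<^esub> x j) g"
proof -
  have x: "x j \<in> lattice" "g j \<in> functionals" if "j < k" for j using s(2) that by (auto simp: dual_basis_def)
  have "(\<Oplus>\<^bsub>V\<^esub>j\<in>{..<k}. g j v \<odot>\<^bsub>V\<^esub> (scalar r \<odot>\<^bsub>V\<^esub> x j)) = scalar (r \<otimes>\<^bsub>R\<^esub> s) \<odot>\<^bsub>V\<^esub> v" if v: "v \<in> lattice" for v
  proof -
    have c: "g j v \<in> carrier T" "x j \<in> carrier V" if "j < k" for j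
      using functionals_closed[OF x(2)[OF that] v] lattice_carrier(2)[OF x(1)[OF that]] by auto
    have "(\<Oplus>\<^bsub>V\<^esub>j\<in>{..<k}. g j v \<odot>\<^bsub>V\<^esub> (scalar r \<odot>\<^bsub>V\<^esub> x j)) = (\<Oplus>\<^bsub>V\<^esub>j\<in>{..<k}. scalar r \<odot>\<^bsub>V\<^esub> (g j v \<odot>\<^bsub>V\<^esub> x j))"
      using c r V_smult_closed
      by (intro V.M.finsum_cong') (auto simp: smult_smult scalar_central)
    also have "\<dots> = scalar r \<odot>\<^bsub>V\<^esub> (\<Oplus>\<^bsub>V\<^esub>j\<in>{..<k}. g j v \<odot>\<^bsub>V\<^esub> x j)"
      using c r V_smult_closed by (intro V.finsum_smult_r[symmetric]) auto
    also have "\<dots> = scalar r \<odot>\<^bsub>V\<^esub> (scalar s \<odot>\<^bsub>V\<^esub> v)" using s(2) v by (simp add: dual_basis_def)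
    also have "\<dots> = scalar (r \<otimes>\<^bsub>R\<^esub> s) \<odot>\<^bsub>V\<^esub> v"
      using r s(1) lattice_carrier(2)[OF v] by (simp add: smult_smult scalar_mult R.m_comm)
    finally show ?thesis .
  qed
  then show ?thesis unfolding dual_basis_def using x lattice_scalar[OF r] by blast
qed

text \<open>The scaling factor \<open>c\<close> enters twice, in the basis vectors and in the coordinate functions.\<close>

lemma dual_basis_local:
  assumes m: "maximalideal m R"
  obtains s k x g where "s \<in> carrier R" "s \<notin> m" "dual_basis s k x g"
proof -
  obtain c where c: "c \<in> carrier R" "c \<notin> m"
    and x: "\<And>q. q < l m \<Longrightarrow> scalar c \<odot>\<^bsub>V\<^esub> U m q \<in> lattice"
    and g: "\<And>q. q < l m \<Longrightarrow> (\<lambda>v. scalar c \<otimes>\<^bsub>T\<^esub> W m q v) \<in> functionals"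
    by (rule scaled_local_basis[OF m]) (rule that)
  have cc: "c \<otimes>\<^bsub>R\<^esub> c \<in> carrier R" "c \<otimes>\<^bsub>R\<^esub> c \<notin> m"
    using R.S_closed(3)[OF compl_submonoid[OF m], of c c] c by auto
  have "(\<Oplus>\<^bsub>V\<^esub>q\<in>{..<l m}. (scalar c \<otimes>\<^bsub>T\<^esub> W m q v) \<odot>\<^bsub>V\<^esub> (scalar c \<odot>\<^bsub>V\<^esub> U m q)) = scalar (c \<otimes>\<^bsub>R\<^esub> c) \<odot>\<^bsub>V\<^esub> v"
    if v: "v \<in> lattice" for v
  proof -
    note vV = lattice_carrier(2)[OF v]
    have w: "W m q v \<in> carrier T" if "q < l m" for q using HomD(1)[OF W[OF m that] vV] .
    have "(scalar c \<otimes>\<^bsub>T\<^esub> W m q v) \<odot>\<^bsub>V\<^esub> (scalar c \<odot>\<^bsub>V\<^esub> U m q) = scalar (c \<otimes>\<^bsub>R\<^esub> c) \<odot>\<^bsub>V\<^esub> (W m q v \<odot>\<^bsub>V\<^esub> U m q)"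
      if q: "q < l m" for q
    proof -
      have "scalar c \<otimes>\<^bsub>T\<^esub> (scalar c \<otimes>\<^bsub>T\<^esub> W m q v) = W m q v \<otimes>\<^bsub>T\<^esub> scalar (c \<otimes>\<^bsub>R\<^esub> c)"
        using c w[OF q] cc scalar_central[OF cc(1) w[OF q]] by (simp add: scalar_mult flip: T.m_assoc)
      then show ?thesis using c cc w[OF q] U_carrier[OF m q] by (simp add: smult_smult)
    qed
    then have "(\<Oplus>\<^bsub>V\<^esub>q\<in>{..<l m}. (scalar c \<otimes>\<^bsub>T\<^esub> W m q v) \<odot>\<^bsub>V\<^esub> (scalar c \<odot>\<^bsub>V\<^esub> U m q))
        = (\<Oplus>\<^bsub>V\<^esub>q\<in>{..<l m}. scalar (c \<otimes>\<^bsub>R\<^esub> c) \<odot>\<^bsub>V\<^esub> (W m q v \<odot>\<^bsub>V\<^esub> U m q))"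
      using cc w U_carrier[OF m] by (intro V.M.finsum_cong') (auto intro!: V_smult_closed)
    also have "\<dots> = scalar (c \<otimes>\<^bsub>R\<^esub> c) \<odot>\<^bsub>V\<^esub> (\<Oplus>\<^bsub>V\<^esub>q\<in>{..<l m}. W m q v \<odot>\<^bsub>V\<^esub> U m q)"
      using cc w U_carrier[OF m] by (intro V.finsum_smult_r[symmetric]) (auto intro!: V_smult_closed)
    finally show ?thesis using UW[OF m lattice_carrier(1)[OF v]] by simp
  qed
  then have "dual_basis (c \<otimes>\<^bsub>R\<^esub> c) (l m) (\<lambda>q. scalar c \<odot>\<^bsub>V\<^esub> U m q) (\<lambda>q v. scalar c \<otimes>\<^bsub>T\<^esub> W m q v)"
    unfolding dual_basis_def using x g by blast
  then show thesis using that cc by blast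
qed

text \<open>The elements of \<open>R\<close> that have a dual basis form an ideal that is contained in no maximal ideal.\<close>

lemma dual_basis_global:
  obtains k x g where "dual_basis \<one>\<^bsub>R\<^esub> k x g"
proof -
  let ?A = "{s \<in> carrier R. \<exists>k x g. dual_basis s k x g}"
  have "left_ideal ?A R"
    unfolding R.left_ideal_iff
  proof (intro conjI ballI)
    have "scalar \<zero>\<^bsub>R\<^esub> \<odot>\<^bsub>V\<^esub> v = \<zero>\<^bsub>V\<^esub>" if "v \<in> lattice" for v
      using V.smult_l_null[OF lattice_carrier(2)[OF that]] by simp
    then have "dual_basis \<zero>\<^bsub>R\<^esub> 0 x g" for x g by (simp add: dual_basis_def del: scalar_zero)
    then show "\<zero>\<^bsub>R\<^esub> \<in> ?A" by blast
    show "s \<oplus>\<^bsub>R\<^esub> t \<in> ?A" if "s \<in> ?A" "t \<in> ?A" for s t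
      using that dual_basis_add by blast
    show "r \<otimes>\<^bsub>R\<^esub> s \<in> ?A" if "r \<in> carrier R" "s \<in> ?A" for r s
      using that dual_basis_scale by blast
  qed auto
  then have "ideal ?A R" by (rule R.left_ideal_imp_ideal)
  then have "\<one>\<^bsub>R\<^esub> \<in> ?A"
  proof (rule R.ideal_eq_carrier_local)
    fix m assume m: "maximalideal m R"
    obtain s k x g where "s \<in> carrier R" "s \<notin> m" "dual_basis s k x g" by (rule dual_basis_local[OF m])
    then show "\<exists>s \<in> ?A. s \<notin> m" by blast
  qed
  then show thesis using that by blast
qed

text \<open>The matrix \<open>E i j = g i (x j)\<close> of a dual basis of the lattice is idempotent with entries in \<open>I\<close>.  Let
  \<open>K\<close> be the ideal generated by the entries, and \<open>h\<close> any functional from the lattice to \<open>I\<close>.  In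
  \<open>h v = \<Sum> h (x j) g j v\<close>, first for \<open>v = x i\<close> the second factors are entries of \<open>E\<close>, so \<open>h (x i) \<in> K\<close>; then
  for arbitrary \<open>v\<close> the first factors lie in \<open>K\<close>, so \<open>h v \<in> K\<close>.  For the scaled coordinate functions and
  basis vectors at \<open>m\<close> this says \<open>c\<^sup>2 e\<^sub>m \<in> K\<close>.  Hence \<open>K\<close> contains \<open>I\<close> locally, and so globally.\<close>

lemma glued_idempotent_matrix:
  obtains n E where "idempotent_matrix \<Lambda> n E" "genideal \<Lambda> (entries n E) = I"
proof -
  obtain k x g where xg: "dual_basis \<one>\<^bsub>R\<^esub> k x g" by (rule dual_basis_global)
  have x: "x j \<in> lattice" and g: "g j \<in> functionals" if "j < k" for j
    using xg that by (auto simp: dual_basis_def)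
  have one: "scalar \<one>\<^bsub>R\<^esub> \<odot>\<^bsub>V\<^esub> v = v" if "v \<in> carrier V" for v
    using V.smult_one[OF that] by simp
  have expand: "h v = (\<Oplus>\<^bsub>T\<^esub>j\<in>{..<k}. h (x j) \<otimes>\<^bsub>T\<^esub> g j v)" if hh: "h \<in> Hom" and v: "v \<in> lattice" for h v
  proof -
    have "v = (\<Oplus>\<^bsub>V\<^esub>j\<in>{..<k}. g j v \<odot>\<^bsub>V\<^esub> x j)"
      using xg v one[OF lattice_carrier(2)[OF v]] by (simp add: dual_basis_def del: scalar_one)
    then have "h v = h (\<Oplus>\<^bsub>V\<^esub>j\<in>{..<k}. g j v \<odot>\<^bsub>V\<^esub> x j)" by (rule arg_cong)
    also have "\<dots> = (\<Oplus>\<^bsub>T\<^esub>j\<in>{..<k}. h (x j) \<otimes>\<^bsub>T\<^esub> g j v)"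
      using functionals_closed[OF g v] lattice_carrier(2)[OF x] by (intro Hom_finsum[OF hh]) auto
    finally show ?thesis .
  qed
  define E where "E = (\<lambda>i j. inv_into (carrier \<Lambda>) \<iota> (g i (x j)))"
  have gI: "h v \<in> \<iota> ` I" if "h \<in> functionals" "v \<in> lattice" for h v
    using that by (simp add: functionals_def)
  have E: "E i j \<in> I" "\<iota> (E i j) = g i (x j)" if ij: "i < k" "j < k" for i j
  proof -
    obtain z where z: "z \<in> I" "g i (x j) = \<iota> z" using gI[OF g[OF ij(1)] x[OF ij(2)]] by blast
    then have "E i j = z" using \<iota>_inj I.Icarr by (simp add: E_def)
    then show "E i j \<in> I" "\<iota> (E i j) = g i (x j)" using z by auto
  qed
  have EL: "E i j \<in> carrier \<Lambda>" if "i < k" "j < k" for i j using I.Icarr[OF E(1)[OF that]] .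
  have "idempotent_matrix \<Lambda> k E"
    unfolding idempotent_matrix_def
  proof (intro conjI allI impI)
    fix i j assume ij: "i < k" "j < k"
    show "E i j \<in> carrier \<Lambda>" by (rule EL[OF ij])
    have "\<iota> (\<Oplus>\<^bsub>\<Lambda>\<^esub>q\<in>{..<k}. E i q \<otimes>\<^bsub>\<Lambda>\<^esub> E q j) = (\<Oplus>\<^bsub>T\<^esub>q\<in>{..<k}. \<iota> (E i q \<otimes>\<^bsub>\<Lambda>\<^esub> E q j))"
      using EL ij by (intro additive_finsum[OF \<Lambda>.abelian_group_axioms T.abelian_group_axioms]) auto
    also have "\<dots> = (\<Oplus>\<^bsub>T\<^esub>q\<in>{..<k}. g i (x q) \<otimes>\<^bsub>T\<^esub> g q (x j))"
      using EL ij E(2) functionals_closed[OF g x] by (intro T.finsum_cong') auto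
    also have "\<dots> = g i (x j)"
      using expand[OF _ x[OF ij(2)], of "g i"] g[OF ij(1)] by (simp add: functionals_def)
    also have "\<dots> = \<iota> (E i j)" using E(2)[OF ij] by simp
    finally show "(\<Oplus>\<^bsub>\<Lambda>\<^esub>q\<in>{..<k}. E i q \<otimes>\<^bsub>\<Lambda>\<^esub> E q j) = E i j"
      by (subst (asm) \<iota>_eq_iff) (use EL ij in \<open>auto intro!: \<Lambda>.finsum_closed\<close>)
  qed
  moreover have "genideal \<Lambda> (entries k E) = I"
  proof
    have ent: "entries k E \<subseteq> I" using E(1) by (auto simp: entries_def)
    then have entc: "entries k E \<subseteq> carrier \<Lambda>" using I.Icarr by blast
    show "genideal \<Lambda> (entries k E) \<subseteq> I" by (rule \<Lambda>.genideal_minimal[OF I ent])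
    let ?K = "genideal \<Lambda> (entries k E)"
    have K: "ideal ?K \<Lambda>" by (rule \<Lambda>.genideal_ideal[OF entc])
    interpret K: ideal ?K \<Lambda> by (rule K)
    have EK: "E i j \<in> ?K" if "i < k" "j < k" for i j
      using \<Lambda>.genideal_self[OF entc] that by (auto simp: entries_def)
    have sumK: "(\<Oplus>\<^bsub>T\<^esub>j\<in>{..<k}. a j) \<in> \<iota> ` ?K" if "\<And>j. j < k \<Longrightarrow> a j \<in> \<iota> ` ?K" for a
    proof (rule T.finsum_mem)
      show "\<iota> ` ?K \<subseteq> carrier T" using K.Icarr by auto
      show "\<zero>\<^bsub>T\<^esub> \<in> \<iota> ` ?K" using K.zero_closed by (intro image_eqI[of _ _ "\<zero>\<^bsub>\<Lambda>\<^esub>"]) auto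
      fix y z assume "y \<in> \<iota> ` ?K" "z \<in> \<iota> ` ?K"
      then obtain y' z' where "y' \<in> ?K" "z' \<in> ?K" "y = \<iota> y'" "z = \<iota> z'" by blast
      then have "y \<oplus>\<^bsub>T\<^esub> z = \<iota> (y' \<oplus>\<^bsub>\<Lambda>\<^esub> z')" "y' \<oplus>\<^bsub>\<Lambda>\<^esub> z' \<in> ?K" using K.Icarr K.a_closed by auto
      then show "y \<oplus>\<^bsub>T\<^esub> z \<in> \<iota> ` ?K" by blast
    qed (use that in auto)
    have mulK: "\<iota> y \<otimes>\<^bsub>T\<^esub> \<iota> z \<in> \<iota> ` ?K" if "y \<in> carrier \<Lambda>" "z \<in> carrier \<Lambda>" "y \<in> ?K \<or> z \<in> ?K" for y z
    proof -
      have "y \<otimes>\<^bsub>\<Lambda>\<^esub> z \<in> ?K" using that K.I_l_closed K.I_r_closed by blast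
      then have "\<iota> (y \<otimes>\<^bsub>\<Lambda>\<^esub> z) \<in> \<iota> ` ?K" by (rule imageI)
      then show ?thesis using that by simp
    qed
    have hK: "h v \<in> \<iota> ` ?K" if hh: "h \<in> functionals" and v: "v \<in> lattice" for h v
    proof -
      have hH: "h \<in> Hom" using hh by (simp add: functionals_def)
      have "h (x j) \<in> \<iota> ` ?K" if j: "j < k" for j
        unfolding expand[OF hH x[OF j]]
      proof (rule sumK)
        fix i assume i: "i < k"
        obtain y where y: "y \<in> I" "h (x i) = \<iota> y" using gI[OF hh x[OF i]] by blast
        show "h (x i) \<otimes>\<^bsub>T\<^esub> g i (x j) \<in> \<iota> ` ?K"
          using mulK[of y "E i j"] y(2) E(2)[OF i j] I.Icarr[OF y(1)] EL[OF i j] EK[OF i j] by simp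
      qed
      then have 1: "\<exists>y \<in> ?K. h (x j) = \<iota> y" if "j < k" for j using that by blast
      show ?thesis
        unfolding expand[OF hH v]
      proof (rule sumK)
        fix j assume j: "j < k"
        obtain y where y: "y \<in> ?K" "h (x j) = \<iota> y" using 1[OF j] by blast
        obtain z where z: "z \<in> I" "g j v = \<iota> z" using gI[OF g[OF j] v] by blast
        show "h (x j) \<otimes>\<^bsub>T\<^esub> g j v \<in> \<iota> ` ?K"
          unfolding y(2) z(2) using y z K.Icarr I.Icarr by (intro mulK) auto
      qed
    qed
    show "I \<subseteq> ?K"
    proof
      fix z assume z: "z \<in> I"
      note zL = I.Icarr[OF z]
      have "\<iota> z \<in> \<iota> ` ?K"
      proof (rule frac_local_global[OF K])
        show "\<iota> z \<in> carrier T" using zL by simp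
        fix m assume m: "maximalideal m R"
        obtain c where c: "c \<in> carrier R" "c \<notin> m"
          and cx: "\<And>q. q < l m \<Longrightarrow> scalar c \<odot>\<^bsub>V\<^esub> U m q \<in> lattice"
          and cg: "\<And>q. q < l m \<Longrightarrow> (\<lambda>v. scalar c \<otimes>\<^bsub>T\<^esub> W m q v) \<in> functionals"
          by (rule scaled_local_basis[OF m]) (rule that)
        have cc: "c \<otimes>\<^bsub>R\<^esub> c \<in> carrier R - m"
          using R.S_closed(3)[OF compl_submonoid[OF m], of c c] c by auto
        \<comment> \<open>One basis vector is enough, and there is one because \<open>l m\<close> is positive.\<close>
        note l0 = l[OF m]
        have eT: "e m \<in> carrier T" by (rule frac_carrier[OF e[OF m]])
        have "scalar c \<otimes>\<^bsub>T\<^esub> W m 0 (scalar c \<odot>\<^bsub>V\<^esub> U m 0) \<in> \<iota> ` ?K"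
          using hK[OF cg[OF l0] cx[OF l0]] .
        moreover have "W m 0 (scalar c \<odot>\<^bsub>V\<^esub> U m 0) = e m \<otimes>\<^bsub>T\<^esub> scalar c"
          using HomD(3)[OF W[OF m l0] _ U_carrier[OF m l0]] WU[OF m l0 l0] c(1) by simp
        moreover have "scalar c \<otimes>\<^bsub>T\<^esub> (e m \<otimes>\<^bsub>T\<^esub> scalar c) = scalar (c \<otimes>\<^bsub>R\<^esub> c) \<otimes>\<^bsub>T\<^esub> e m"
          using c(1) eT by (simp flip: scalar_central[OF c(1) eT] scalar_mult T.m_assoc)
        ultimately have "scalar (c \<otimes>\<^bsub>R\<^esub> c) \<otimes>\<^bsub>T\<^esub> e m \<in> \<iota> ` ?K" by simp
        then obtain y where "y \<in> ?K" "scalar (c \<otimes>\<^bsub>R\<^esub> c) \<otimes>\<^bsub>T\<^esub> e m = \<iota> y" by blast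
        then have "e m \<in> frac (carrier R - m) ?K" by (rule fracI[OF eT cc])
        then obtain t where t: "t \<in> carrier R - m" "t \<odot>\<^bsub>\<Lambda>\<^esub> z \<in> ?K" using gen[OF m K _ z] by blast
        show "\<iota> z \<in> frac (carrier R - m) ?K"
          using zL t by (intro fracI[OF _ t(1) t(2)]) (simp_all add: scalar_\<iota>)
      qed
      then show "z \<in> ?K" using zL K.Icarr \<iota>_eq_iff by blast
    qed
  qed
  ultimately show thesis by (rule that)
qed

end

end

section \<open>Traces as ideals of idempotent matrices\<close>

context ring_of_fractions
begin

lemma extension_of_nonzero_ideal:
  assumes sa: "simple_artinian T" and I: "ideal I \<Lambda>" "I \<noteq> {\<zero>\<^bsub>\<Lambda>\<^esub>}"
  shows "frac S I = carrier T" "\<exists>r \<in> S. r \<odot>\<^bsub>\<Lambda>\<^esub> \<one>\<^bsub>\<Lambda>\<^esub> \<in> I"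
proof -
  interpret I: ideal I \<Lambda> by (rule I(1))
  obtain z where z: "z \<in> I" "z \<noteq> \<zero>\<^bsub>\<Lambda>\<^esub>" using I(2) I.zero_closed by blast
  have "\<iota> z \<noteq> \<zero>\<^bsub>T\<^esub>" using \<iota>_eq_iff[OF I.Icarr[OF z(1)] \<Lambda>.zero_closed] z(2) by simp
  then have "frac S I \<noteq> {\<zero>\<^bsub>T\<^esub>}" using \<iota>_in_frac[OF S(1) z(1) I.Icarr[OF z(1)]] by blast
  then show T: "frac S I = carrier T" using sa frac_ideal[OF I(1)] by (auto simp: simple_artinian_def)
  then obtain r x where r: "r \<in> S" "x \<in> I" "scalar r \<otimes>\<^bsub>T\<^esub> \<one>\<^bsub>T\<^esub> = \<iota> x"
    using fracE[of "\<one>\<^bsub>T\<^esub>" S I] T.one_closed by metis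
  have "\<iota> (r \<odot>\<^bsub>\<Lambda>\<^esub> \<one>\<^bsub>\<Lambda>\<^esub>) = \<iota> x" using r S_carrier(1)[OF r(1)] by (simp add: scalar_def)
  then have "r \<odot>\<^bsub>\<Lambda>\<^esub> \<one>\<^bsub>\<Lambda>\<^esub> = x" by (subst (asm) \<iota>_eq_iff) (use S_carrier(1)[OF r(1)] I.Icarr[OF r(2)] in auto)
  then show "\<exists>r \<in> S. r \<odot>\<^bsub>\<Lambda>\<^esub> \<one>\<^bsub>\<Lambda>\<^esub> \<in> I" using r by blast
qed

text \<open>By \<open>x\<^sup>2 = s x\<close>, the fraction \<open>x/s\<close> is an idempotent.  It is not zero, because some non-zero scalar
  multiple of \<open>r\<close> lies in the ideal generated by \<open>x\<close>.\<close>

lemma local_idempotent: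
  assumes S_def: "S = carrier R - {\<zero>\<^bsub>R\<^esub>}" and one: "\<one>\<^bsub>\<Lambda>\<^esub> \<noteq> \<zero>\<^bsub>\<Lambda>\<^esub>"
    and I: "ideal I \<Lambda>" and r: "r \<in> S" "r \<odot>\<^bsub>\<Lambda>\<^esub> \<one>\<^bsub>\<Lambda>\<^esub> \<in> I"
    and m: "maximalideal m R"
    and x: "x \<in> I" "s \<in> carrier R - m" "x \<otimes>\<^bsub>\<Lambda>\<^esub> x = s \<odot>\<^bsub>\<Lambda>\<^esub> x"
      "\<And>z. z \<in> I \<Longrightarrow> \<exists>t \<in> carrier R - m. t \<odot>\<^bsub>\<Lambda>\<^esub> z \<in> genideal \<Lambda> {x}"
  obtains e where "e \<in> frac (carrier R - m) I" "e \<otimes>\<^bsub>T\<^esub> e = e" "e \<noteq> \<zero>\<^bsub>T\<^esub>"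
    "\<And>K z. \<lbrakk>ideal K \<Lambda>; e \<in> frac (carrier R - m) K; z \<in> I\<rbrakk> \<Longrightarrow> \<exists>t \<in> carrier R - m. t \<odot>\<^bsub>\<Lambda>\<^esub> z \<in> K"
proof -
  interpret I: ideal I \<Lambda> by (rule I)
  note sub = compl_submonoid[OF m]
  note Uc = R.S_closed[OF sub]
  have nz: "carrier R - m \<subseteq> S" using R.maximalideal_complement(2)[OF m] unfolding S_def by blast
  have sS: "s \<in> S" and sR: "s \<in> carrier R" using x(2) nz by auto
  have xL: "x \<in> carrier \<Lambda>" using I.Icarr x(1) .
  define e where "e = inv\<^bsub>T\<^esub> (scalar s) \<otimes>\<^bsub>T\<^esub> \<iota> x"
  note su = scalar_unit[OF sS]
  have eT: "e \<in> carrier T" using su xL by (simp add: e_def)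
  have se: "scalar s \<otimes>\<^bsub>T\<^esub> e = \<iota> x" using su sR xL by (simp add: e_def T.Units_closed T.m_assoc[symmetric])
  have "scalar s \<otimes>\<^bsub>T\<^esub> (scalar s \<otimes>\<^bsub>T\<^esub> (e \<otimes>\<^bsub>T\<^esub> e)) = scalar s \<otimes>\<^bsub>T\<^esub> (scalar s \<otimes>\<^bsub>T\<^esub> e) \<otimes>\<^bsub>T\<^esub> e"
    using sR eT by (simp add: T.m_assoc)
  also have "\<dots> = scalar s \<otimes>\<^bsub>T\<^esub> (e \<otimes>\<^bsub>T\<^esub> scalar s) \<otimes>\<^bsub>T\<^esub> e" using scalar_central[OF sR eT] by simp
  also have "\<dots> = (scalar s \<otimes>\<^bsub>T\<^esub> e) \<otimes>\<^bsub>T\<^esub> (scalar s \<otimes>\<^bsub>T\<^esub> e)" using sR eT by (simp add: T.m_assoc)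
  also have "\<dots> = \<iota> (x \<otimes>\<^bsub>\<Lambda>\<^esub> x)" unfolding se using xL by simp
  also have "\<dots> = scalar s \<otimes>\<^bsub>T\<^esub> (scalar s \<otimes>\<^bsub>T\<^esub> e)" unfolding x(3) se using sR xL by (simp add: scalar_\<iota>)
  finally have "scalar s \<otimes>\<^bsub>T\<^esub> (e \<otimes>\<^bsub>T\<^esub> e) = scalar s \<otimes>\<^bsub>T\<^esub> e"
    by (rule scalar_cancel[OF sS, rotated 2]) (use sR eT in auto)
  then have ee: "e \<otimes>\<^bsub>T\<^esub> e = e" by (rule scalar_cancel[OF sS, rotated 2]) (use eT in auto)
  have "e \<noteq> \<zero>\<^bsub>T\<^esub>"
  proof
    assume "e = \<zero>\<^bsub>T\<^esub>"
    then have "\<iota> x = \<iota> \<zero>\<^bsub>\<Lambda>\<^esub>" using se sR by simp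
    then have "x = \<zero>\<^bsub>\<Lambda>\<^esub>" using \<iota>_eq_iff[OF xL \<Lambda>.zero_closed] by blast
    then obtain t where t: "t \<in> carrier R - m" "t \<odot>\<^bsub>\<Lambda>\<^esub> (r \<odot>\<^bsub>\<Lambda>\<^esub> \<one>\<^bsub>\<Lambda>\<^esub>) = \<zero>\<^bsub>\<Lambda>\<^esub>"
      using x(4)[OF r(2)] \<Lambda>.genideal_zero by auto
    have tr: "t \<otimes>\<^bsub>R\<^esub> r \<in> S" "t \<otimes>\<^bsub>R\<^esub> r \<in> carrier R" using S_carrier(3) nz t(1) r(1) S_carrier(1) by auto
    have "(t \<otimes>\<^bsub>R\<^esub> r) \<odot>\<^bsub>\<Lambda>\<^esub> \<one>\<^bsub>\<Lambda>\<^esub> = \<zero>\<^bsub>\<Lambda>\<^esub>" using t S_carrier(1)[OF r(1)] by (simp add: L.smult_assoc1)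
    then show False using torsion_free one tr S(2) \<Lambda>.one_closed unfolding torsion_free_def by metis
  qed
  moreover have "e \<in> frac (carrier R - m) I" by (rule fracI[OF eT x(2,1) se])
  moreover have "\<exists>t \<in> carrier R - m. t \<odot>\<^bsub>\<Lambda>\<^esub> z \<in> K"
    if K: "ideal K \<Lambda>" and eK: "e \<in> frac (carrier R - m) K" and z: "z \<in> I" for K z
  proof -
    interpret K: ideal K \<Lambda> by (rule K)
    obtain c k where c: "c \<in> carrier R - m" "k \<in> K" "scalar c \<otimes>\<^bsub>T\<^esub> e = \<iota> k" using fracE[OF eK] .
    have cR: "c \<in> carrier R" using c by simp
    have "\<iota> (c \<odot>\<^bsub>\<Lambda>\<^esub> x) = scalar c \<otimes>\<^bsub>T\<^esub> (scalar s \<otimes>\<^bsub>T\<^esub> e)" unfolding se using cR xL by (simp add: scalar_\<iota>)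
    also have "\<dots> = scalar s \<otimes>\<^bsub>T\<^esub> (scalar c \<otimes>\<^bsub>T\<^esub> e)"
      using cR sR eT by (simp add: T.m_assoc[symmetric] scalar_mult R.m_comm)
    also have "\<dots> = \<iota> (s \<odot>\<^bsub>\<Lambda>\<^esub> k)" unfolding c(3) using sR K.Icarr[OF c(2)] by (simp add: scalar_\<iota>)
    finally have "c \<odot>\<^bsub>\<Lambda>\<^esub> x = s \<odot>\<^bsub>\<Lambda>\<^esub> k"
      by (subst (asm) \<iota>_eq_iff) (use cR sR xL K.Icarr[OF c(2)] in auto)
    then have cx: "c \<odot>\<^bsub>\<Lambda>\<^esub> x \<in> K" using ideal_smult[OF K sR c(2)] by simp
    let ?K = "{y \<in> carrier \<Lambda>. c \<odot>\<^bsub>\<Lambda>\<^esub> y \<in> K}"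
    have "ideal ?K \<Lambda>"
    proof (rule \<Lambda>.two_sided_idealI)
      show "\<zero>\<^bsub>\<Lambda>\<^esub> \<in> ?K" using cR K.zero_closed by simp
      show "y \<oplus>\<^bsub>\<Lambda>\<^esub> y' \<in> ?K" if "y \<in> ?K" "y' \<in> ?K" for y y'
        using that cR K.a_closed by (simp add: L.smult_r_distr)
      fix a y assume ay: "a \<in> carrier \<Lambda>" "y \<in> ?K"
      have "c \<odot>\<^bsub>\<Lambda>\<^esub> (a \<otimes>\<^bsub>\<Lambda>\<^esub> y) = a \<otimes>\<^bsub>\<Lambda>\<^esub> (c \<odot>\<^bsub>\<Lambda>\<^esub> y)" "c \<odot>\<^bsub>\<Lambda>\<^esub> (y \<otimes>\<^bsub>\<Lambda>\<^esub> a) = (c \<odot>\<^bsub>\<Lambda>\<^esub> y) \<otimes>\<^bsub>\<Lambda>\<^esub> a"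
        using ay cR by (simp_all add: L.smult_mult_left L.smult_mult_right)
      then show "a \<otimes>\<^bsub>\<Lambda>\<^esub> y \<in> ?K" "y \<otimes>\<^bsub>\<Lambda>\<^esub> a \<in> ?K"
        using ay K.I_l_closed K.I_r_closed by simp_all
    qed auto
    then have sub: "genideal \<Lambda> {x} \<subseteq> ?K" using cx xL by (intro \<Lambda>.genideal_minimal) auto
    obtain t where t: "t \<in> carrier R - m" "t \<odot>\<^bsub>\<Lambda>\<^esub> z \<in> genideal \<Lambda> {x}" using x(4)[OF z] by blast
    then have "(c \<otimes>\<^bsub>R\<^esub> t) \<odot>\<^bsub>\<Lambda>\<^esub> z \<in> K" using sub cR I.Icarr[OF z] by (auto simp: L.smult_assoc1)
    then show ?thesis using Uc(3)[OF c(1) t(1)] by blast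
  qed
  ultimately show thesis using that ee by blast
qed

text \<open>At a maximal ideal that does not contain the non-zero scalar \<open>r\<close> of \<open>I\<close>, the localization of \<open>I\<close> is the
  whole ring, and the idempotent is chosen to be \<open>\<one>\<close>.  So there are only finitely many idempotents,
  the common dimension \<open>n\<close> can be the product of the ranks \<open>d\<close> of all of them over \<open>f\<close>, and there are
  only finitely many changes of coordinates for which a common denominator \<open>b\<close> is to be found.\<close>

lemma idempotent_matrix_of_local_idempotents:
  assumes h: "h_local_domain R" and sa: "simple_artinian T" and S_def: "S = carrier R - {\<zero>\<^bsub>R\<^esub>}"
    and I: "ideal I \<Lambda>"
    and loc: "\<And>m. maximalideal m R \<Longrightarrow> \<exists>x \<in> I. \<exists>s \<in> carrier R - m. x \<otimes>\<^bsub>\<Lambda>\<^esub> x = s \<odot>\<^bsub>\<Lambda>\<^esub> x \<and>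
      (\<forall>z \<in> I. \<exists>t \<in> carrier R - m. t \<odot>\<^bsub>\<Lambda>\<^esub> z \<in> genideal \<Lambda> {x})"
  obtains n E where "idempotent_matrix \<Lambda> n E" "genideal \<Lambda> (entries n E) = I"
proof (cases "I = {\<zero>\<^bsub>\<Lambda>\<^esub>}")
  case True
  have "idempotent_matrix \<Lambda> 1 (\<lambda>_ _. \<zero>\<^bsub>\<Lambda>\<^esub>)" by (simp add: idempotent_matrix_def)
  moreover have "entries 1 (\<lambda>_ _. \<zero>\<^bsub>\<Lambda>\<^esub>) = {\<zero>\<^bsub>\<Lambda>\<^esub>}" by (auto simp: entries_def)
  ultimately show thesis using that True \<Lambda>.genideal_zero by metis
next
  case False
  interpret I: ideal I \<Lambda> by (rule I)
  interpret O: ring "opposite T" by (rule T.ring_opposite)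
  note ext = extension_of_nonzero_ideal[OF sa I False]
  obtain r where r: "r \<in> S" "r \<odot>\<^bsub>\<Lambda>\<^esub> \<one>\<^bsub>\<Lambda>\<^esub> \<in> I" using ext(2) by blast
  have rR: "r \<in> carrier R" "r \<noteq> \<zero>\<^bsub>R\<^esub>" using r(1) S_def by auto
  have one: "\<one>\<^bsub>\<Lambda>\<^esub> \<noteq> \<zero>\<^bsub>\<Lambda>\<^esub>"
  proof
    assume eq: "\<one>\<^bsub>\<Lambda>\<^esub> = \<zero>\<^bsub>\<Lambda>\<^esub>"
    have "\<iota> \<one>\<^bsub>\<Lambda>\<^esub> = \<iota> \<zero>\<^bsub>\<Lambda>\<^esub>" unfolding eq by (rule refl)
    then show False using sa by (simp add: simple_artinian_def)
  qed
  define P where "P = (\<lambda>m e. e \<in> frac (carrier R - m) I \<and> e \<otimes>\<^bsub>T\<^esub> e = e \<and> e \<noteq> \<zero>\<^bsub>T\<^esub> \<and>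
    (\<forall>K z. ideal K \<Lambda> \<and> e \<in> frac (carrier R - m) K \<and> z \<in> I \<longrightarrow> (\<exists>t \<in> carrier R - m. t \<odot>\<^bsub>\<Lambda>\<^esub> z \<in> K)) \<and>
    (r \<notin> m \<longrightarrow> e = \<one>\<^bsub>T\<^esub>))"
  have "\<exists>e. P m e" if m: "maximalideal m R" for m
  proof (cases "r \<in> m")
    case True
    obtain x s where x: "x \<in> I" "s \<in> carrier R - m" "x \<otimes>\<^bsub>\<Lambda>\<^esub> x = s \<odot>\<^bsub>\<Lambda>\<^esub> x"
      "\<And>z. z \<in> I \<Longrightarrow> \<exists>t \<in> carrier R - m. t \<odot>\<^bsub>\<Lambda>\<^esub> z \<in> genideal \<Lambda> {x}" using loc[OF m] by blast
    obtain e where "e \<in> frac (carrier R - m) I" "e \<otimes>\<^bsub>T\<^esub> e = e" "e \<noteq> \<zero>\<^bsub>T\<^esub>"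
      "\<And>K z. \<lbrakk>ideal K \<Lambda>; e \<in> frac (carrier R - m) K; z \<in> I\<rbrakk> \<Longrightarrow> \<exists>t \<in> carrier R - m. t \<odot>\<^bsub>\<Lambda>\<^esub> z \<in> K"
      by (rule local_idempotent[OF S_def one I r m x]) (assumption, rule that)
    then have "P m e" unfolding P_def using True by blast
    then show ?thesis by blast
  next
    case False
    have "\<one>\<^bsub>T\<^esub> \<in> frac (carrier R - m) I"
      using False rR r(2) by (intro fracI[of _ r _ "r \<odot>\<^bsub>\<Lambda>\<^esub> \<one>\<^bsub>\<Lambda>\<^esub>"]) (auto simp: scalar_def)
    moreover have "\<exists>t \<in> carrier R - m. t \<odot>\<^bsub>\<Lambda>\<^esub> z \<in> K"
      if K: "ideal K \<Lambda>" "\<one>\<^bsub>T\<^esub> \<in> frac (carrier R - m) K" and z: "z \<in> I" for K z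
    proof -
      obtain c k where c: "c \<in> carrier R - m" "k \<in> K" "scalar c \<otimes>\<^bsub>T\<^esub> \<one>\<^bsub>T\<^esub> = \<iota> k" using fracE[OF K(2)] .
      have "\<iota> (c \<odot>\<^bsub>\<Lambda>\<^esub> \<one>\<^bsub>\<Lambda>\<^esub>) = \<iota> k" using c by (simp add: scalar_def)
      then have "c \<odot>\<^bsub>\<Lambda>\<^esub> \<one>\<^bsub>\<Lambda>\<^esub> = k" by (subst (asm) \<iota>_eq_iff) (use c ideal.Icarr[OF K(1) c(2)] in auto)
      then have "c \<odot>\<^bsub>\<Lambda>\<^esub> z = k \<otimes>\<^bsub>\<Lambda>\<^esub> z" using smult_as_mult(1)[of c z] c(1) I.Icarr[OF z] by simp
      then show ?thesis using c(1) ideal.I_r_closed[OF K(1) c(2) I.Icarr[OF z]] by (intro bexI[of _ c]) simp_all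
    qed
    moreover have "\<one>\<^bsub>T\<^esub> \<noteq> \<zero>\<^bsub>T\<^esub>" using sa by (simp add: simple_artinian_def)
    moreover have "\<one>\<^bsub>T\<^esub> \<otimes>\<^bsub>T\<^esub> \<one>\<^bsub>T\<^esub> = \<one>\<^bsub>T\<^esub>" by simp
    ultimately have "P m \<one>\<^bsub>T\<^esub>" unfolding P_def by blast
    then show ?thesis by blast
  qed
  then obtain e where eP: "\<And>m. maximalideal m R \<Longrightarrow> P m (e m)" by metis
  have e: "e m \<in> frac (carrier R - m) I" "e m \<otimes>\<^bsub>T\<^esub> e m = e m" "e m \<noteq> \<zero>\<^bsub>T\<^esub>" "r \<notin> m \<Longrightarrow> e m = \<one>\<^bsub>T\<^esub>"
    if "maximalideal m R" for m using eP[OF that] unfolding P_def by blast+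
  have eT: "e m \<in> carrier T" if "maximalideal m R" for m by (rule frac_carrier[OF e(1)[OF that]])
  have gen: "\<exists>t \<in> carrier R - m. t \<odot>\<^bsub>\<Lambda>\<^esub> z \<in> K"
    if "maximalideal m R" "ideal K \<Lambda>" "e m \<in> frac (carrier R - m) K" "z \<in> I" for m K z
    using eP[OF that(1)] that(2-4) unfolding P_def by blast
  obtain f where f: "f \<in> carrier T" "f \<noteq> \<zero>\<^bsub>T\<^esub>" "f \<otimes>\<^bsub>T\<^esub> f = f"
    and free: "\<And>e. \<lbrakk>e \<in> carrier T; e \<otimes>\<^bsub>T\<^esub> e = e\<rbrakk> \<Longrightarrow> \<exists>d u w. free_over_idempotent T f e d u w"
    by (rule simple_artinian_free_over_idempotent[OF sa]) (rule that)
  define F where "F = e ` {m. maximalideal m R}"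
  have "F \<subseteq> insert \<one>\<^bsub>T\<^esub> (e ` {m. maximalideal m R \<and> r \<in> m})" using e(4) by (auto simp: F_def)
  moreover have "finite {m. maximalideal m R \<and> r \<in> m}" using h rR unfolding h_local_domain_def by blast
  ultimately have finF: "finite F" by (meson finite.insertI finite_imageI finite_subset)
  have "\<exists>d u w. free_over_idempotent T f a d u w" if "a \<in> F" for a
    using free eT e(2) that by (auto simp: F_def)
  then obtain d u w where duw: "\<And>a. a \<in> F \<Longrightarrow> free_over_idempotent T f a (d a) (u a) (w a)" by metis
  have d0: "0 < d a" if a: "a \<in> F" for a
  proof (rule ccontr)
    assume "\<not> 0 < d a"
    then have "a = \<zero>\<^bsub>T\<^esub>" using duw[OF a] by (simp add: free_over_idempotent_def)
    moreover obtain m where "maximalideal m R" "a = e m" using a by (auto simp: F_def)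
    ultimately show False using e(3)[of m] by simp
  qed
  define n where "n = prod d F"
  define l where "l = (\<lambda>a. n div d a)"
  have n0: "0 < n" unfolding n_def using d0 by (simp add: prod_pos)
  have nl: "n = l a * d a" if "a \<in> F" for a
    using finF that unfolding l_def n_def by (simp add: dvd_prodI)
  have l0: "0 < l a" if "a \<in> F" for a using n0 nl[OF that] by (metis gr0I mult_0)
  have eF: "e m \<in> F" if "maximalideal m R" for m using that by (auto simp: F_def)
  let ?V = "free_module (opposite T) {..<n} :: ('t, nat \<Rightarrow> 't) module"
  interpret V: left_module "opposite T" ?V by (rule O.free_left_module)
  define L0 where "L0 = {v \<in> carrier ?V. \<forall>k. f \<otimes>\<^bsub>T\<^esub> v k = v k}"
  let ?U = "\<lambda>a. patch_column T n (d a) (w a)" and ?W = "\<lambda>a. patch_row T (d a) (u a)"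
  have patch: "?U a q \<in> L0" "?U a q \<in> carrier ?V" "?W a q \<in> mod_hom (opposite T) ?V (regular_module (opposite T))"
    if a: "a \<in> F" for a q
    using T.patch_column_carrier[OF f(1,3) duw[OF a] d0[OF a] nl[OF a]] T.patch_column_fixed[OF f(1,3) duw[OF a] d0[OF a] nl[OF a]]
      T.patch_row_hom[OF f(1,3) duw[OF a] d0[OF a] nl[OF a]] by (auto simp: L0_def)
  \<comment> \<open>It contains the entries of all changes of coordinates.  A denominator with respect to \<open>I\<close> exists
      since \<open>T\<close> is the extension of \<open>I\<close>.\<close>
  define D where "D = (\<lambda>(a, a', q, q'). ?W a q (?U a' q')) ` (F \<times> F \<times> {..<n} \<times> {..<n})"
  have "finite D" unfolding D_def using finF by auto
  moreover have "D \<subseteq> frac S I"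
    unfolding ext(1) D_def using mod_homD(1)[OF patch(3) patch(2)] by auto
  ultimately obtain b where b: "b \<in> S" "\<And>a. a \<in> D \<Longrightarrow> scalar b \<otimes>\<^bsub>T\<^esub> a \<in> \<iota> ` I"
    by (rule common_denominator[OF I]) (rule that)
  have ln: "q < n" if "a \<in> F" "q < l a" for a q
    using nl[OF that(1)] d0[OF that(1)] that(2)
    by (metis le_square less_le_trans mult_le_mono2 nat_mult_1_right Suc_leI One_nat_def)
  show thesis
  proof (rule glued_idempotent_matrix[OF h I V.left_module_axioms, of L0 e "\<lambda>m. l (e m)" "\<lambda>m. ?U (e m)" "\<lambda>m. ?W (e m)" b])
    show "L0 \<subseteq> carrier ?V" by (auto simp: L0_def)
    show "scalar r \<odot>\<^bsub>?V\<^esub> v \<in> L0" if rv: "r \<in> carrier R" "v \<in> L0" for r v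
    proof -
      have vV: "v \<in> carrier ?V" "\<And>k. f \<otimes>\<^bsub>T\<^esub> v k = v k" using rv by (auto simp: L0_def)
      have vc: "v k \<in> carrier T" for k using vV(1) by (simp add: free_module_carrier)
      have "scalar r \<odot>\<^bsub>?V\<^esub> v \<in> carrier ?V" using V.smult_closed[of "scalar r" v] rv(1) vV by simp
      moreover have "f \<otimes>\<^bsub>T\<^esub> (v k \<otimes>\<^bsub>T\<^esub> scalar r) = v k \<otimes>\<^bsub>T\<^esub> scalar r" for k
        using f(1) vc rv(1) vV(2)[of k] by (simp flip: T.m_assoc)
      ultimately show ?thesis by (simp add: L0_def free_module_simps)
    qed
    show "e m \<in> frac (carrier R - m) I" if "maximalideal m R" for m by (rule e(1)[OF that])
    show "\<exists>t \<in> carrier R - m. t \<odot>\<^bsub>\<Lambda>\<^esub> z \<in> K"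
      if "maximalideal m R" "ideal K \<Lambda>" "e m \<in> frac (carrier R - m) K" "z \<in> I" for m K z
      by (rule gen[OF that])
    show "0 < l (e m)" if "maximalideal m R" for m by (rule l0[OF eF[OF that]])
    show "?U (e m) q \<in> L0" if "maximalideal m R" for m q by (rule patch(1)[OF eF[OF that]])
    show "?W (e m) q \<in> mod_hom (opposite T) ?V (regular_module (opposite T))" if "maximalideal m R" for m q
      by (rule patch(3)[OF eF[OF that]])
    show "(\<Oplus>\<^bsub>?V\<^esub>q\<in>{..<l (e m)}. ?W (e m) q v \<odot>\<^bsub>?V\<^esub> ?U (e m) q) = v" if m: "maximalideal m R" and v: "v \<in> L0" for m v
      using v by (intro T.patch_expand[OF f(1,3) duw[OF eF[OF m]] d0[OF eF[OF m]] nl[OF eF[OF m]]]) (auto simp: L0_def)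
    show "e m \<otimes>\<^bsub>T\<^esub> ?W (e m) q v = ?W (e m) q v" if m: "maximalideal m R" and v: "v \<in> L0" for m q v
      using v by (intro T.patch_row_fixed[OF f(1,3) duw[OF eF[OF m]] d0[OF eF[OF m]] nl[OF eF[OF m]]]) (auto simp: L0_def)
    show "?W (e m) q (?U (e m) q') = (if q = q' then e m else \<zero>\<^bsub>T\<^esub>)"
      if m: "maximalideal m R" and q: "q < l (e m)" "q' < l (e m)" for m q q'
      by (rule T.patch_row_column[OF f(1,3) duw[OF eF[OF m]] d0[OF eF[OF m]] nl[OF eF[OF m]] q])
    show "b \<in> carrier R" "b \<noteq> \<zero>\<^bsub>R\<^esub>" using b(1) S_def by auto
    show "scalar b \<otimes>\<^bsub>T\<^esub> ?W (e m) q (?U (e m') q') \<in> \<iota> ` I"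
      if "maximalideal m R" "q < l (e m)" "maximalideal m' R" "q' < l (e m')" for m q m' q'
    proof (rule b(2))
      show "?W (e m) q (?U (e m') q') \<in> D"
        unfolding D_def using that ln eF
        by (intro image_eqI[of _ _ "(e m, e m', q, q')"]) auto
    qed
  qed (rule that)
qed

end

text \<open>Two rings of fractions are in play: the radical of \<open>\<Lambda>\<^sub>m\<close> provides the local generators, and the
  gluing takes place in \<open>\<Lambda> \<otimes> Q\<close>.\<close>

lemma trace_ideal_idempotent_matrix:
  fixes R :: "('r, 'b) ring_scheme" and \<Lambda> :: "('r, 'a) module" and M :: "('a, 'm) module"
  assumes h: "h_local_domain R" and alg: "ring_algebra R \<Lambda>" and tf: "torsion_free R \<Lambda>"
    and lsp: "locally_semiperfect R \<Lambda>" and sa: "simple_artinian (tensor_algebra R \<Lambda> (fraction_field R))"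
    and I: "ideal I \<Lambda>"
    and tr: "(projective (opposite \<Lambda>) M \<and> trace_ideal (opposite \<Lambda>) M = I) \<or>
      (projective \<Lambda> M \<and> trace_ideal \<Lambda> M = I)"
  obtains n E where "idempotent_matrix \<Lambda> n E" "genideal \<Lambda> (entries n E) = I"
proof -
  interpret R: "domain" R using h by (simp add: h_local_domain_def)
  have S0: "submonoid (carrier R - {\<zero>\<^bsub>R\<^esub>}) R"
    by unfold_locales (use R.integral in auto)
  interpret Q: ring_of_fractions R \<Lambda> "carrier R - {\<zero>\<^bsub>R\<^esub>}"
    "tensor_algebra R \<Lambda> (localization R (carrier R - {\<zero>\<^bsub>R\<^esub>}))" "to_tensor R \<Lambda> (carrier R - {\<zero>\<^bsub>R\<^esub>})"
    by (rule tensor_localization_ring_of_fractions[OF alg R.domain_axioms tf S0]) simp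
  have loc: "\<exists>x \<in> I. \<exists>s \<in> carrier R - m. x \<otimes>\<^bsub>\<Lambda>\<^esub> x = s \<odot>\<^bsub>\<Lambda>\<^esub> x \<and>
      (\<forall>z \<in> I. \<exists>t \<in> carrier R - m. t \<odot>\<^bsub>\<Lambda>\<^esub> z \<in> genideal \<Lambda> {x})" if m: "maximalideal m R" for m
  proof -
    note cm = R.maximalideal_complement[OF m]
    interpret P: ring_of_fractions R \<Lambda> "carrier R - m"
      "tensor_algebra R \<Lambda> (localization R (carrier R - m))" "to_tensor R \<Lambda> (carrier R - m)"
      by (rule tensor_localization_ring_of_fractions[OF alg R.domain_axioms tf cm(1)]) (use cm(2) in simp)
    have "semiperfect (tensor_algebra R \<Lambda> (localization R (carrier R - m)))"
      using lsp m by (simp add: locally_semiperfect_def local_ring_at_def)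
    then obtain x s where "x \<in> I" "s \<in> carrier R - m" "x \<otimes>\<^bsub>\<Lambda>\<^esub> x = s \<odot>\<^bsub>\<Lambda>\<^esub> x"
      "\<And>z. z \<in> I \<Longrightarrow> \<exists>t \<in> carrier R - m. t \<odot>\<^bsub>\<Lambda>\<^esub> z \<in> genideal \<Lambda> {x}"
      by (rule P.semiperfect_trace_generator[OF _ I tr]) (rule that)
    then show ?thesis by blast
  qed
  show thesis
    by (rule Q.idempotent_matrix_of_local_idempotents[OF h sa[unfolded fraction_field_def] refl I loc]) (assumption, rule that)
qed

lemma finitely_generated_imp_countably_generated:
  assumes "finitely_generated R M" shows "countably_generated R M"
proof -
  obtain X where X: "X \<subseteq> carrier M" "finite X" "mod_span R M X = carrier M"
    using assms unfolding finitely_generated_def by (elim exE conjE)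
  then show ?thesis unfolding countably_generated_def by (intro exI[of _ X] conjI countable_finite)
qed

theorem lemma6p7:
  fixes R :: "('r, 'b) ring_scheme"
    and \<Lambda> :: "('r, 'a) module"
  assumes "h_local_domain R"
    and "ring_algebra R \<Lambda>"
    and "torsion_free R \<Lambda>"
    and "locally_semiperfect R \<Lambda>"
    and "simple_artinian (tensor_algebra R \<Lambda> (fraction_field R))"
  shows "(\<forall>I. ideal I \<Lambda> \<and>
            ((\<exists>M :: ('a, 'm) module. projective (opposite \<Lambda>) M \<and> trace_ideal (opposite \<Lambda>) M = I) \<or>
             (\<exists>M :: ('a, 'm) module. projective \<Lambda> M \<and> trace_ideal \<Lambda> M = I)) \<longrightarrow>
            (\<exists>N :: ('a, nat \<Rightarrow> 'a) module. projective (opposite \<Lambda>) N \<and>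
               finitely_generated (opposite \<Lambda>) N \<and> trace_ideal (opposite \<Lambda>) N = I)) \<and>
         traces_right \<Lambda> = traces_left \<Lambda>"
proof -
  interpret \<Lambda>: ring \<Lambda> by (rule ring_algebra.axioms(2)[OF assms(2)])
  interpret O: ring "opposite \<Lambda>" by (rule \<Lambda>.ring_opposite)
  have right: "\<exists>N :: ('a, nat \<Rightarrow> 'a) module. projective (opposite \<Lambda>) N \<and>
      finitely_generated (opposite \<Lambda>) N \<and> trace_ideal (opposite \<Lambda>) N = genideal \<Lambda> (entries n E)"
    and left: "\<exists>N :: ('a, nat \<Rightarrow> 'a) module. projective \<Lambda> N \<and>
      finitely_generated \<Lambda> N \<and> trace_ideal \<Lambda> N = genideal \<Lambda> (entries n E)"
    if E: "idempotent_matrix \<Lambda> n E" for n E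
  proof -
    obtain N :: "('a, nat \<Rightarrow> 'a) module" where N: "projective (opposite \<Lambda>) N" "finitely_generated (opposite \<Lambda>) N"
      "trace_ideal (opposite \<Lambda>) N = genideal (opposite \<Lambda>) (entries n (\<lambda>i j. E j i))"
      by (rule O.idempotent_matrix_module[OF \<Lambda>.idempotent_matrix_opposite[OF E]]) (rule that)
    have "genideal (opposite \<Lambda>) (entries n (\<lambda>i j. E j i)) = genideal \<Lambda> (entries n E)"
      by (subst genideal_opposite[OF \<Lambda>.ring_axioms], subst entries_transpose) (rule refl)
    then show "\<exists>N :: ('a, nat \<Rightarrow> 'a) module. projective (opposite \<Lambda>) N \<and>
      finitely_generated (opposite \<Lambda>) N \<and> trace_ideal (opposite \<Lambda>) N = genideal \<Lambda> (entries n E)"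
      using N by (intro exI[of _ N]) simp
    obtain N :: "('a, nat \<Rightarrow> 'a) module" where "projective \<Lambda> N" "finitely_generated \<Lambda> N"
      "trace_ideal \<Lambda> N = genideal \<Lambda> (entries n E)"
      by (rule \<Lambda>.idempotent_matrix_module[OF E]) (rule that)
    then show "\<exists>N :: ('a, nat \<Rightarrow> 'a) module. projective \<Lambda> N \<and>
      finitely_generated \<Lambda> N \<and> trace_ideal \<Lambda> N = genideal \<Lambda> (entries n E)" by blast
  qed
  note matrix = trace_ideal_idempotent_matrix[OF assms]
  have "\<exists>N :: ('a, nat \<Rightarrow> 'a) module. projective (opposite \<Lambda>) N \<and>
      finitely_generated (opposite \<Lambda>) N \<and> trace_ideal (opposite \<Lambda>) N = I"
    if I: "ideal I \<Lambda>" and M: "(\<exists>M :: ('a, 'm) module. projective (opposite \<Lambda>) M \<and> trace_ideal (opposite \<Lambda>) M = I) \<or>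
       (\<exists>M :: ('a, 'm) module. projective \<Lambda> M \<and> trace_ideal \<Lambda> M = I)" for I
  proof -
    from M obtain M :: "('a, 'm) module" where M: "(projective (opposite \<Lambda>) M \<and> trace_ideal (opposite \<Lambda>) M = I) \<or>
      (projective \<Lambda> M \<and> trace_ideal \<Lambda> M = I)" by (elim disjE exE) auto
    from matrix[OF I M] obtain n E where E: "idempotent_matrix \<Lambda> n E" "genideal \<Lambda> (entries n E) = I" .
    show ?thesis using right[OF E(1)] E(2) by simp
  qed
  moreover have "traces_right \<Lambda> = traces_left \<Lambda>"
  proof
    show "traces_right \<Lambda> \<subseteq> traces_left \<Lambda>"
    proof
      fix I assume "I \<in> traces_right \<Lambda>"
      then obtain M :: "('a, nat \<Rightarrow> 'a) module" where I: "ideal I \<Lambda>"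
        and M: "projective (opposite \<Lambda>) M" "trace_ideal (opposite \<Lambda>) M = I" by (auto simp: traces_right_def)
      from matrix[OF I disjI1[OF conjI[OF M]]]
      obtain n E where E: "idempotent_matrix \<Lambda> n E" "genideal \<Lambda> (entries n E) = I" .
      show "I \<in> traces_left \<Lambda>" unfolding traces_left_def using I left[OF E(1)] E(2) finitely_generated_imp_countably_generated
          by auto
    qed
    show "traces_left \<Lambda> \<subseteq> traces_right \<Lambda>"
    proof
      fix I assume "I \<in> traces_left \<Lambda>"
      then obtain M :: "('a, nat \<Rightarrow> 'a) module" where I: "ideal I \<Lambda>"
        and M: "projective \<Lambda> M" "trace_ideal \<Lambda> M = I" by (auto simp: traces_left_def)
      from matrix[OF I disjI2[OF conjI[OF M]]]
      obtain n E where E: "idempotent_matrix \<Lambda> n E" "genideal \<Lambda> (entries n E) = I" .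
      show "I \<in> traces_right \<Lambda>" unfolding traces_right_def using I right[OF E(1)] E(2) finitely_generated_imp_countably_generated
          by auto
    qed
  qed
  ultimately show ?thesis by blast
qed

end
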